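(* Let $f\colon[0,2]\to[0,+\infty]$ be a measurable function. There exists a convex domain $\Omega\subset\mathbb{R}^2$ such that the following holds. Let $\varphi_0\in S_0(\Omega)$ be the distance function $\varphi_0(x)=\operatorname{dist}(x,\partial\Omega)$. If $\varphi_0$ is a minimizer of $\mathcal{J}_f$ over $S_0(\Omega)$, then $$\limsup_{t\to0}\frac{f(t)}{t}\;\le\;2\,\limsup_{t\to2}f(t).$$
   Context: Domains $\Omega\subset\mathbb{R}^2$ are Lipschitz. Define $$S(\Omega)=\{\varphi\in\operatorname{Lip}(\Omega): |\nabla\varphi|=1\text{ a.e. and }\nabla\varphi\in BV(\Omega)\},\qquad S_0(\Omega)=\{\varphi\in S(\Omega):\varphi=0\text{ on }\partial\Omega\}.$$ For $\varphi\in S(\Omega)$, $J(\nabla\varphi)$ denotes the $\mathcal{H}^1$-rectifiable jump set of the $BV$ vector field $\nabla\varphi$, and $(\nabla\varphi)_\pm$ its traces on the two sides of this set. The energy is $$\mathcal{J}_f(\varphi)=\int_{J(\nabla\varphi)}f\big(|(\nabla\varphi)_+-(\nabla\varphi)_-|\big)\,d\mathcal{H}^1,$$ where $\mathcal{H}^1$ is the one-dimensional Hausdorff measure. 'Minimizer' means $\varphi_0\in S_0(\Omega)$ and $\mathcal{J}_f(\varphi_0)\le\mathcal{J}_f(\varphi)$ for all $\varphi\in S_0(\Omega)$. Conventions: $\limsup_{t\to0}f(t)/t=\lim_{\delta\to0^+}\sup\{f(t)/t: 0<t\le\delta\}$ and $\limsup_{t\to2}f(t)=\lim_{\delta\to0^+}\sup\{f(t):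 2-\delta\le t\le2\}$ (the value $t=2$ is included). *)

theory Defs
  imports "HOL-Analysis.Analysis"
begin

type_synonym plane = "real^2"

section \<open>One-dimensional Hausdorff measure\<close>

(* In dimension one the usual normalising constant is 1, so the gauge of a covering set is its
   diameter.  Boundedness is required since diameter is unspecified on unbounded sets. *)
definition hausdorff1_pre :: "real \<Rightarrow> 'a::metric_space set \<Rightarrow> ennreal" where
  "hausdorff1_pre \<delta> A =
     (INF C \<in> {C :: nat \<Rightarrow> 'a set. A \<subseteq> (\<Union>i. C i) \<and> (\<forall>i. bounded (C i) \<and> diameter (C i) \<le> \<delta>)}.
        \<Sum>i. ennreal (diameter (C i)))"

definition hausdorff1_outer :: "'a::metric_space set \<Rightarrow> ennreal" where
  "hausdorff1_outer A = (SUP \<delta>\<in>{0<..}. hausdorff1_pre \<delta> A)"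

(* lambda_system is the family of Caratheodory-measurable sets. *)
definition hausdorff1 :: "'a::metric_space measure" where
  "hausdorff1 = measure_of UNIV (lambda_system UNIV UNIV hausdorff1_outer) hausdorff1_outer"

lemma hausdorff1_pre_mono: "A \<subseteq> B \<Longrightarrow> hausdorff1_pre \<delta> A \<le> hausdorff1_pre \<delta> B"
  unfolding hausdorff1_pre_def by (rule INF_superset_mono) auto

lemma hausdorff1_pre_empty:
  assumes "\<delta> > 0" shows "hausdorff1_pre \<delta> ({} :: 'a::metric_space set) = 0"
proof -
  have "hausdorff1_pre \<delta> ({} :: 'a set) \<le> (\<Sum>i::nat. ennreal (diameter ({} :: 'a set)))"
    unfolding hausdorff1_pre_def by (rule INF_lower2[where i="\<lambda>_. {}"]) (use assms in auto)
  then show ?thesis by simp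
qed

lemma hausdorff1_pre_subadditive:
  fixes A :: "nat \<Rightarrow> 'a::metric_space set"
  shows "hausdorff1_pre \<delta> (\<Union>i. A i) \<le> (\<Sum>i. hausdorff1_pre \<delta> (A i))"
proof (cases "\<exists>i. hausdorff1_pre \<delta> (A i) = top")
  case True
  then obtain i where "hausdorff1_pre \<delta> (A i) = top" by blast
  moreover have "hausdorff1_pre \<delta> (A i) \<le> (\<Sum>i. hausdorff1_pre \<delta> (A i))"
    using sum_le_suminf[of "\<lambda>i. hausdorff1_pre \<delta> (A i)" "{i}"] by simp
  ultimately show ?thesis by (simp add: top_unique)
next
  case False
  show ?thesis
  proof (rule ennreal_le_epsilon)
    fix e :: real assume e: "0 < e"
    have "\<exists>C. A i \<subseteq> (\<Union>j. C j) \<and> (\<forall>j. bounded (C j) \<and> diameter (C j) \<le> \<delta>) \<and>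
        (\<Sum>j::nat. ennreal (diameter (C j))) \<le> hausdorff1_pre \<delta> (A i) + ennreal (e * (1/2)^Suc i)" for i
    proof -
      have "0 < e * (1/2)^Suc i" using e by simp
      from INF_approx_ennreal[OF this hausdorff1_pre_def[of \<delta> "A i"]] False
      obtain C where "C \<in> {C. A i \<subseteq> (\<Union>j. C j) \<and> (\<forall>j. bounded (C j) \<and> diameter (C j) \<le> \<delta>)}"
          "(\<Sum>j::nat. ennreal (diameter (C j))) < hausdorff1_pre \<delta> (A i) + ennreal (e * (1/2)^Suc i)"
        by (auto simp: infinity_ennreal_def)
      then show ?thesis by (intro exI[of _ C]) (simp add: less_imp_le)
    qed
    then obtain C where C: "\<And>i. A i \<subseteq> (\<Union>j. C i j)" "\<And>i j. bounded (C i j)"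
        "\<And>i j. diameter (C i j) \<le> \<delta>"
        "\<And>i. (\<Sum>j::nat. ennreal (diameter (C i j))) \<le> hausdorff1_pre \<delta> (A i) + ennreal (e * (1/2)^Suc i)"
      by metis
    define D where "D = (\<lambda>n. case prod_decode n of (i, j) \<Rightarrow> C i j)"
    have sub: "(\<Union>i. A i) \<subseteq> (\<Union>n. D n)"
    proof
      fix x assume "x \<in> (\<Union>i. A i)"
      then obtain i j where "x \<in> C i j" using C(1) by blast
      then have "x \<in> D (prod_encode (i, j))" by (simp add: D_def)
      then show "x \<in> (\<Union>n. D n)" by blast
    qed
    have "hausdorff1_pre \<delta> (\<Union>i. A i) \<le> (\<Sum>n. ennreal (diameter (D n)))"
      unfolding hausdorff1_pre_def
      by (rule INF_lower) (use sub C(2,3) in \<open>auto simp: D_def split: prod.split\<close>)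
    also have "\<dots> = (\<Sum>i. \<Sum>j. ennreal (diameter (C i j)))"
      using suminf_ennreal_2dimen[of "\<lambda>i. \<Sum>j. ennreal (diameter (C i j))"
          "\<lambda>(i,j). ennreal (diameter (C i j))"]
      by (simp add: D_def o_def case_prod_beta)
    also have "\<dots> \<le> (\<Sum>i. hausdorff1_pre \<delta> (A i) + ennreal (e * (1/2)^Suc i))"
      by (intro suminf_le C(4)) auto
    also have "\<dots> = (\<Sum>i. hausdorff1_pre \<delta> (A i)) + (\<Sum>i. ennreal (e * (1/2)^Suc i))"
      by (rule suminf_add[symmetric]) auto
    also have "(\<Sum>i. ennreal (e * (1/2)^Suc i)) = ennreal e"
    proof (rule suminf_ennreal_eq)
      show "(\<lambda>i. e * (1/2)^Suc i) sums e"
        using sums_mult[OF power_half_series, of e] by simp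
    qed (use e in auto)
    finally show "hausdorff1_pre \<delta> (\<Union>i. A i) \<le> (\<Sum>i. hausdorff1_pre \<delta> (A i)) + ennreal e" .
  qed
qed

lemma outer_measure_hausdorff1:
  "outer_measure_space UNIV (hausdorff1_outer :: 'a::metric_space set \<Rightarrow> ennreal)"
  unfolding outer_measure_space_def positive_def increasing_def countably_subadditive_def
proof (intro conjI ballI allI impI)
  show "hausdorff1_outer ({} :: 'a set) = 0"
    by (auto simp: hausdorff1_outer_def hausdorff1_pre_empty intro!: SUP_eq_const)
next
  fix A B :: "'a set" assume "A \<subseteq> B"
  then show "hausdorff1_outer A \<le> hausdorff1_outer B"
    unfolding hausdorff1_outer_def by (intro SUP_mono) (auto intro: hausdorff1_pre_mono)
next
  fix A :: "nat \<Rightarrow> 'a set"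
  show "hausdorff1_outer (\<Union>i. A i) \<le> (\<Sum>i. hausdorff1_outer (A i))"
    unfolding hausdorff1_outer_def[of "\<Union>i. A i"]
  proof (rule SUP_least)
    fix \<delta> :: real assume "\<delta> \<in> {0<..}"
    have "hausdorff1_pre \<delta> (\<Union>i. A i) \<le> (\<Sum>i. hausdorff1_pre \<delta> (A i))"
      by (rule hausdorff1_pre_subadditive)
    also have "\<dots> \<le> (\<Sum>i. hausdorff1_outer (A i))"
      unfolding hausdorff1_outer_def by (intro suminf_le SUP_upper \<open>\<delta> \<in> {0<..}\<close>) auto
    finally show "hausdorff1_pre \<delta> (\<Union>i. A i) \<le> (\<Sum>i. hausdorff1_outer (A i))" .
  qed
qed

lemma measure_space_hausdorff1:
  "measure_space UNIV (lambda_system UNIV UNIV hausdorff1_outer) hausdorff1_outer"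
  using sigma_algebra.caratheodory_lemma[OF sigma_algebra_Pow[of UNIV]] outer_measure_hausdorff1
  by simp

lemma space_hausdorff1 [simp]: "space hausdorff1 = UNIV"
  by (simp add: hausdorff1_def space_measure_of_conv)

lemma sets_hausdorff1:
  "sets (hausdorff1 :: 'a::metric_space measure) = lambda_system UNIV UNIV hausdorff1_outer"
proof -
  have "sigma_algebra (UNIV :: 'a set) (lambda_system UNIV UNIV hausdorff1_outer)"
    using measure_space_hausdorff1[where ?'a = 'a] by (simp add: measure_space_def)
  from sigma_algebra.sigma_sets_eq[OF this] show ?thesis
    by (simp add: hausdorff1_def sets_measure_of_conv)
qed

lemma emeasure_hausdorff1:
  fixes A :: "'a::metric_space set"
  assumes "A \<in> sets hausdorff1"
  shows "emeasure hausdorff1 A = hausdorff1_outer A"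
proof (rule emeasure_measure_of[OF hausdorff1_def])
  show "positive (sets (hausdorff1 :: 'a measure)) hausdorff1_outer"
    and "countably_additive (sets (hausdorff1 :: 'a measure)) hausdorff1_outer"
    using measure_space_hausdorff1[where ?'a = 'a]
    unfolding measure_space_def sets_hausdorff1 by blast+
qed (use assms in simp_all)


section \<open>Lipschitz domains\<close>

definition lipschitz_domain :: "plane set \<Rightarrow> bool" where
  "lipschitz_domain \<Omega> \<longleftrightarrow> open \<Omega> \<and> connected \<Omega> \<and> \<Omega> \<noteq> {} \<and>
     (\<forall>p\<in>frontier \<Omega>. \<exists>r>0. \<exists>e1 e2. \<exists>g::real \<Rightarrow> real. \<exists>L.
        norm e1 = 1 \<and> norm e2 = 1 \<and> e1 \<bullet> e2 = 0 \<and> L-lipschitz_on UNIV g \<and>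
        \<Omega> \<inter> ball p r = {x \<in> ball p r. g (x \<bullet> e1) < x \<bullet> e2})"


section \<open>Gradients and functions of bounded variation\<close>

definition grad :: "(plane \<Rightarrow> real) \<Rightarrow> plane \<Rightarrow> plane" where
  "grad \<phi> x = (THE D. GDERIV \<phi> x :> D)"

definition divergence :: "(plane \<Rightarrow> plane) \<Rightarrow> plane \<Rightarrow> real" where
  "divergence \<psi> x = trace (jacobian \<psi> (at x))"

definition test_field :: "plane set \<Rightarrow> (plane \<Rightarrow> plane) \<Rightarrow> bool" where
  "test_field \<Omega> \<psi> \<longleftrightarrow>
     \<psi> differentiable_on UNIV \<and>
     (\<forall>h. continuous_on UNIV (\<lambda>x. frechet_derivative \<psi> (at x) h)) \<and>
     compact (closure {x. \<psi> x \<noteq> 0}) \<and> closure {x. \<psi> x \<noteq> 0} \<subseteq> \<Omega> \<and>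
     (\<forall>x. norm (\<psi> x) \<le> 1)"

definition BV :: "plane set \<Rightarrow> (plane \<Rightarrow> real) set" where
  "BV \<Omega> = {u. set_integrable lebesgue \<Omega> u \<and>
     bdd_above {LINT x:\<Omega>|lebesgue. u x * divergence \<psi> x | \<psi>. test_field \<Omega> \<psi>}}"

definition BV_field :: "plane set \<Rightarrow> (plane \<Rightarrow> plane) set" where
  "BV_field \<Omega> = {u. \<forall>i. (\<lambda>x. u x $ i) \<in> BV \<Omega>}"


section \<open>Approximate jump points and one-sided traces\<close>

definition average :: "plane set \<Rightarrow> (plane \<Rightarrow> real) \<Rightarrow> real" where
  "average A g = (LINT y:A|lebesgue. g y) / measure lebesgue A"

definition half_ball :: "plane \<Rightarrow> real \<Rightarrow> plane \<Rightarrow> plane set" where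
  "half_ball x r \<nu> = {y \<in> ball x r. (y - x) \<bullet> \<nu> > 0}"

definition jump_triple :: "(plane \<Rightarrow> plane) \<Rightarrow> plane \<Rightarrow> plane \<Rightarrow> plane \<Rightarrow> plane \<Rightarrow> bool" where
  "jump_triple u x a b \<nu> \<longleftrightarrow> a \<noteq> b \<and> norm \<nu> = 1 \<and>
     ((\<lambda>r. average (half_ball x r \<nu>) (\<lambda>y. norm (u y - a))) \<longlongrightarrow> 0) (at_right 0) \<and>
     ((\<lambda>r. average (half_ball x r (- \<nu>)) (\<lambda>y. norm (u y - b))) \<longlongrightarrow> 0) (at_right 0)"

definition jump_set :: "plane set \<Rightarrow> (plane \<Rightarrow> plane) \<Rightarrow> plane set" where
  "jump_set \<Omega> u = {x \<in> \<Omega>. \<exists>a b \<nu>. jump_triple u x a b \<nu>}"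

(* A jump triple is unique up to exchanging (a, b, nu) with (b, a, -nu), so the traces are
   determined up to their order. *)
definition traces :: "(plane \<Rightarrow> plane) \<Rightarrow> plane \<Rightarrow> plane \<times> plane" where
  "traces u x = (SOME (a, b). \<exists>\<nu>. jump_triple u x a b \<nu>)"

definition trace_plus :: "(plane \<Rightarrow> plane) \<Rightarrow> plane \<Rightarrow> plane" where
  "trace_plus u x = fst (traces u x)"

definition trace_minus :: "(plane \<Rightarrow> plane) \<Rightarrow> plane \<Rightarrow> plane" where
  "trace_minus u x = snd (traces u x)"


section \<open>The admissible classes and the energy\<close>

definition S_class :: "plane set \<Rightarrow> (plane \<Rightarrow> real) set" where
  "S_class \<Omega> = {\<phi>. (\<exists>L. L-lipschitz_on \<Omega> \<phi>) \<and>
     (AE x in lebesgue_on \<Omega>. \<phi> differentiable (at x) \<and> norm (grad \<phi> x) = 1) \<and>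
     grad \<phi> \<in> BV_field \<Omega>}"

(* Functions are total in HOL; only their values on \<Omega> matter, so the boundary values are those
   of the continuous extension from \<Omega>. *)
definition S0_class :: "plane set \<Rightarrow> (plane \<Rightarrow> real) set" where
  "S0_class \<Omega> = {\<phi> \<in> S_class \<Omega>. \<forall>p\<in>frontier \<Omega>. (\<phi> \<longlongrightarrow> 0) (at p within \<Omega>)}"

definition energy :: "(real \<Rightarrow> ennreal) \<Rightarrow> plane set \<Rightarrow> (plane \<Rightarrow> real) \<Rightarrow> ennreal" where
  "energy f \<Omega> \<phi> =
     (\<integral>\<^sup>+x\<in>jump_set \<Omega> (grad \<phi>).
        f (norm (trace_plus (grad \<phi>) x - trace_minus (grad \<phi>) x)) \<partial>hausdorff1)"

definition minimizer :: "(real \<Rightarrow> ennreal) \<Rightarrow> plane set \<Rightarrow> (plane \<Rightarrow> real) \<Rightarrow> bool" where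
  "minimizer f \<Omega> \<phi>\<^sub>0 \<longleftrightarrow> \<phi>\<^sub>0 \<in> S0_class \<Omega> \<and> (\<forall>\<phi>\<in>S0_class \<Omega>. energy f \<Omega> \<phi>\<^sub>0 \<le> energy f \<Omega> \<phi>)"

definition boundary_distance :: "plane set \<Rightarrow> plane \<Rightarrow> real" where
  "boundary_distance \<Omega> x = infdist x (frontier \<Omega>)"


section \<open>Upper limits at the end points\<close>

definition limsup_slope_0 :: "(real \<Rightarrow> ennreal) \<Rightarrow> ennreal" where
  "limsup_slope_0 f = Limsup (at_right 0) (\<lambda>t. f t / ennreal t)"

(* The filter contains the point 2 itself, unlike at_left 2. *)
definition limsup_2 :: "(real \<Rightarrow> ennreal) \<Rightarrow> ennreal" where
  "limsup_2 f = Limsup (inf (nhds 2) (principal {..2})) f"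

lemma tendsto_Limsup_SUP:
  fixes g :: "real \<Rightarrow> ennreal" and A :: "real \<Rightarrow> real set"
  assumes mono: "\<And>d e. 0 < d \<Longrightarrow> d \<le> e \<Longrightarrow> A d \<subseteq> A e"
    and ev: "\<And>P. eventually P F \<longleftrightarrow> (\<exists>d>0. \<forall>t\<in>A d. P t)"
  shows "((\<lambda>d. SUP t\<in>A d. g t) \<longlongrightarrow> Limsup F g) (at_right 0)"
proof (rule order_tendstoI)
  fix a assume a: "a < Limsup F g"
  have "Limsup F g \<le> (SUP t\<in>A d. g t)" if "d > 0" for d
    unfolding Limsup_def by (rule INF_lower2[where i="\<lambda>t. t \<in> A d"]) (use that ev in auto)
  then show "\<forall>\<^sub>F d in at_right 0. a < (SUP t\<in>A d. g t)"
    using a by (auto simp: eventually_at_right_field intro!: exI[of _ 1] intro: less_le_trans)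
next
  fix a assume "Limsup F g < a"
  then obtain P where P: "eventually P F" "(SUP t\<in>{t. P t}. g t) < a"
    unfolding Limsup_def INF_less_iff by auto
  then obtain d where d: "d > 0" "\<forall>t\<in>A d. P t" using ev by auto
  have "(SUP t\<in>A e. g t) < a" if "0 < e" "e < d" for e
  proof -
    have "(SUP t\<in>A e. g t) \<le> (SUP t\<in>{t. P t}. g t)"
      by (rule SUP_subset_mono) (use mono[of e d] that d in auto)
    then show ?thesis using P(2) by (rule le_less_trans)
  qed
  then show "\<forall>\<^sub>F d in at_right 0. (SUP t\<in>A d. g t) < a"
    using d(1) by (auto simp: eventually_at_right_field)
qed

lemma limsup_slope_0_lim:
  "((\<lambda>\<delta>. SUP t\<in>{0<..\<delta>}. f t / ennreal t) \<longlongrightarrow> limsup_slope_0 f) (at_right 0)"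
  unfolding limsup_slope_0_def
proof (rule tendsto_Limsup_SUP)
  fix P :: "real \<Rightarrow> bool"
  show "eventually P (at_right 0) \<longleftrightarrow> (\<exists>d>0. \<forall>t\<in>{0<..d}. P t)"
  proof
    assume "eventually P (at_right 0)"
    then obtain b where b: "b > 0" "\<forall>y>0. y < b \<longrightarrow> P y"
      unfolding eventually_at_right_field by blast
    have "\<forall>t\<in>{0<..b/2}. P t" using b by auto
    then show "\<exists>d>0. \<forall>t\<in>{0<..d}. P t" using b(1) by (intro exI[of _ "b/2"]) simp
  next
    assume "\<exists>d>0. \<forall>t\<in>{0<..d}. P t"
    then obtain d where d: "d > 0" "\<forall>t\<in>{0<..d}. P t" by blast
    have "\<forall>y>0. y < d \<longrightarrow> P y" using d(2) by simp
    then show "eventually P (at_right 0)"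
      unfolding eventually_at_right_field using d(1) by blast
  qed
qed auto

lemma limsup_2_lim:
  "((\<lambda>\<delta>. SUP t\<in>{2-\<delta>..2}. f t) \<longlongrightarrow> limsup_2 f) (at_right 0)"
  unfolding limsup_2_def
proof (rule tendsto_Limsup_SUP)
  fix P :: "real \<Rightarrow> bool"
  show "eventually P (inf (nhds 2) (principal {..2})) \<longleftrightarrow> (\<exists>d>0. \<forall>t\<in>{2-d..2}. P t)"
    unfolding eventually_inf_principal eventually_nhds_metric
  proof (safe)
    fix d :: real assume "0 < d" "\<forall>x. dist x 2 < d \<longrightarrow> x \<in> {..2} \<longrightarrow> P x"
    then show "\<exists>d>0. \<forall>t\<in>{2-d..2}. P t" by (intro exI[of _ "d/2"]) (auto simp: dist_real_def)
  next
    fix d :: real assume "0 < d" "\<forall>t\<in>{2-d..2}. P t"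
    then show "\<exists>d>0. \<forall>x. dist x 2 < d \<longrightarrow> x \<in> {..2} \<longrightarrow> P x"
      by (intro exI[of _ d]) (auto simp: dist_real_def)
  qed
qed auto

end

theory Submission
  imports Defs
begin

text \<open>
  The domain is the neighbourhood of radius \<open>1 / 2\<close> of a polygon circumscribed about the unit circle
  with \<open>N + 1\<close> sides, \<open>N\<close> of whose exterior angles equal \<open>2 * \<theta>\<close>, where \<open>2 * sin \<theta>\<close> is a
  point close to \<open>0\<close> at which \<open>f t / t\<close> is nearly maximal and \<open>N\<close> is about \<open>pi / \<theta>\<close>. The boundary
  distance has, for each of these angles, a ridge of length at least \<open>1\<close> with jump \<open>2 * sin \<theta>\<close>; so
  its energy is at least \<open>N * f (2 * sin \<theta>)\<close>.

  Since the corners of the domain are rounded, the boundary distance is continuously differentiable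
  outside the polygon. Folding it there into a cone centred at the origin removes all ridges, at the
  price of a jump close to \<open>2\<close> along one convex curve. The nearest-point projection of a circle
  covers this curve, which bounds its length by \<open>2 * pi * (R + 1 / 2)\<close> with \<open>R\<close> close to \<open>1\<close>. Both
  functions are differences of convex Lipschitz functions, which gives the \<open>BV\<close> bounds.
\<close>


subsection \<open>Hausdorff measure\<close>

text \<open>What decides is a ratio of constants. If the inequality fails, there is \<open>M\<close>
  with \<open>f t > 2 * M * t\<close> for arbitrarily small \<open>t\<close> and
  \<open>f t < M\<close> near \<open>2\<close>. The ridges of the distance then cost about
  \<open>(pi / \<theta>) * 2 * M * 2 * \<theta> = 4 * pi * M\<close>, the jump curve of the
  competitor about \<open>M * 2 * pi * (1 + 1 / 2) = 3 * pi * M\<close>. A rounding radius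
  \<open>r\<close> gives \<open>2 * pi * (1 + r) * M\<close> for the latter, so every
  \<open>r < 1\<close> leaves a gap, and \<open>1 / 2\<close> is a convenient choice. With sharp
  corners the ridges would run up to the boundary, and a competitor that equals the distance near
  the boundary would retain their outer parts. One exterior angle is left over because
  \<open>pi / \<theta>\<close> need not be an integer; it is at most \<open>2 * \<theta>\<close>,
  which keeps the polygon in the disc of radius \<open>1 / cos \<theta>\<close>. The domain depends
  on \<open>f\<close> through \<theta>; when the inequality holds, any such domain serves.\<close>

lemma hausdorff1_outer_mono: "A \<subseteq> B \<Longrightarrow> hausdorff1_outer A \<le> hausdorff1_outer B"
  unfolding hausdorff1_outer_def by (intro SUP_mono) (auto intro: hausdorff1_pre_mono)

lemma hausdorff1_outer_empty [simp]: "hausdorff1_outer {} = 0"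
  using outer_measure_hausdorff1 by (auto simp: outer_measure_space_def positive_def)

lemma hausdorff1_outer_UN_le:
  "hausdorff1_outer (\<Union>i::nat. A i) \<le> (\<Sum>i. hausdorff1_outer (A i))"
  unfolding hausdorff1_outer_def[of "\<Union>i. A i"]
proof (rule SUP_least)
  fix \<delta> :: real assume "\<delta> \<in> {0<..}"
  then have "(\<Sum>i. hausdorff1_pre \<delta> (A i)) \<le> (\<Sum>i. hausdorff1_outer (A i))"
    unfolding hausdorff1_outer_def by (intro suminf_le SUP_upper) auto
  with hausdorff1_pre_subadditive
  show "hausdorff1_pre \<delta> (\<Union>i. A i) \<le> (\<Sum>i. hausdorff1_outer (A i))"
    by (rule order_trans)
qed

lemma hausdorff1_outer_Un_le: "hausdorff1_outer (A \<union> B) \<le> hausdorff1_outer A + hausdorff1_outer B"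
proof -
  have "hausdorff1_outer (\<Union>i. binaryset A B i) \<le> (\<Sum>i. hausdorff1_outer (binaryset A B i))"
    by (rule hausdorff1_outer_UN_le)
  also have "\<dots> = hausdorff1_outer A + hausdorff1_outer B"
    by (rule suminf_binaryset_eq) simp
  finally show ?thesis by (simp add: UN_binaryset_eq)
qed

lemma hausdorff1_pre_antimono: "\<delta> \<le> \<delta>' \<Longrightarrow> hausdorff1_pre \<delta>' A \<le> hausdorff1_pre \<delta> A"
  unfolding hausdorff1_pre_def by (rule INF_superset_mono) (auto intro: order_trans)

text \<open>A covering set of diameter at most \<open>\<delta> < d\<close> meets at most one of the
  two sets, so every covering of the union splits into coverings of \<open>A\<close> and
  \<open>B\<close> without raising the total diameter.\<close>

lemma hausdorff1_pre_separated:
  fixes A B :: "'a::metric_space set"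
  assumes sep: "\<And>x y. x \<in> A \<Longrightarrow> y \<in> B \<Longrightarrow> d \<le> dist x y" and "\<delta> < d"
  shows "hausdorff1_pre \<delta> A + hausdorff1_pre \<delta> B \<le> hausdorff1_pre \<delta> (A \<union> B)"
  unfolding hausdorff1_pre_def[of \<delta> "A \<union> B"]
proof (rule INF_greatest)
  fix C :: "nat \<Rightarrow> 'a set"
  assume "C \<in> {C. A \<union> B \<subseteq> (\<Union>i. C i) \<and> (\<forall>i. bounded (C i) \<and> diameter (C i) \<le> \<delta>)}"
  then have cov: "A \<subseteq> (\<Union>i. C i)" "B \<subseteq> (\<Union>i. C i)"
    and C: "\<And>i. bounded (C i)" "\<And>i. diameter (C i) \<le> \<delta>" by auto
  have \<delta>: "0 \<le> \<delta>" using C(2)[of 0] diameter_ge_0[OF C(1)[of 0]] by linarith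
  \<comment> \<open>A member that misses \<open>X\<close> becomes empty, with diameter 0;
    nonnegativity of \<delta> makes this admissible.\<close>
  define D where "D = (\<lambda>X i. if C i \<inter> X \<noteq> {} then C i else {})"
  have pre: "hausdorff1_pre \<delta> X \<le> (\<Sum>i. ennreal (diameter (D X i)))" if "X \<subseteq> (\<Union>i. C i)" for X
    unfolding hausdorff1_pre_def
    by (rule INF_lower) (use that C \<delta> in \<open>force simp: D_def\<close>)
  have D0: "0 \<le> diameter (D X i)" for X i by (simp add: D_def diameter_ge_0 C)
  have *: "diameter (D A i) + diameter (D B i) \<le> diameter (C i)" for i
  proof (cases "C i \<inter> A \<noteq> {} \<and> C i \<inter> B \<noteq> {}")
    case True
    then obtain x y where "x \<in> C i \<inter> A" "y \<in> C i \<inter> B" by blast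
    then have "d \<le> dist x y" "dist x y \<le> diameter (C i)"
      using sep diameter_bounded_bound[OF C(1)] by auto
    with C(2)[of i] \<open>\<delta> < d\<close> show ?thesis by linarith
  qed (auto simp: D_def diameter_ge_0 C)
  have le: "ennreal (diameter (D A i)) + ennreal (diameter (D B i)) \<le> ennreal (diameter (C i))" for i
    using ennreal_leI[OF *[of i]] by (simp add: ennreal_plus D0)
  have "hausdorff1_pre \<delta> A + hausdorff1_pre \<delta> B
      \<le> (\<Sum>i. ennreal (diameter (D A i))) + (\<Sum>i. ennreal (diameter (D B i)))"
    by (intro add_mono pre cov)
  also have "\<dots> = (\<Sum>i. ennreal (diameter (D A i)) + ennreal (diameter (D B i)))"
    by (rule suminf_add) auto
  also have "\<dots> \<le> (\<Sum>i. ennreal (diameter (C i)))" by (intro suminf_le le) auto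
  finally show "hausdorff1_pre \<delta> A + hausdorff1_pre \<delta> B \<le> (\<Sum>i. ennreal (diameter (C i)))" .
qed

text \<open>Once \<delta> is below \<open>d\<close> the premeasures add; since they grow as \<delta>
  shrinks, this passes to the supremum.\<close>

lemma hausdorff1_outer_separated:
  fixes A B :: "'a::metric_space set"
  assumes sep: "\<And>x y. x \<in> A \<Longrightarrow> y \<in> B \<Longrightarrow> d \<le> dist x y" and "0 < d"
  shows "hausdorff1_outer A + hausdorff1_outer B \<le> hausdorff1_outer (A \<union> B)"
proof -
  have "hausdorff1_outer A + hausdorff1_outer B
      = (SUP \<delta>\<in>{0<..}. hausdorff1_pre \<delta> A + hausdorff1_pre \<delta> B)"
    unfolding hausdorff1_outer_def
  proof (rule SUP_add_directed_ennreal[symmetric])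
    fix i j :: real assume "i \<in> {0<..}" "j \<in> {0<..}"
    then show "\<exists>k\<in>{0<..}. hausdorff1_pre i A + hausdorff1_pre j B
        \<le> hausdorff1_pre k A + hausdorff1_pre k B"
      by (intro bexI[of _ "min i j"] add_mono hausdorff1_pre_antimono) auto
  qed
  also have "\<dots> \<le> hausdorff1_outer (A \<union> B)"
  proof (rule SUP_least)
    fix \<delta> :: real assume "\<delta> \<in> {0<..}"
    then have m: "0 < min \<delta> (d/2)" using \<open>0 < d\<close> by simp
    have "hausdorff1_pre \<delta> A + hausdorff1_pre \<delta> B
        \<le> hausdorff1_pre (min \<delta> (d/2)) A + hausdorff1_pre (min \<delta> (d/2)) B"
      by (intro add_mono hausdorff1_pre_antimono) auto
    also have "\<dots> \<le> hausdorff1_pre (min \<delta> (d/2)) (A \<union> B)"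
      by (rule hausdorff1_pre_separated[OF sep]) (use \<open>0 < d\<close> in auto)
    also have "\<dots> \<le> hausdorff1_outer (A \<union> B)"
      unfolding hausdorff1_outer_def by (rule SUP_upper) (use m in simp)
    finally show "hausdorff1_pre \<delta> A + hausdorff1_pre \<delta> B \<le> hausdorff1_outer (A \<union> B)" .
  qed
  finally show ?thesis .
qed

text \<open>Each set only has to keep a positive distance from the union of its predecessors. The
  distance may depend on \<open>n\<close>, as it does for shells that accumulate at a closed
  set.\<close>

lemma hausdorff1_outer_sum_separated:
  fixes D :: "nat \<Rightarrow> 'a::metric_space set"
  assumes "\<And>n. \<exists>d>0. \<forall>x\<in>(\<Union>k<n. D k). \<forall>y\<in>D n. d \<le> dist x y"
  shows "(\<Sum>k<n. hausdorff1_outer (D k)) \<le> hausdorff1_outer (\<Union>k<n. D k)"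
proof (induction n)
  case (Suc n)
  obtain d where d: "d > 0" "\<And>x y. x \<in> (\<Union>k<n. D k) \<Longrightarrow> y \<in> D n \<Longrightarrow> d \<le> dist x y"
    using assms[of n] by blast
  have "(\<Sum>k<Suc n. hausdorff1_outer (D k)) \<le> hausdorff1_outer (\<Union>k<n. D k) + hausdorff1_outer (D n)"
    using Suc by (simp add: add_right_mono)
  also have "\<dots> \<le> hausdorff1_outer ((\<Union>k<n. D k) \<union> D n)"
    by (rule hausdorff1_outer_separated[OF d(2,1)])
  also have "(\<Union>k<n. D k) \<union> D n = (\<Union>k<Suc n. D k)" by (auto simp: less_Suc_eq)
  finally show ?case .
qed simp

text \<open>Caratheodory's criterion: the shells \<open>D k\<close> around \<open>F\<close> of equal parity are separated, so their
  measures are summable and the part of \<open>A\<close> close to \<open>F\<close> is negligible.\<close>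

lemma closed_in_sets_hausdorff1:
  fixes F :: "'a::metric_space set"
  assumes "closed F" shows "F \<in> sets hausdorff1"
proof (cases "F = {}")
  case False
  have key: "hausdorff1_outer (A \<inter> F) + hausdorff1_outer (A - F) \<le> hausdorff1_outer A" for A :: "'a set"
  proof (cases "hausdorff1_outer A = top")
    case fin: False
    define c where "c = (\<lambda>k::nat. 1 / real (Suc k))"
    have c_mono: "c (Suc k) \<le> c k" for k by (simp add: c_def field_simps)
    have c_anti: "c k \<le> c j" if "j \<le> k" for j k using that by (simp add: c_def field_simps)
    have c_strict: "c k < c j" if "j < k" for j k using that by (simp add: c_def field_simps)
    define B where "B = (\<lambda>k. {x \<in> A. c k \<le> infdist x F})"
    define D where "D = (\<lambda>k. B (Suc k) - B k)"
    have D_far: "c (Suc i) \<le> infdist x F" if "x \<in> D i" for i x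
      using that by (auto simp: D_def B_def)
    have D_near: "infdist x F < c i" if "x \<in> D i" for i x
      using that by (auto simp: D_def B_def)
    have half: "(\<Sum>k<n. hausdorff1_outer (D (2 * k + p))) \<le> hausdorff1_outer A" for n p
    proof -
      have "(\<Sum>k<n. hausdorff1_outer (D (2 * k + p))) \<le> hausdorff1_outer (\<Union>k<n. D (2 * k + p))"
      proof (rule hausdorff1_outer_sum_separated)
        fix n
        show "\<exists>d>0. \<forall>x\<in>(\<Union>k<n. D (2 * k + p)). \<forall>y\<in>D (2 * n + p). d \<le> dist x y"
        proof (cases n)
          case (Suc m)
          show ?thesis
          \<comment> \<open>Earlier shells lie at distance at least \<open>c (2*m+p+1)\<close> from
            \<open>F\<close>, the new one closer than \<open>c (2*n+p)\<close>; the skipped shell of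
            the other parity leaves this gap.\<close>
          proof (intro exI[of _ "c (2*m+p+1) - c (2*n+p)"] conjI ballI)
            show "0 < c (2*m+p+1) - c (2*n+p)" using c_strict[of "2*m+p+1" "2*n+p"] Suc by simp
            fix x y assume "x \<in> (\<Union>k<n. D (2 * k + p))" and y: "y \<in> D (2 * n + p)"
            then obtain k where k: "k < n" "x \<in> D (2*k+p)" by blast
            have "c (2*m+p+1) \<le> c (Suc (2*k+p))" by (rule c_anti) (use k Suc in simp)
            also have "\<dots> \<le> infdist x F" by (rule D_far[OF k(2)])
            finally show "c (2*m+p+1) - c (2*n+p) \<le> dist x y"
              using D_near[OF y] infdist_triangle[of x F y] by linarith
          qed
        qed (auto intro: exI[of _ 1])
      qed
      also have "\<dots> \<le> hausdorff1_outer A"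
        by (rule hausdorff1_outer_mono) (auto simp: D_def B_def)
      finally show ?thesis .
    qed
    have all: "(\<Sum>k<n. hausdorff1_outer (D k)) \<le> 2 * hausdorff1_outer A" for n
    proof -
      have "(\<Sum>k<n. hausdorff1_outer (D k)) \<le> (\<Sum>k<2*n. hausdorff1_outer (D k))"
        by (rule sum_mono2) auto
      also have "\<dots> = (\<Sum>k<n. hausdorff1_outer (D (2*k+0))) + (\<Sum>k<n. hausdorff1_outer (D (2*k+1)))"
        by (induction n) (auto simp: algebra_simps)
      also have "\<dots> \<le> 2 * hausdorff1_outer A"
        unfolding mult_2[of "hausdorff1_outer A"] by (intro add_mono half)
      finally show ?thesis .
    qed
    define r where "r = (\<lambda>k. enn2real (hausdorff1_outer (D k)))"
    have D_fin: "hausdorff1_outer (D k) < top" for k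
    proof -
      have "hausdorff1_outer (D k) \<le> hausdorff1_outer A"
        by (rule hausdorff1_outer_mono) (auto simp: D_def B_def)
      also have "\<dots> < top" using fin by (simp add: less_top)
      finally show ?thesis .
    qed
    have r: "hausdorff1_outer (D k) = ennreal (r k)" "0 \<le> r k" for k
      using D_fin[of k] by (auto simp: r_def)
    have "(\<Sum>k. hausdorff1_outer (D k)) \<le> 2 * hausdorff1_outer A"
      by (rule suminf_le_const) (use all in auto)
    also have "\<dots> < top" using fin by (auto simp: ennreal_mult_less_top less_top)
    finally have "(\<Sum>k. ennreal (r k)) \<noteq> top" by (simp add: r(1))
    then have summ: "summable r" using r(2) by (intro summable_suminf_not_top) auto
    show ?thesis
    proof (rule ennreal_le_epsilon)
      fix e :: real assume "0 < e"
      then obtain n where n: "\<And>m. m \<ge> n \<Longrightarrow> norm (\<Sum>i. r (i + m)) < e"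
        using suminf_exist_split[OF _ summ] by blast
      have "x \<in> B n \<union> (\<Union>i. D (i + n))" if x: "x \<in> A - F" for x
      proof -
        have "0 < infdist x F" using infdist_pos_not_in_closed[OF assms False] x by auto
        then obtain k where k: "c k \<le> infdist x F"
          unfolding c_def by (meson nat_approx_posE less_imp_le)
        show ?thesis
        proof (cases "x \<in> B n")
          case nB: False
          define j where "j = (LEAST k. x \<in> B k)"
          have "x \<in> B k" using x k by (auto simp: B_def)
          then have j: "x \<in> B j" unfolding j_def by (rule LeastI)
          have "n < j"
          proof (rule ccontr)
            assume "\<not> n < j"
            then have "c n \<le> c j" by (intro c_anti) simp
            then show False using nB j by (auto simp: B_def)
          qed
          then obtain i where i: "j = Suc (i + n)" using less_iff_Suc_add[of n j] by (auto simp: add.commute)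
          have "x \<notin> B (i + n)" using not_less_Least[of "i+n" "\<lambda>k. x \<in> B k"] i by (simp add: j_def)
          then show ?thesis using j i by (auto simp: D_def)
        qed simp
      qed
      then have "hausdorff1_outer (A - F) \<le> hausdorff1_outer (B n \<union> (\<Union>i. D (i + n)))"
        by (intro hausdorff1_outer_mono) blast
      also have "\<dots> \<le> hausdorff1_outer (B n) + (\<Sum>i. hausdorff1_outer (D (i + n)))"
        by (rule order_trans[OF hausdorff1_outer_Un_le add_left_mono[OF hausdorff1_outer_UN_le]])
      also have "(\<Sum>i. hausdorff1_outer (D (i + n))) = ennreal (\<Sum>i. r (i + n))"
        unfolding r(1) by (rule suminf_ennreal2) (use r(2) summ summable_ignore_initial_segment in auto)
      also have "\<dots> \<le> ennreal e" using n[of n] by (intro ennreal_leI) auto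
      finally have 1: "hausdorff1_outer (A - F) \<le> hausdorff1_outer (B n) + ennreal e"
        by (simp add: add_left_mono)
      have "hausdorff1_outer (A \<inter> F) + hausdorff1_outer (B n) \<le> hausdorff1_outer ((A \<inter> F) \<union> B n)"
      proof (rule hausdorff1_outer_separated)
        show "0 < c n" by (simp add: c_def)
        fix x y assume "x \<in> A \<inter> F" "y \<in> B n"
        then show "c n \<le> dist x y"
          using infdist_le[of x F y] by (auto simp: B_def dist_commute)
      qed
      also have "\<dots> \<le> hausdorff1_outer A" by (rule hausdorff1_outer_mono) (auto simp: B_def)
      finally have 2: "hausdorff1_outer (A \<inter> F) + hausdorff1_outer (B n) \<le> hausdorff1_outer A" .
      show "hausdorff1_outer (A \<inter> F) + hausdorff1_outer (A - F) \<le> hausdorff1_outer A + ennreal e"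
        using order_trans[OF add_left_mono[OF 1] add_right_mono[OF 2, of "ennreal e", unfolded add.assoc]] .
    qed
  qed simp
  have "hausdorff1_outer (F \<inter> A) + hausdorff1_outer ((UNIV - F) \<inter> A) = hausdorff1_outer A" for A
  proof (rule antisym)
    show "hausdorff1_outer (F \<inter> A) + hausdorff1_outer ((UNIV - F) \<inter> A) \<le> hausdorff1_outer A"
      using key[of A] by (simp add: Int_commute Diff_eq)
    have "hausdorff1_outer A \<le> hausdorff1_outer ((F \<inter> A) \<union> ((UNIV - F) \<inter> A))"
      by (rule hausdorff1_outer_mono) auto
    then show "hausdorff1_outer A \<le> hausdorff1_outer (F \<inter> A) + hausdorff1_outer ((UNIV - F) \<inter> A)"
      using hausdorff1_outer_Un_le order_trans by blast
  qed
  then show ?thesis by (simp add: sets_hausdorff1 lambda_system_def)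
qed simp

lemma borel_in_sets_hausdorff1:
  fixes A :: "'a::metric_space set"
  assumes "A \<in> sets borel" shows "A \<in> sets hausdorff1"
proof -
  have "Collect closed \<subseteq> sets (hausdorff1 :: 'a measure)"
    using closed_in_sets_hausdorff1 by blast
  from sets.sigma_sets_subset[OF this]
  have "sigma_sets UNIV (Collect closed) \<subseteq> sets (hausdorff1 :: 'a measure)" by simp
  moreover have "sets borel = sigma_sets UNIV (Collect (closed :: 'a set \<Rightarrow> bool))"
    unfolding borel_eq_closed by (rule sets_measure_of) simp
  ultimately show ?thesis using assms by blast
qed

text \<open>Each covering set maps into an interval no longer than its diameter, so countable
  subadditivity of Lebesgue measure bounds the length of the covered interval. It is applied to the
  coordinate along a ridge.\<close>

lemma hausdorff1_outer_ge_projection: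
  fixes f :: "'a::metric_space \<Rightarrow> real"
  assumes f: "\<And>x y. x \<in> A \<Longrightarrow> y \<in> A \<Longrightarrow> \<bar>f x - f y\<bar> \<le> dist x y"
    and sub: "{a<..<b} \<subseteq> f ` A" and "a \<le> b"
  shows "ennreal (b - a) \<le> hausdorff1_outer A"
proof -
  have "ennreal (b - a) \<le> hausdorff1_pre 1 A"
    unfolding hausdorff1_pre_def
  proof (rule INF_greatest)
    fix C :: "nat \<Rightarrow> 'a set"
    assume "C \<in> {C. A \<subseteq> (\<Union>i. C i) \<and> (\<forall>i. bounded (C i) \<and> diameter (C i) \<le> 1)}"
    then have cov: "A \<subseteq> (\<Union>i. C i)" and C: "\<And>i. bounded (C i)" by auto
    \<comment> \<open>The closed hull of the image, because the image itself need not be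
      Borel.\<close>
    define J where "J = (\<lambda>i. if C i \<inter> A = {} then {} else {Inf (f ` (C i \<inter> A)) .. Sup (f ` (C i \<inter> A))})"
    have J: "f ` (C i \<inter> A) \<subseteq> J i \<and> emeasure lborel (J i) \<le> ennreal (diameter (C i))" for i
    proof (cases "C i \<inter> A = {}")
      case ne: False
      then obtain x0 where x0: "x0 \<in> C i \<inter> A" by blast
      have close: "\<bar>f x - f y\<bar> \<le> diameter (C i)" if "x \<in> C i \<inter> A" "y \<in> C i \<inter> A" for x y
        using f[of x y] diameter_bounded_bound[OF C, of x i y] that by fastforce
      have bd: "bdd_above (f ` (C i \<inter> A))" "bdd_below (f ` (C i \<inter> A))"
        using close[OF x0] 
        by (auto intro!: bdd_aboveI[of _ "f x0 + diameter (C i)"] bdd_belowI[of _ "f x0 - diameter (C i)"])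
          (smt (verit) IntI)+
      have "Sup (f ` (C i \<inter> A)) \<le> Inf (f ` (C i \<inter> A)) + diameter (C i)"
      proof (rule cSup_least)
        fix u assume "u \<in> f ` (C i \<inter> A)"
        then obtain x where x: "x \<in> C i \<inter> A" "u = f x" by auto
        have "u - diameter (C i) \<le> Inf (f ` (C i \<inter> A))"
        proof (rule cInf_greatest)
          fix v assume "v \<in> f ` (C i \<inter> A)"
          then obtain y where y: "y \<in> C i \<inter> A" "v = f y" by auto
          show "u - diameter (C i) \<le> v" using close[OF x(1) y(1)] x y by linarith
        qed (use ne in auto)
        then show "u \<le> Inf (f ` (C i \<inter> A)) + diameter (C i)" by linarith
      qed (use ne in auto)
      moreover have "Inf (f ` (C i \<inter> A)) \<le> Sup (f ` (C i \<inter> A))"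
        by (rule cInf_le_cSup) (use ne bd in auto)
      moreover have "f ` (C i \<inter> A) \<subseteq> {Inf (f ` (C i \<inter> A)) .. Sup (f ` (C i \<inter> A))}"
        using bd by (intro subsetI) (simp add: cInf_lower cSup_upper)
      ultimately show ?thesis using ne by (simp add: J_def ennreal_leI)
    qed (simp add: J_def)
    have [measurable]: "J i \<in> sets borel" for i by (simp add: J_def)
    have "f ` A \<subseteq> (\<Union>i. J i)"
    proof (clarify)
      fix x assume "x \<in> A"
      moreover from this obtain i where "x \<in> C i" using cov by blast
      ultimately have "f x \<in> J i" using J[of i] by blast
      then show "f x \<in> (\<Union>i. J i)" by blast
    qed
    then have "{a<..<b} \<subseteq> (\<Union>i. J i)" by (rule order_trans[OF sub])
    then have "emeasure lborel {a<..<b} \<le> emeasure lborel (\<Union>i. J i)"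
      by (intro emeasure_mono) auto
    also have "\<dots> \<le> (\<Sum>i. emeasure lborel (J i))"
      by (rule emeasure_subadditive_countably) auto
    also have "\<dots> \<le> (\<Sum>i. ennreal (diameter (C i)))" by (intro suminf_le) (use J in auto)
    finally show "ennreal (b - a) \<le> (\<Sum>i. ennreal (diameter (C i)))" using \<open>a \<le> b\<close> by simp
  qed
  also have "\<dots> \<le> hausdorff1_outer A" unfolding hausdorff1_outer_def by (rule SUP_upper) simp
  finally show ?thesis .
qed

text \<open>The images of \<open>n\<close> equal parameter intervals have diameter at most
  \<open>L * h\<close>, and \<open>n * (L * h) = L * (b - a)\<close> for every \<open>n\<close>, so
  the mesh can be pushed below \<delta> at no cost.\<close>

lemma hausdorff1_outer_lipschitz_curve_le:
  fixes g :: "real \<Rightarrow> 'a::metric_space"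
  assumes "L-lipschitz_on {a..b} g" and "a \<le> b"
  shows "hausdorff1_outer (g ` {a..b}) \<le> ennreal (L * (b - a))"
  unfolding hausdorff1_outer_def
proof (rule SUP_least)
  fix \<delta> :: real assume "\<delta> \<in> {0<..}"
  then have \<delta>: "0 < \<delta>" by simp
  have L: "0 \<le> L" and lip: "\<And>s t. s \<in> {a..b} \<Longrightarrow> t \<in> {a..b} \<Longrightarrow> dist (g s) (g t) \<le> L * dist s t"
    using assms(1) by (auto simp: lipschitz_on_def)
  obtain n :: nat where n: "L * (b - a) / \<delta> < n" using reals_Archimedean2 by blast
  have n0: "0 < n" using n L assms(2) \<delta> by (cases n) (auto simp: divide_less_0_iff mult_less_0_iff)
  define h where "h = (b - a) / n"
  have h: "0 \<le> h" "n * h = b - a" using n0 assms(2) by (auto simp: h_def)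
  have hL: "L * h \<le> \<delta>" using n n0 \<delta> by (simp add: h_def field_simps)
  define C where "C = (\<lambda>i::nat. if i < n then g ` {a + i * h .. a + Suc i * h} else {})"
  have sub: "{a + i * h .. a + Suc i * h} \<subseteq> {a..b}" if "i < n" for i
  proof -
    have "real (Suc i) * h \<le> n * h" using that h(1) by (intro mult_right_mono) auto
    moreover have "0 \<le> real i * h" using h(1) by simp
    ultimately show ?thesis using h(2) by auto
  qed
  have C_diam: "bounded (C i) \<and> diameter (C i) \<le> (if i < n then L * h else 0)" for i
  proof (cases "i < n")
    case True
    have Ci: "C i = g ` {a + i * h .. a + Suc i * h}" using True by (simp add: C_def)
    have d: "dist x y \<le> L * h" if xy: "x \<in> C i" "y \<in> C i" for x y
    proof -
      obtain s t where st: "s \<in> {a + i * h .. a + Suc i * h}" "t \<in> {a + i * h .. a + Suc i * h}"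
        "x = g s" "y = g t" using xy unfolding Ci by blast
      have "dist x y \<le> L * dist s t" using lip st sub[OF True] by blast
      also have "dist s t \<le> h" using st by (auto simp: dist_real_def algebra_simps abs_le_iff)
      finally show ?thesis using L by (simp add: mult_left_mono)
    qed
    have "bounded (C i)" using d unfolding bounded_def by (metis)
    moreover have "diameter (C i) \<le> L * h"
      unfolding diameter_def using d L h(1) by (auto intro!: cSUP_least)
    ultimately show ?thesis using True by simp
  qed (simp add: C_def)
  have cov: "g ` {a..b} \<subseteq> (\<Union>i. C i)"
  proof (clarify)
    fix t assume t: "t \<in> {a..b}"
    show "g t \<in> (\<Union>i. C i)"
    proof (cases "h = 0")
      case True
      then have "t = a" using h t by auto
      then have "g t \<in> C 0" using n0 True by (simp add: C_def)
      then show ?thesis by blast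
    next
      case False
      then have hp: "0 < h" using h by simp
      define j where "j = nat \<lfloor>(t - a) / h\<rfloor>"
      have q: "0 \<le> (t - a) / h" using t hp by simp
      have j: "real j \<le> (t - a) / h" "(t - a) / h < real j + 1"
        unfolding j_def using q by linarith+
      show ?thesis
      proof (cases "j < n")
        case True
        have "t \<in> {a + j * h .. a + Suc j * h}"
          using j hp by (auto simp: field_simps)
        then have "g t \<in> C j" using True by (simp add: C_def)
        then show ?thesis by blast
      next
        \<comment> \<open>Only \<open>t = b\<close> is assigned the index \<open>n\<close>; it goes
          to the last piece.\<close>
        case False
        have "real n * h \<le> real j * h" using False hp by simp
        moreover have "real j * h \<le> t - a" using j hp by (simp add: field_simps)
        ultimately have "t = b" using h t by auto
        moreover have "b = a + Suc (n - 1) * h" using h n0 by simp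
        moreover have "a + real (n - 1) * h \<le> a + Suc (n - 1) * h" using hp by simp
        ultimately have "g t \<in> C (n - 1)" using n0 by (auto simp: C_def intro!: imageI)
        then show ?thesis by blast
      qed
    qed
  qed
  have "hausdorff1_pre \<delta> (g ` {a..b}) \<le> (\<Sum>i. ennreal (diameter (C i)))"
    unfolding hausdorff1_pre_def
  proof (rule INF_lower)
    have "diameter (C i) \<le> \<delta>" for i using C_diam[of i] hL \<delta> by (auto split: if_splits)
    then show "C \<in> {C. g ` {a..b} \<subseteq> (\<Union>i. C i) \<and> (\<forall>i. bounded (C i) \<and> diameter (C i) \<le> \<delta>)}"
      using cov C_diam by blast
  qed
  also have "\<dots> = (\<Sum>i<n. ennreal (diameter (C i)))"
    by (rule suminf_finite) (auto simp: C_def)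
  also have "\<dots> \<le> (\<Sum>i<n. ennreal (L * h))"
  proof (intro sum_mono ennreal_leI)
    fix i assume "i \<in> {..<n}"
    then show "diameter (C i) \<le> L * h" using C_diam[of i] by simp
  qed
  also have "\<dots> = ennreal (n * (L * h))" using L h by (simp add: ennreal_mult ennreal_of_nat_eq_real_of_nat)
  also have "n * (L * h) = L * (b - a)" using h(2) by (metis mult.left_commute)
  finally show "hausdorff1_pre \<delta> (g ` {a..b}) \<le> ennreal (L * (b - a))" .
qed

text \<open>A constant curve over a degenerate interval. It removes the origin, the vertex of the
  cone, from the energy of the competitor.\<close>

lemma hausdorff1_outer_singleton: "hausdorff1_outer {x} = 0"
  using hausdorff1_outer_lipschitz_curve_le[of 0 0 0 "\<lambda>_::real. x"]
  by (simp add: lipschitz_on_def)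


subsection \<open>Gradients of differences of convex functions\<close>

lemma second_difference_nonneg:
  fixes g :: "'a::real_vector \<Rightarrow> real"
  assumes "convex_on UNIV g"
  shows "0 \<le> g (x + v) + g (x - v) - 2 * g x"
proof -
  have "g ((1 - 1/2) *\<^sub>R (x + v) + (1/2) *\<^sub>R (x - v)) \<le> (1 - 1/2) * g (x + v) + (1/2) * g (x - v)"
    by (rule convex_onD[OF assms]) auto
  moreover have "(1 - 1/2) *\<^sub>R (x + v) + (1/2) *\<^sub>R (x - v) = x"
    by (simp add: algebra_simps flip: scaleR_add_left)
  ultimately show ?thesis by simp
qed

lemma continuous_imp_lebesgue_measurable:
  fixes f :: "'a::euclidean_space \<Rightarrow> real"
  assumes "continuous_on UNIV f" shows "f \<in> borel_measurable lebesgue"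
  using assms by (simp add: borel_measurable_continuous_onI measurable_completion)

lemma integrable_continuous_vanishing:
  fixes f :: "'a::euclidean_space \<Rightarrow> real"
  assumes "continuous_on UNIV f" and "\<And>x. x \<notin> cball 0 r \<Longrightarrow> f x = 0"
  shows "integrable lborel f"
proof -
  have "integrable lborel (\<lambda>x. indicator (cball 0 r) x *\<^sub>R f x)"
    by (rule borel_integrable_compact) (use assms(1) continuous_on_subset in auto)
  also have "(\<lambda>x. indicator (cball 0 r) x *\<^sub>R f x) = f"
    using assms(2) by (auto simp: fun_eq_iff indicator_def)
  finally show ?thesis .
qed

lemma lborel_integral_translation:
  fixes f :: "'a::euclidean_space \<Rightarrow> real"
  assumes "f \<in> borel_measurable borel"
  shows "(LINT x|lborel. f (x + c)) = (LINT x|lborel. f x)"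
proof -
  have "(LINT x|lborel. f x) = (LINT x|distr lborel borel ((+) c). f x)"
    by (simp add: lborel_distr_plus)
  also have "\<dots> = (LINT x|lborel. f (c + x))"
    by (rule integral_distr) (use assms in auto)
  finally show ?thesis by (simp add: add.commute)
qed

lemma continuous_on_UNIV_comp:
  "continuous_on UNIV f \<Longrightarrow> continuous_on S g \<Longrightarrow> continuous_on S (\<lambda>x. f (g x))"
  by (rule continuous_on_compose2[of UNIV]) auto

text \<open>Summation by parts moves one of the two differences onto the Lipschitz cutoff.\<close>

lemma integral_second_difference_le:
  fixes g :: "'a::euclidean_space \<Rightarrow> real" and \<rho> :: real
  assumes g: "L-lipschitz_on UNIV g" and v: "norm v \<le> 1"
  defines "\<kappa> \<equiv> (\<lambda>x::'a. max 0 (\<rho> + 1 - norm x))"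
  shows "(LINT x|lborel. \<kappa> x * (g (x + v) + g (x - v) - 2 * g x))
    \<le> L * (norm v)\<^sup>2 * measure lborel (cball (0::'a) (\<rho> + 2))"
proof -
  have L: "0 \<le> L" and lip: "\<And>x y. \<bar>g x - g y\<bar> \<le> L * norm (x - y)"
    using g by (auto simp: lipschitz_on_def dist_norm)
  have gc: "continuous_on UNIV g" using g by (rule lipschitz_on_continuous_on)
  have \<kappa>c: "continuous_on UNIV \<kappa>" unfolding \<kappa>_def by (intro continuous_intros)
  note ci = continuous_intros continuous_on_UNIV_comp[OF gc] continuous_on_UNIV_comp[OF \<kappa>c]
  define D where "D = (\<lambda>x. g (x + v) - g x)"
  have Dc: "continuous_on UNIV D" unfolding D_def by (intro ci)
  note ci = ci continuous_on_UNIV_comp[OF Dc]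
  have \<kappa>0: "\<kappa> x = 0" if "\<rho> + 1 \<le> norm x" for x using that by (simp add: \<kappa>_def)
  have far: "\<rho> + 1 \<le> norm (x + w)" if "x \<notin> cball 0 (\<rho> + 2)" "norm w \<le> 1" for x w
    using norm_triangle_ineq4[of "x + w" w] that by simp
  have i1: "integrable lborel (\<lambda>x. \<kappa> x * D x)"
    by (rule integrable_continuous_vanishing[where r="\<rho>+2"]) (auto intro!: ci simp: \<kappa>0)
  have i2: "integrable lborel (\<lambda>x. \<kappa> x * D (x - v))"
    by (rule integrable_continuous_vanishing[where r="\<rho>+2"]) (auto intro!: ci simp: \<kappa>0)
  have i3: "integrable lborel (\<lambda>x. \<kappa> (x + v) * D x)"
    by (rule integrable_continuous_vanishing[where r="\<rho>+2"]) (auto intro!: ci simp: \<kappa>0 far v)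
  have "(LINT x|lborel. \<kappa> x * D (x - v)) = (LINT x|lborel. \<kappa> (x + v) * D (x + v - v))"
    by (rule lborel_integral_translation[symmetric], rule borel_measurable_continuous_onI) (intro ci)
  then have shift: "(LINT x|lborel. \<kappa> x * D (x - v)) = (LINT x|lborel. \<kappa> (x + v) * D x)"
    by simp
  have "(LINT x|lborel. \<kappa> x * (g (x + v) + g (x - v) - 2 * g x))
      = (LINT x|lborel. \<kappa> x * D x - \<kappa> x * D (x - v))"
    by (simp add: D_def algebra_simps)
  also have "\<dots> = (LINT x|lborel. \<kappa> x * D x - \<kappa> (x + v) * D x)"
    using i1 i2 i3 by (simp add: shift)
  also have "\<dots> \<le> (LINT x|lborel. indicator (cball (0::'a) (\<rho> + 2)) x * (L * (norm v)\<^sup>2))"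
  proof (rule integral_mono)
    show "integrable lborel (\<lambda>x. \<kappa> x * D x - \<kappa> (x + v) * D x)" using i1 i3 by simp
    show "integrable lborel (\<lambda>x::'a. indicator (cball 0 (\<rho> + 2)) x * (L * (norm v)\<^sup>2))"
      by (intro integrable_mult_left integrable_real_indicator emeasure_bounded_finite bounded_cball) simp
    fix x :: 'a
    show "\<kappa> x * D x - \<kappa> (x + v) * D x \<le> indicator (cball 0 (\<rho> + 2)) x * (L * (norm v)\<^sup>2)"
    proof (cases "x \<in> cball 0 (\<rho> + 2)")
      case True
      have "\<kappa> x * D x - \<kappa> (x + v) * D x = (\<kappa> x - \<kappa> (x + v)) * D x" by (simp add: algebra_simps)
      also have "\<dots> \<le> \<bar>\<kappa> x - \<kappa> (x + v)\<bar> * \<bar>D x\<bar>" by (metis abs_ge_self abs_mult)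
      also have "\<dots> \<le> norm v * (L * norm v)"
      proof (intro mult_mono)
        show "\<bar>\<kappa> x - \<kappa> (x + v)\<bar> \<le> norm v"
          using norm_triangle_ineq[of x v] norm_triangle_ineq4[of "x+v" v] by (auto simp: \<kappa>_def)
        show "\<bar>D x\<bar> \<le> L * norm v" using lip[of "x+v" x] by (simp add: D_def)
      qed auto
      finally show ?thesis using True by (simp add: power2_eq_square ac_simps)
    qed (use far[of x 0] far[of x v] v in \<open>simp add: \<kappa>0\<close>)
  qed
  also have "\<dots> = L * (norm v)\<^sup>2 * measure lborel (cball (0::'a) (\<rho> + 2))" by simp
  finally show ?thesis .
qed

text \<open>Polarization: with \<open>p\<close> and \<open>q\<close> half the sum and half the
  difference of \<open>a\<close> and \<open>b\<close>, the mixed difference is the second difference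
  at \<open>x + p\<close> in direction \<open>p\<close> minus the one in direction \<open>q\<close>.
  Convexity makes both nonnegative, so the test function may be replaced by a Lipschitz cutoff that
  dominates it.\<close>

lemma integral_mixed_difference_le:
  fixes g :: "'a::euclidean_space \<Rightarrow> real"
  assumes conv: "convex_on UNIV g" and g: "L-lipschitz_on UNIV g"
    and ab: "norm a \<le> 1" "norm b \<le> 1"
    and \<eta>: "continuous_on UNIV \<eta>" "\<And>x. \<bar>\<eta> x\<bar> \<le> 1" "\<And>x. x \<notin> cball 0 \<rho> \<Longrightarrow> \<eta> x = 0"
  shows "\<bar>LINT x|lborel. \<eta> x * (g (x + a + b) + g x - g (x + a) - g (x + b))\<bar>
    \<le> L * (((norm a)\<^sup>2 + (norm b)\<^sup>2) / 2) * measure lborel (cball (0::'a) (\<rho> + 3))"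
proof -
  have gc: "continuous_on UNIV g" using g by (rule lipschitz_on_continuous_on)
  \<comment> \<open>The tent of the previous lemma with \<open>\<rho> + 1\<close> in place of
    \<open>\<rho>\<close>, so that it is at least 1 at \<open>x + p\<close> for \<open>x\<close> in
    \<open>cball 0 \<rho>\<close>.\<close>
  define \<kappa> where "\<kappa> = (\<lambda>x::'a. max 0 (\<rho> + 1 + 1 - norm x))"
  define S where "S = (\<lambda>v x. g (x + v) + g (x - v) - 2 * g x)"
  define p q where "p = (1/2) *\<^sub>R (a + b)" and "q = (1/2) *\<^sub>R (a - b)"
  have pq: "a = p + q" "b = p - q"
    by (simp_all add: p_def q_def algebra_simps flip: scaleR_add_left)
  have np: "norm p \<le> 1" "norm q \<le> 1"
    using ab norm_triangle_ineq[of a b] norm_triangle_ineq4[of a b] by (auto simp: p_def q_def)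
  have S0: "0 \<le> S v x" for v x unfolding S_def by (rule second_difference_nonneg[OF conv])
  have \<kappa>c: "continuous_on UNIV \<kappa>" unfolding \<kappa>_def by (intro continuous_intros)
  have Sc: "continuous_on UNIV (S v)" for v
    unfolding S_def by (intro continuous_intros continuous_on_UNIV_comp[OF gc])
  note ci = continuous_intros continuous_on_UNIV_comp[OF gc] continuous_on_UNIV_comp[OF \<kappa>c]
    continuous_on_UNIV_comp[OF Sc] continuous_on_UNIV_comp[OF \<eta>(1)]
  have mixed: "g (x + a + b) + g x - g (x + a) - g (x + b) = S p (x + p) - S q (x + p)" for x
  proof -
    have "x + a + b = x + p + p" "x + a = x + p + q" "x + b = x + p - q"
      by (simp_all add: pq algebra_simps)
    then show ?thesis by (simp only: S_def) simp
  qed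
  have \<kappa>0: "\<kappa> x = 0" if "x \<notin> cball 0 (\<rho> + 2)" for x using that by (simp add: \<kappa>_def)
  have i: "integrable lborel (\<lambda>x. \<kappa> x * S v x)" for v
    by (rule integrable_continuous_vanishing[where r="\<rho>+2"]) (auto intro!: ci simp: \<kappa>0)
  have i': "integrable lborel (\<lambda>x. \<kappa> (x + p) * (S p (x + p) + S q (x + p)))"
  proof (rule integrable_continuous_vanishing[where r="\<rho>+3"])
    fix x :: 'a assume "x \<notin> cball 0 (\<rho> + 3)"
    then have "x + p \<notin> cball 0 (\<rho> + 2)" using norm_triangle_ineq4[of "x+p" p] np by simp
    then show "\<kappa> (x + p) * (S p (x + p) + S q (x + p)) = 0" by (simp add: \<kappa>0)
  qed (intro ci)
  have "\<bar>LINT x|lborel. \<eta> x * (g (x + a + b) + g x - g (x + a) - g (x + b))\<bar>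
      = norm (LINT x|lborel. \<eta> x * (S p (x + p) - S q (x + p)))" by (simp add: mixed)
  also have "\<dots> \<le> (LINT x|lborel. \<kappa> (x + p) * (S p (x + p) + S q (x + p)))"
  proof (rule Bochner_Integration.integral_norm_bound_integral)
    show "integrable lborel (\<lambda>x. \<eta> x * (S p (x + p) - S q (x + p)))"
      by (rule integrable_continuous_vanishing[where r=\<rho>]) (auto intro!: ci simp: \<eta>(3))
    show "integrable lborel (\<lambda>x. \<kappa> (x + p) * (S p (x + p) + S q (x + p)))" by (rule i')
    fix x
    have "\<bar>\<eta> x\<bar> \<le> \<kappa> (x + p)"
    proof (cases "x \<in> cball 0 \<rho>")
      case True
      then have "norm (x + p) \<le> \<rho> + 1" using norm_triangle_ineq[of x p] np by simp
      then show ?thesis using \<eta>(2)[of x] by (simp add: \<kappa>_def)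
    qed (simp add: \<eta>(3) \<kappa>_def)
    moreover have "\<bar>S p (x + p) - S q (x + p)\<bar> \<le> S p (x + p) + S q (x + p)"
      using S0[of p "x+p"] S0[of q "x+p"] by linarith
    ultimately show "norm (\<eta> x * (S p (x + p) - S q (x + p))) \<le> \<kappa> (x + p) * (S p (x + p) + S q (x + p))"
      by (auto simp: abs_mult intro: mult_mono)
  qed
  also have "\<dots> = (LINT x|lborel. \<kappa> x * (S p x + S q x))"
    by (rule lborel_integral_translation, rule borel_measurable_continuous_onI) (intro ci)
  also have "\<dots> = (LINT x|lborel. \<kappa> x * S p x) + (LINT x|lborel. \<kappa> x * S q x)"
    using i by (simp add: distrib_left)
  also have "\<dots> \<le> L * (norm p)\<^sup>2 * measure lborel (cball (0::'a) (\<rho> + 1 + 2))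
      + L * (norm q)\<^sup>2 * measure lborel (cball (0::'a) (\<rho> + 1 + 2))"
    unfolding \<kappa>_def S_def by (intro add_mono integral_second_difference_le[OF g] np)
  also have "\<dots> = L * ((norm p)\<^sup>2 + (norm q)\<^sup>2) * measure lborel (cball (0::'a) (\<rho> + 3))"
    by (simp add: algebra_simps)
  also have "(norm p)\<^sup>2 + (norm q)\<^sup>2 = ((norm a)\<^sup>2 + (norm b)\<^sup>2) / 2"
    unfolding pq by (simp add: power2_norm_eq_inner inner_simps inner_commute)
  finally show ?thesis .
qed

text \<open>The distributional second derivatives of a convex Lipschitz function are measures of
  locally bounded mass. The integral is a limit of integrals of products of two difference
  quotients; a translation moves both differences onto \<open>g1 - g2\<close>, whose mixed second
  differences integrate to a multiple of the squared step, which cancels the two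
  denominators.\<close>

lemma integral_partial_derivatives_le:
  fixes g1 g2 :: "'a::euclidean_space \<Rightarrow> real" and u :: "'a \<Rightarrow> real"
  assumes conv: "convex_on UNIV g1" "convex_on UNIV g2"
    and lip: "L1-lipschitz_on UNIV g1" "L2-lipschitz_on UNIV g2"
    and \<Omega>: "\<Omega> \<subseteq> cball 0 \<rho>" and e: "norm e = 1" and e': "norm e' = 1"
    and u: "(\<lambda>x. indicator \<Omega> x * u x) \<in> borel_measurable lebesgue"
    and u_lim: "AE x in lebesgue. x \<in> \<Omega> \<longrightarrow>
        (\<lambda>n. ((g1 (x + (1 / Suc n) *\<^sub>R e) - g2 (x + (1 / Suc n) *\<^sub>R e)) - (g1 x - g2 x)) / (1 / Suc n)) \<longlonglongrightarrow> u x"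
    and \<eta>: "continuous_on UNIV \<eta>" "\<And>x. \<bar>\<eta> x\<bar> \<le> 1"
    and K: "closed K" "K \<subseteq> \<Omega>" "\<And>x. x \<notin> K \<Longrightarrow> \<eta> x = 0"
    and \<eta>': "\<And>x. ((\<lambda>t. \<eta> (x + t *\<^sub>R e')) has_real_derivative \<eta>' x) (at 0)" "continuous_on UNIV \<eta>'"
  shows "\<bar>LINT x:\<Omega>|lebesgue. u x * \<eta>' x\<bar> \<le> (L1 + L2) * measure lborel (cball (0::'a) (\<rho> + 3))"
proof -
  define g where "g = (\<lambda>x. g1 x - g2 x)"
  define h where "h = (\<lambda>n. 1 / real (Suc n))"
  have h: "0 < h n" "h n \<le> 1" for n by (auto simp: h_def)
  have h_lim: "h \<longlonglongrightarrow> 0" unfolding h_def by (rule lim_1_over_n[THEN LIMSEQ_Suc])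
  define L where "L = L1 + L2"
  have gL: "L-lipschitz_on UNIV g" unfolding g_def L_def by (intro lipschitz_intros lip)
  then have L: "0 \<le> L" and gl: "\<And>x y. \<bar>g x - g y\<bar> \<le> L * norm (x - y)"
    by (auto simp: lipschitz_on_def dist_norm)
  have gc: "continuous_on UNIV g" "continuous_on UNIV g1" "continuous_on UNIV g2"
    using gL lip by (auto intro: lipschitz_on_continuous_on)
  note ci = continuous_intros gc[THEN continuous_on_UNIV_comp] continuous_on_UNIV_comp[OF \<eta>(1)]
  have \<eta>0: "\<eta> x = 0" if "x \<notin> cball 0 \<rho>" for x using that K \<Omega> by blast
  have \<eta>_der: "((\<lambda>t. \<eta> (x + t *\<^sub>R e')) has_real_derivative \<eta>' (x + s *\<^sub>R e')) (at s)" for x s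
    using DERIV_shift[of "\<lambda>t. \<eta> (x + t *\<^sub>R e')" "\<eta>' (x + s *\<^sub>R e')" 0 s] \<eta>'(1)[of "x + s *\<^sub>R e'"]
    by (simp add: algebra_simps)
  \<comment> \<open>Since \<open>K\<close> is closed, \<eta> vanishes near \<open>x\<close>, and so
    do its derivative and its late difference quotients. This covers the points outside \<Omega>,
    where nothing is known about \<open>u\<close>.\<close>
  have \<eta>'0: "\<eta>' x = 0 \<and> (\<forall>\<^sub>F n in sequentially. \<eta> (x + h n *\<^sub>R e') = 0)" if x: "x \<notin> K" for x
  proof -
    have "((\<lambda>t. x + t *\<^sub>R e') \<longlongrightarrow> x + 0 *\<^sub>R e') (nhds 0)"
      by (intro tendsto_intros filterlim_ident)
    then have ev: "\<forall>\<^sub>F t in nhds 0. x + t *\<^sub>R e' \<in> - K"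
      by (rule topological_tendstoD) (use K(1) x in auto)
    then have ev0: "\<forall>\<^sub>F t in nhds 0. \<eta> (x + t *\<^sub>R e') = 0" by eventually_elim (auto intro: K)
    have "((\<lambda>t. 0) has_real_derivative \<eta>' x) (at (0::real))"
      by (rule DERIV_cong_ev[OF refl _ refl, THEN iffD1, OF _ \<eta>'(1)[of x]]) (rule ev0)
    then have "\<eta>' x = 0" using DERIV_unique[OF _ DERIV_const] by blast
    then show ?thesis using eventually_compose_filterlim[OF ev0 h_lim] by simp
  qed
  obtain B where B: "\<And>x. \<bar>\<eta>' x\<bar> \<le> B"
  proof -
    have "compact K" using K \<Omega> bounded_subset[OF bounded_cball, of K 0 \<rho>]
      by (auto simp: compact_eq_bounded_closed)
    then have "bounded (\<eta>' ` K)"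
      by (intro compact_imp_bounded compact_continuous_image) (auto intro: continuous_on_subset[OF \<eta>'(2)])
    then obtain B where "\<And>x. x \<in> K \<Longrightarrow> \<bar>\<eta>' x\<bar> \<le> B" by (auto simp: bounded_iff)
    then have "\<bar>\<eta>' x\<bar> \<le> max B 0" for x
      using \<eta>'0[of x] by (cases "x \<in> K") (auto simp: le_max_iff_disj)
    then show ?thesis by (rule that)
  qed
  have \<eta>lip: "\<bar>\<eta> (x + h n *\<^sub>R e') - \<eta> x\<bar> \<le> h n * B" for x n
  proof -
    obtain z where "\<eta> (x + h n *\<^sub>R e') - \<eta> (x + 0 *\<^sub>R e') = (h n - 0) * \<eta>' (x + z *\<^sub>R e')"
      using MVT2[OF h(1), of n "\<lambda>t. \<eta> (x + t *\<^sub>R e')" "\<lambda>t. \<eta>' (x + t *\<^sub>R e')"] \<eta>_der by blast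
    then show ?thesis using B[of "x + z *\<^sub>R e'"] h(1)[of n] by (simp add: abs_mult)
  qed
  define Q where "Q = (\<lambda>n x. ((g (x + h n *\<^sub>R e) - g x) / h n) * ((\<eta> (x + h n *\<^sub>R e') - \<eta> x) / h n))"
  have Qc: "continuous_on UNIV (Q n)" for n
    unfolding Q_def using h(1)[of n] by (intro ci) auto
  have Q_le: "\<bar>LINT x|lebesgue. Q n x\<bar> \<le> L * measure lborel (cball (0::'a) (\<rho> + 3))" for n
  proof -
    \<comment> \<open>The minus sign in \<open>b\<close>: a shift of \<eta> by
      \<open>h n *\<^sub>R e'\<close> becomes, after the change of variables, a shift of
      \<open>d\<close> by the opposite vector.\<close>
    define a b where "a = h n *\<^sub>R e" and "b = - (h n *\<^sub>R e')"
    have ab: "norm a = h n" "norm b = h n" using h(1)[of n] e e' by (auto simp: a_def b_def)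
    define M where "M = (\<lambda>f x. f (x + a + b) + f x - f (x + a) - f (x + b) :: real)"
    define d where "d = (\<lambda>x. g (x + a) - g x)"
    have dc: "continuous_on UNIV d" unfolding d_def by (intro ci)
    note ci = ci continuous_on_UNIV_comp[OF dc]
    have iM: "integrable lborel (\<lambda>x. \<eta> x * M f x)" if "continuous_on UNIV f" for f
      unfolding M_def
      by (rule integrable_continuous_vanishing[where r=\<rho>])
        (auto intro!: ci continuous_on_UNIV_comp[OF that] simp: \<eta>0)
    have far: "x - b \<notin> cball 0 \<rho>" if "x \<notin> cball 0 (\<rho> + 1)" for x
      using norm_triangle_ineq[of "x - b" b] that ab h(2)[of n] by simp
    have i1: "integrable lborel (\<lambda>x. \<eta> x * d (x + b))"
      by (rule integrable_continuous_vanishing[where r=\<rho>]) (auto intro!: ci simp: \<eta>0)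
    have i2: "integrable lborel (\<lambda>x. \<eta> x * d x)"
      by (rule integrable_continuous_vanishing[where r=\<rho>]) (auto intro!: ci simp: \<eta>0)
    have i3: "integrable lborel (\<lambda>x. \<eta> (x - b) * d x)"
    proof (rule integrable_continuous_vanishing[where r="\<rho>+1"])
      fix x :: 'a assume "x \<notin> cball 0 (\<rho> + 1)"
      then show "\<eta> (x - b) * d x = 0" using \<eta>0[OF far] by simp
    qed (intro ci)
    have shift: "(LINT x|lborel. \<eta> (x - b) * d x) = (LINT x|lborel. \<eta> x * d (x + b))"
    proof -
      have "(LINT x|lborel. \<eta> (x + b - b) * d (x + b)) = (LINT x|lborel. \<eta> (x - b) * d x)"
        by (rule lborel_integral_translation, rule borel_measurable_continuous_onI) (intro ci)
      then show ?thesis by simp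
    qed
    have "(LINT x|lebesgue. Q n x) = (LINT x|lborel. Q n x)"
      by (rule integral_completion) (simp add: borel_measurable_continuous_onI[OF Qc])
    also have "\<dots> = (LINT x|lborel. (\<eta> (x - b) * d x - \<eta> x * d x) / (h n)\<^sup>2)"
    proof (rule arg_cong[where f="integral\<^sup>L lborel"], rule ext)
      fix x
      have "Q n x = d x * (\<eta> (x - b) - \<eta> x) / (h n)\<^sup>2"
        by (simp add: Q_def d_def a_def b_def power2_eq_square)
      then show "Q n x = (\<eta> (x - b) * d x - \<eta> x * d x) / (h n)\<^sup>2" by (simp add: algebra_simps)
    qed
    also have "\<dots> = ((LINT x|lborel. \<eta> x * d (x + b)) - (LINT x|lborel. \<eta> x * d x)) / (h n)\<^sup>2"
      using i2 i3 by (simp add: shift)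
    also have "\<dots> = (LINT x|lborel. \<eta> x * d (x + b) - \<eta> x * d x) / (h n)\<^sup>2"
      using i1 i2 by simp
    also have "(\<lambda>x. \<eta> x * d (x + b) - \<eta> x * d x) = (\<lambda>x. \<eta> x * M g x)"
      by (simp add: fun_eq_iff d_def M_def algebra_simps)
    also have "(LINT x|lborel. \<eta> x * M g x) = (LINT x|lborel. \<eta> x * M g1 x - \<eta> x * M g2 x)"
      by (simp add: M_def g_def algebra_simps)
    also have "\<dots> = (LINT x|lborel. \<eta> x * M g1 x) - (LINT x|lborel. \<eta> x * M g2 x)"
      by (intro Bochner_Integration.integral_diff iM gc)
    finally have eq: "(LINT x|lebesgue. Q n x) * (h n)\<^sup>2
        = (LINT x|lborel. \<eta> x * M g1 x) - (LINT x|lborel. \<eta> x * M g2 x)"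
      using h(1)[of n] by simp
    have M_le: "\<bar>LINT x|lborel. \<eta> x * M f x\<bar> \<le> l * (h n)\<^sup>2 * measure lborel (cball (0::'a) (\<rho> + 3))"
      if "convex_on UNIV f" "l-lipschitz_on UNIV f" for f l
      using integral_mixed_difference_le[OF that, of a b \<eta> \<rho>] \<eta> \<eta>0 h(2)[of n] by (simp add: M_def ab)
    have "\<bar>LINT x|lebesgue. Q n x\<bar> * (h n)\<^sup>2 = \<bar>(LINT x|lebesgue. Q n x) * (h n)\<^sup>2\<bar>"
      by (simp add: abs_mult)
    also have "\<dots> \<le> (L * measure lborel (cball (0::'a) (\<rho> + 3))) * (h n)\<^sup>2"
      unfolding eq L_def using M_le[OF conv(1) lip(1)] M_le[OF conv(2) lip(2)]
      by (simp add: algebra_simps)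
    finally show ?thesis using h(1)[of n] by simp
  qed
  have "(\<lambda>n. LINT x|lebesgue. Q n x) \<longlonglongrightarrow> (LINT x|lebesgue. indicator \<Omega> x * u x * \<eta>' x)"
  \<comment> \<open>The quotients of \<open>g\<close> and \<eta> are bounded by \<open>L\<close> and
    \<open>B\<close>, and a shift of length \<open>h n \<le> 1\<close> keeps the support in
    \<open>cball 0 (\<rho> + 1)\<close>.\<close>
  proof (rule integral_dominated_convergence[where w="\<lambda>x. indicator (cball 0 (\<rho> + 1)) x * (L * B)"])
    have "\<eta>' \<in> borel_measurable lebesgue"
      by (rule continuous_imp_lebesgue_measurable[OF \<eta>'(2)])
    then show "(\<lambda>x. indicator \<Omega> x * u x * \<eta>' x) \<in> borel_measurable lebesgue"
      by (rule borel_measurable_times[OF u])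
    show "Q n \<in> borel_measurable lebesgue" for n
      by (rule continuous_imp_lebesgue_measurable[OF Qc])
    have "emeasure lebesgue (cball (0::'a) (\<rho>+1)) < \<infinity>" using emeasure_lborel_cball_finite by simp
    then show "integrable lebesgue (\<lambda>x::'a. indicator (cball 0 (\<rho> + 1)) x * (L * B))"
      by (intro integrable_mult_left integrable_real_indicator) auto
    show "AE x in lebesgue. (\<lambda>n. Q n x) \<longlonglongrightarrow> indicator \<Omega> x * u x * \<eta>' x"
      using u_lim
    proof eventually_elim
      case (elim x)
      show ?case
      proof (cases "x \<in> \<Omega>")
        case True
        have "(\<lambda>t. (\<eta> (x + t *\<^sub>R e') - \<eta> x) / t) \<midarrow>0\<rightarrow> \<eta>' x"
          using \<eta>'(1)[of x] by (simp add: has_field_derivative_iff)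
        then have "(\<lambda>n. (\<eta> (x + h n *\<^sub>R e') - \<eta> x) / h n) \<longlonglongrightarrow> \<eta>' x"
          by (rule filterlim_compose)
            (use h(1) h_lim in \<open>auto simp: filterlim_at less_imp_neq[symmetric]\<close>)
        moreover have "(\<lambda>n. (g (x + h n *\<^sub>R e) - g x) / h n) \<longlonglongrightarrow> u x"
          using elim True by (simp add: g_def h_def)
        ultimately have "(\<lambda>n. Q n x) \<longlonglongrightarrow> u x * \<eta>' x" unfolding Q_def by (intro tendsto_mult)
        then show ?thesis using True by simp
      next
        case False
        then have "x \<notin> K" using K by blast
        then have "\<forall>\<^sub>F n in sequentially. Q n x = 0"
          using \<eta>'0[of x] K(3)[of x] by (auto elim!: eventually_mono simp: Q_def)
        then show ?thesis using False by (simp add: tendsto_eventually)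
      qed
    qed
    show "AE x in lebesgue. norm (Q n x) \<le> indicator (cball 0 (\<rho> + 1)) x * (L * B)" for n
    proof (rule AE_I2)
      fix x :: 'a
      show "norm (Q n x) \<le> indicator (cball 0 (\<rho> + 1)) x * (L * B)"
      proof (cases "x \<in> cball 0 (\<rho> + 1)")
        case True
        have "\<bar>(g (x + h n *\<^sub>R e) - g x) / h n\<bar> \<le> L"
          using gl[of "x + h n *\<^sub>R e" x] h(1)[of n] e by (simp add: field_simps)
        moreover have "\<bar>(\<eta> (x + h n *\<^sub>R e') - \<eta> x) / h n\<bar> \<le> B"
          using \<eta>lip[of x n] h(1)[of n] by (simp add: field_simps)
        ultimately have "norm (Q n x) \<le> L * B"
          unfolding Q_def real_norm_def abs_mult using L by (intro mult_mono) auto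
        then show ?thesis using True by simp
      next
        case False
        have "\<rho> < norm (x + h n *\<^sub>R e')"
          using False norm_triangle_ineq4[of "x + h n *\<^sub>R e'" "h n *\<^sub>R e'"] h[of n] e' by simp
        then show ?thesis using False by (simp add: Q_def \<eta>0)
      qed
    qed
  qed
  then have "\<bar>LINT x|lebesgue. indicator \<Omega> x * u x * \<eta>' x\<bar>
      \<le> L * measure lborel (cball (0::'a) (\<rho> + 3))"
    by (rule tendsto_upperbound[OF tendsto_rabs]) (auto simp: Q_le)
  then show ?thesis by (simp add: set_lebesgue_integral_def L_def mult.assoc)
qed


section \<open>Gradients as vectors, and bounded variation of the gradient\<close>

lemma GDERIV_unique:
  fixes D D' :: "'a::real_inner"
  assumes "GDERIV \<phi> x :> D" "GDERIV \<phi> x :> D'" shows "D = D'"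
proof -
  have "(\<lambda>h. h \<bullet> D) = (\<lambda>h. h \<bullet> D')"
    using assms has_derivative_unique unfolding gderiv_def by blast
  then have "(D - D') \<bullet> D = (D - D') \<bullet> D'" by (rule fun_cong)
  then have "(D - D') \<bullet> (D - D') = 0" by (simp add: inner_diff_right)
  then show ?thesis by simp
qed

lemma grad_eq: "GDERIV \<phi> x :> D \<Longrightarrow> grad \<phi> x = D"
  unfolding grad_def by (rule the_equality) (auto intro: GDERIV_unique)

text \<open>By Riesz representation, \<open>adjoint f' 1\<close> is the vector that represents the
  derivative.\<close>

lemma differentiable_imp_GDERIV_grad:
  assumes "\<phi> differentiable (at x)" shows "GDERIV \<phi> x :> grad \<phi> x"
proof -
  obtain f' where f': "(\<phi> has_derivative f') (at x)" using assms by (auto simp: differentiable_def)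
  then have "linear f'" by (rule has_derivative_linear)
  then have "f' = (\<lambda>h. h \<bullet> adjoint f' 1)" using adjoint_works[of f' _ 1] by (simp add: fun_eq_iff)
  then have "GDERIV \<phi> x :> adjoint f' 1" using f' unfolding gderiv_def by simp
  then show ?thesis using grad_eq by metis
qed

lemma GDERIV_transform_open:
  assumes "open S" "x \<in> S" "\<And>y. y \<in> S \<Longrightarrow> \<phi> y = \<psi> y" "GDERIV \<phi> x :> D"
  shows "GDERIV \<psi> x :> D"
  using assms unfolding gderiv_def by (blast intro: has_derivative_transform_within_open)

lemma GDERIV_imp_differentiable: "GDERIV \<phi> x :> D \<Longrightarrow> \<phi> differentiable (at x)"
  unfolding gderiv_def by (rule differentiableI)

lemma GDERIV_difference_quotient:
  assumes "GDERIV \<phi> x :> D"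
  shows "(\<lambda>n. (\<phi> (x + (1 / Suc n) *\<^sub>R e) - \<phi> x) / (1 / Suc n)) \<longlonglongrightarrow> D \<bullet> e"
proof -
  have "((\<lambda>t. x + t *\<^sub>R e) has_derivative (\<lambda>t. t *\<^sub>R e)) (at 0)"
    by (auto intro!: derivative_eq_intros)
  moreover have "(\<phi> has_derivative (\<lambda>h. h \<bullet> D)) (at (x + 0 *\<^sub>R e))"
    using assms by (simp add: gderiv_def)
  ultimately have "((\<lambda>t. \<phi> (x + t *\<^sub>R e)) has_derivative (\<lambda>t. (t *\<^sub>R e) \<bullet> D)) (at 0)"
    by (rule has_derivative_compose)
  then have "((\<lambda>t. \<phi> (x + t *\<^sub>R e)) has_real_derivative D \<bullet> e) (at 0)"
    unfolding has_field_derivative_def by (simp add: inner_commute mult_commute_abs)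
  then have "(\<lambda>t. (\<phi> (x + t *\<^sub>R e) - \<phi> x) / t) \<midarrow>0\<rightarrow> D \<bullet> e"
    by (simp add: has_field_derivative_iff)
  then show ?thesis
    by (rule filterlim_compose)
      (use lim_1_over_n[where 'a=real, THEN LIMSEQ_Suc] in \<open>auto simp: filterlim_at\<close>)
qed

text \<open>The gradient is almost everywhere bounded, on a bounded set, and a limit of continuous
  difference quotients, hence integrable; its variation is controlled one partial derivative of the
  test field at a time.\<close>

lemma grad_in_BV_field:
  assumes "open \<Omega>" and sub: "\<Omega> \<subseteq> cball 0 \<rho>"
    and conv: "convex_on UNIV g1" "convex_on UNIV g2"
    and lip: "L1-lipschitz_on UNIV g1" "L2-lipschitz_on UNIV g2"
    and \<phi>: "\<And>x. x \<in> \<Omega> \<Longrightarrow> \<phi> x = g1 x - g2 x"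
    and diff: "AE x in lebesgue_on \<Omega>. \<phi> differentiable (at x)"
  shows "grad \<phi> \<in> BV_field \<Omega>"
proof -
  define g where "g = (\<lambda>x. g1 x - g2 x)"
  have \<Omega>m: "\<Omega> \<in> sets lebesgue" using \<open>open \<Omega>\<close> by auto
  have gL: "(L1 + L2)-lipschitz_on UNIV g" unfolding g_def by (intro lipschitz_intros lip)
  then have gc: "continuous_on UNIV g" by (rule lipschitz_on_continuous_on)
  have \<Omega>fin: "emeasure lebesgue \<Omega> < \<infinity>"
    using emeasure_bounded_finite[OF bounded_subset[OF bounded_cball sub]] \<open>open \<Omega>\<close>
    by (simp add: emeasure_completion)
  have deriv: "AE x in lebesgue. x \<in> \<Omega> \<longrightarrow> GDERIV g x :> grad \<phi> x"
  proof -
    have "AE x in lebesgue. x \<in> \<Omega> \<longrightarrow> \<phi> differentiable (at x)"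
      using diff \<Omega>m by (simp add: AE_restrict_space_iff)
    then show ?thesis
    proof eventually_elim
      case (elim x)
      then show ?case
        using GDERIV_transform_open[OF \<open>open \<Omega>\<close> _ _ differentiable_imp_GDERIV_grad, of x \<phi> g] \<phi>
        by (auto simp: g_def)
    qed
  qed
  have "(\<lambda>x. grad \<phi> x $ i) \<in> BV \<Omega>" for i
  proof -
    define u where "u = (\<lambda>x. grad \<phi> x $ i)"
    define e :: plane where "e = axis i 1"
    define U where "U = (\<lambda>n x. (g (x + (1 / Suc n) *\<^sub>R e) - g x) / (1 / Suc n))"
    have e: "norm e = 1" by (simp add: e_def)
    have U_lim: "AE x in lebesgue. x \<in> \<Omega> \<longrightarrow> (\<lambda>n. U n x) \<longlonglongrightarrow> u x"
      using deriv
    proof eventually_elim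
      case (elim x)
      then show ?case
        using GDERIV_difference_quotient[of g x "grad \<phi> x" e] by (auto simp: U_def u_def e_def inner_axis)
    qed
    have U_meas: "U n \<in> borel_measurable lebesgue" for n
      unfolding U_def
      by (intro continuous_imp_lebesgue_measurable continuous_intros continuous_on_UNIV_comp[OF gc]) simp
    have U_le: "\<bar>U n x\<bar> \<le> L1 + L2" for n x
    proof -
      have "\<bar>g (x + (1 / Suc n) *\<^sub>R e) - g x\<bar> \<le> (L1 + L2) * (1 / Suc n)"
        using lipschitz_onD[OF gL, of "x + (1 / Suc n) *\<^sub>R e" x] e by (simp add: dist_norm)
      then have "\<bar>g (x + (1 / Suc n) *\<^sub>R e) - g x\<bar> / (1 / Suc n) \<le> L1 + L2"
        by (subst pos_divide_le_eq) auto
      then show ?thesis by (simp add: U_def abs_mult)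
    qed
    \<comment> \<open>\<open>grad\<close> is unspecified where \<phi> is not differentiable, so
      measurability comes from the limit of the quotients and the completeness of Lebesgue
      measure.\<close>
    have u_meas: "(\<lambda>x. indicator \<Omega> x * u x) \<in> borel_measurable lebesgue"
    proof (rule borel_measurable_AE)
      show "(\<lambda>x. lim (\<lambda>n. indicator \<Omega> x * U n x)) \<in> borel_measurable lebesgue"
        using U_meas \<Omega>m by (intro borel_measurable_lim_metric borel_measurable_times) auto
      show "AE x in lebesgue. lim (\<lambda>n. indicator \<Omega> x * U n x) = indicator \<Omega> x * u x"
        using U_lim by eventually_elim (auto simp: indicator_def limI)
    qed
    have u_le: "AE x in lebesgue. \<bar>indicator \<Omega> x * u x\<bar> \<le> L1 + L2"
      using U_lim
    proof eventually_elim
      case (elim x)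
      show ?case
      proof (cases "x \<in> \<Omega>")
        case True
        then have "(\<lambda>n. \<bar>U n x\<bar>) \<longlonglongrightarrow> \<bar>u x\<bar>" using elim by (auto intro: tendsto_rabs)
        then have "\<bar>u x\<bar> \<le> L1 + L2" by (rule tendsto_upperbound) (auto simp: U_le)
        then show ?thesis using True by simp
      qed (use lipschitz_on_nonneg[OF gL] in simp)
    qed
    have i: "integrable lebesgue (\<lambda>x. indicator \<Omega> x * u x * w x)"
      if w: "continuous_on UNIV w" "\<And>x. \<bar>w x\<bar> \<le> B" for w B
    proof (rule Bochner_Integration.integrable_bound)
      show "integrable lebesgue (\<lambda>x. indicator \<Omega> x * ((L1 + L2) * B))"
        using \<Omega>m \<Omega>fin by (intro integrable_mult_left integrable_real_indicator)
      show "(\<lambda>x. indicator \<Omega> x * u x * w x) \<in> borel_measurable lebesgue"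
        by (rule borel_measurable_times[OF u_meas continuous_imp_lebesgue_measurable[OF w(1)]])
      show "AE x in lebesgue. norm (indicator \<Omega> x * u x * w x) \<le> norm (indicator \<Omega> x * ((L1 + L2) * B))"
        using u_le
      proof eventually_elim
        case (elim x)
        have "0 \<le> L1 + L2" by (rule lipschitz_on_nonneg[OF gL])
        moreover have "0 \<le> B" using w(2)[of x] by linarith
        ultimately show ?case
          using elim mult_mono[OF elim w(2)[of x]] by (cases "x \<in> \<Omega>") (auto simp: abs_mult)
      qed
    qed
    have "set_integrable lebesgue \<Omega> u"
      using i[of "\<lambda>_. 1" 1] by (simp add: set_integrable_def)
    moreover have "(LINT x:\<Omega>|lebesgue. u x * divergence \<psi> x)
        \<le> 2 * ((L1 + L2) * measure lborel (cball (0::plane) (\<rho> + 3)))" if \<psi>: "test_field \<Omega> \<psi>" for \<psi>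
    proof -
      define K where "K = closure {x. \<psi> x \<noteq> 0}"
      have K: "compact K" "closed K" "K \<subseteq> \<Omega>" and K0: "\<And>x. x \<notin> K \<Longrightarrow> \<psi> x = 0"
        and \<psi>1: "\<And>x. norm (\<psi> x) \<le> 1"
        and \<psi>c: "\<And>h. continuous_on UNIV (\<lambda>x. frechet_derivative \<psi> (at x) h)"
        and \<psi>d: "\<And>x. (\<psi> has_derivative frechet_derivative \<psi> (at x)) (at x)"
        using \<psi> closure_subset[of "{x. \<psi> x \<noteq> 0}"]
        by (auto simp: test_field_def K_def differentiable_on_def frechet_derivative_works[symmetric])
      define \<eta>' where "\<eta>' = (\<lambda>j x. frechet_derivative \<psi> (at x) (axis j 1) $ j)"
      have \<eta>'c: "continuous_on UNIV (\<eta>' j)" for j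
        unfolding \<eta>'_def by (intro continuous_intros \<psi>c)
      have \<eta>'d: "((\<lambda>t. \<psi> (x + t *\<^sub>R axis j 1) $ j) has_real_derivative \<eta>' j x) (at 0)" for x j
      proof -
        have "((\<lambda>t. x + t *\<^sub>R axis j 1) has_derivative (\<lambda>t. t *\<^sub>R axis j 1)) (at 0)"
          by (auto intro!: derivative_eq_intros)
        moreover have "(\<psi> has_derivative frechet_derivative \<psi> (at x)) (at (x + 0 *\<^sub>R axis j 1))"
          using \<psi>d by simp
        ultimately have "((\<lambda>t. \<psi> (x + t *\<^sub>R axis j 1)) has_derivative
            (\<lambda>t. frechet_derivative \<psi> (at x) (t *\<^sub>R axis j 1))) (at 0)"
          by (rule has_derivative_compose)
        then have "((\<lambda>t. \<psi> (x + t *\<^sub>R axis j 1) $ j) has_derivative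
            (\<lambda>t. frechet_derivative \<psi> (at x) (t *\<^sub>R axis j 1) $ j)) (at 0)"
          by (rule bounded_linear.has_derivative[OF bounded_linear_vec_nth])
        then show ?thesis
          by (simp add: has_field_derivative_def \<eta>'_def linear_cmul[OF has_derivative_linear[OF \<psi>d]]
              mult.commute[of _ "_ $ j"])
      qed
      have le: "\<bar>LINT x:\<Omega>|lebesgue. u x * \<eta>' j x\<bar>
          \<le> (L1 + L2) * measure lborel (cball (0::plane) (\<rho> + 3))" for j
      proof (rule integral_partial_derivatives_le[OF conv lip sub e _ u_meas _ _ _ K(2,3) _ \<eta>'d \<eta>'c])
        show "AE x in lebesgue. x \<in> \<Omega> \<longrightarrow> (\<lambda>n. (g1 (x + (1 / Suc n) *\<^sub>R e)
            - g2 (x + (1 / Suc n) *\<^sub>R e) - (g1 x - g2 x)) / (1 / Suc n)) \<longlonglongrightarrow> u x"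
          using U_lim by (simp add: U_def g_def)
        have "continuous_on UNIV \<psi>"
          using \<psi>d by (intro continuous_at_imp_continuous_on) (auto intro: has_derivative_continuous)
        then show "continuous_on UNIV (\<lambda>x. \<psi> x $ j)" by (intro continuous_intros)
        show "\<bar>\<psi> x $ j\<bar> \<le> 1" for x using component_le_norm_cart[of "\<psi> x" j] \<psi>1[of x] by linarith
      qed (auto simp: K0)
      \<comment> \<open>Needed to split the integral of the divergence. Outside \<open>K\<close> the
        derivative of the test field vanishes, so continuity on the compact set \<open>K\<close>
        bounds it.\<close>
      have i\<eta>: "integrable lebesgue (\<lambda>x. indicator \<Omega> x * u x * \<eta>' j x)" for j
      proof -
        have bK: "bounded (\<eta>' j ` K)"
          by (intro compact_imp_bounded compact_continuous_image K(1)) (auto intro: continuous_on_subset[OF \<eta>'c])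
        then obtain B where B: "\<And>x. x \<in> K \<Longrightarrow> \<bar>\<eta>' j x\<bar> \<le> B" by (auto simp: bounded_iff)
        have "\<eta>' j x = 0" if "x \<notin> K" for x
        proof -
          have "((\<lambda>_. 0) has_derivative frechet_derivative \<psi> (at x)) (at x)"
            by (rule has_derivative_transform_within_open[OF \<psi>d, of "- K"]) (use K K0 that in auto)
          then have "frechet_derivative \<psi> (at x) = (\<lambda>_. 0)"
            using has_derivative_unique has_derivative_const by blast
          then show ?thesis by (simp add: \<eta>'_def)
        qed
        then have "\<bar>\<eta>' j x\<bar> \<le> max B 0" for x
          using B[of x] by (cases "x \<in> K") (auto simp: le_max_iff_disj)
        then show ?thesis by (rule i[OF \<eta>'c])
      qed
      have div: "divergence \<psi> x = \<eta>' 1 x + \<eta>' 2 x" for x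
        by (simp add: divergence_def trace_def jacobian_def matrix_def \<eta>'_def sum_2)
      have "(LINT x:\<Omega>|lebesgue. u x * divergence \<psi> x)
          = (LINT x:\<Omega>|lebesgue. u x * \<eta>' 1 x) + (LINT x:\<Omega>|lebesgue. u x * \<eta>' 2 x)"
        using i\<eta> by (simp add: set_lebesgue_integral_def div distrib_left mult.assoc)
      then show ?thesis using le[of 1] le[of 2] by linarith
    qed
    ultimately show ?thesis unfolding BV_def u_def by (auto intro!: bdd_aboveI)
  qed
  then show ?thesis by (simp add: BV_field_def)
qed

subsection \<open>Jumps and traces\<close>

text \<open>A one-sided limit, uniform on every cone
  \<open>c * norm (y - x) < (y - x) \<bullet> w\<close>, that says nothing about tangential
  approach. It therefore also makes sense at points of a curved jump line.\<close>

definition sector_limit :: "(plane \<Rightarrow> plane) \<Rightarrow> plane \<Rightarrow> plane \<Rightarrow> plane \<Rightarrow> bool" where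
  "sector_limit u x w a \<longleftrightarrow> (\<forall>c>0. \<forall>e>0. \<exists>\<delta>>0. \<forall>y.
     norm (y - x) < \<delta> \<longrightarrow> c * norm (y - x) < (y - x) \<bullet> w \<longrightarrow> norm (u y - a) < e)"

lemma sector_limitD:
  assumes "sector_limit u x w a" "0 < c" "0 < e"
  obtains \<delta> where "0 < \<delta>"
    "\<And>y. norm (y - x) < \<delta> \<Longrightarrow> c * norm (y - x) < (y - x) \<bullet> w \<Longrightarrow> norm (u y - a) < e"
  using assms unfolding sector_limit_def by blast

lemma half_ball_in_lebesgue: "half_ball x r \<nu> \<in> sets lebesgue"
proof -
  have "open {y. (y - x) \<bullet> \<nu> > 0}" by (intro open_Collect_less continuous_intros)
  moreover have "half_ball x r \<nu> = ball x r \<inter> {y. (y - x) \<bullet> \<nu> > 0}" by (auto simp: half_ball_def)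
  ultimately have "open (half_ball x r \<nu>)" by auto
  then show ?thesis by auto
qed

text \<open>The integral of a nonintegrable function is 0 by convention; integrability rules out
  that an \<open>average\<close> vanishes for this reason.\<close>

lemma BV_field_set_integrable_norm:
  assumes u: "u \<in> BV_field \<Omega>" and H: "H \<in> sets lebesgue" "H \<subseteq> \<Omega>" "bounded H"
  shows "set_integrable lebesgue H (\<lambda>y. norm (u y - a))"
proof -
  have "set_integrable lebesgue \<Omega> (\<lambda>y. u y $ i)" for i
    using u by (auto simp: BV_field_def BV_def)
  then have i: "set_integrable lebesgue H (\<lambda>y. u y $ i)" for i
    using H set_integrable_subset by blast
  have "emeasure lebesgue H < \<infinity>"
    using bounded_set_imp_lmeasurable[OF H(3,1)] unfolding fmeasurable_def by blast
  then have ic: "set_integrable lebesgue H (\<lambda>y. c)" for c :: real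
    using H(1) unfolding set_integrable_def by (auto intro: integrable_mult_left integrable_real_indicator)
  have id: "set_integrable lebesgue H (\<lambda>y. (u y - a) $ i)" for i
    using set_integral_diff(1)[OF i ic] by simp
  have m: "(\<lambda>y. indicator H y *\<^sub>R (u y - a)) \<in> borel_measurable lebesgue"
  proof (subst borel_measurable_euclidean_space, intro ballI)
    fix b :: plane assume "b \<in> Basis"
    then obtain i where "b = axis i 1" by (auto simp: Basis_vec_def)
    then show "(\<lambda>y. (indicator H y *\<^sub>R (u y - a)) \<bullet> b) \<in> borel_measurable lebesgue"
      using borel_measurable_integrable[OF id[of i, unfolded set_integrable_def]] by (simp add: inner_axis)
  qed
  have m': "(\<lambda>y. indicator H y *\<^sub>R norm (u y - a)) \<in> borel_measurable lebesgue"
    using measurable_compose[OF m borel_measurable_norm] by simp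
  have "set_integrable lebesgue H (\<lambda>y. \<bar>(u y - a) $ 1\<bar> + \<bar>(u y - a) $ 2\<bar>)"
    by (intro set_integral_add set_integrable_abs id)
  then show ?thesis unfolding set_integrable_def
  proof (rule Bochner_Integration.integrable_bound)
    show "AE y in lebesgue. norm (indicator H y *\<^sub>R norm (u y - a))
        \<le> norm (indicator H y *\<^sub>R (\<bar>(u y - a) $ 1\<bar> + \<bar>(u y - a) $ 2\<bar>))"
      using norm_le_l1_cart[of "u _ - a"] by (auto simp: sum_2 indicator_def)
  qed (rule m')
qed

text \<open>A ball inside half of the unit disc keeps, under scaling, a fixed share of the half
  ball. If \<open>u\<close> tends to \<open>c\<close> on these balls and \<open>a\<close> differs
  from \<open>c\<close>, the averages of \<open>norm (u y - a)\<close> stay away from 0.\<close>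

lemma half_ball_trace_eq:
  assumes \<Omega>: "open \<Omega>" "x \<in> \<Omega>" and u: "u \<in> BV_field \<Omega>"
    and lim: "((\<lambda>r. average (half_ball x r \<nu>) (\<lambda>y. norm (u y - a))) \<longlongrightarrow> 0) (at_right 0)"
    and q: "0 < q" and sub: "ball w q \<subseteq> {z. norm z < 1 \<and> 0 < z \<bullet> \<nu>}"
    and conv: "\<And>e. 0 < e \<Longrightarrow> \<exists>\<delta>>0. \<forall>r. 0 < r \<longrightarrow> r < \<delta> \<longrightarrow> (\<forall>z\<in>ball w q. norm (u (x + r *\<^sub>R z) - c) < e)"
  shows "a = c"
proof (rule ccontr)
  assume "a \<noteq> c"
  define d where "d = norm (a - c)"
  have d: "0 < d" using \<open>a \<noteq> c\<close> by (simp add: d_def)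
  obtain \<delta> where \<delta>: "0 < \<delta>" "\<And>r z. 0 < r \<Longrightarrow> r < \<delta> \<Longrightarrow> z \<in> ball w q \<Longrightarrow> norm (u (x + r *\<^sub>R z) - c) < d / 2"
    using conv[of "d/2"] d by auto
  obtain \<delta>' where \<delta>': "0 < \<delta>'" "ball x \<delta>' \<subseteq> \<Omega>" using \<Omega> by (auto simp: open_contains_ball)
  have "\<forall>\<^sub>F r in at_right 0. average (half_ball x r \<nu>) (\<lambda>y. norm (u y - a)) < d / 2 * q\<^sup>2"
    using lim d q by (intro order_tendstoD) auto
  then obtain b where b: "0 < b"
    "\<And>r. 0 < r \<Longrightarrow> r < b \<Longrightarrow> average (half_ball x r \<nu>) (\<lambda>y. norm (u y - a)) < d / 2 * q\<^sup>2"
    by (auto simp: eventually_at_right_field)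
  define r where "r = min b (min \<delta> \<delta>') / 2"
  have r: "0 < r" "r < b" "r < \<delta>" "r < \<delta>'" using b(1) \<delta>(1) \<delta>'(1) by (auto simp: r_def)
  define H where "H = half_ball x r \<nu>"
  \<comment> \<open>This ball takes up at least the share \<open>q\<^sup>2\<close> of
    \<open>H\<close>, and on it \<open>norm (u y - a)\<close> is at least \<open>d / 2\<close>;
    hence the threshold \<open>d / 2 * q\<^sup>2\<close> above.\<close>
  define B where "B = ball (x + r *\<^sub>R w) (r * q)"
  have Hm: "H \<in> sets lebesgue" by (simp add: H_def half_ball_in_lebesgue)
  have Hb: "H \<subseteq> ball x r" by (auto simp: H_def half_ball_def)
  then have Hl: "H \<in> lmeasurable"
    by (intro bounded_set_imp_lmeasurable Hm) (auto intro: bounded_subset)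
  have Bform: "\<exists>z\<in>ball w q. y = x + r *\<^sub>R z" if "y \<in> B" for y
  proof
    show "y = x + r *\<^sub>R ((1/r) *\<^sub>R (y - x))" using r by simp
    have "w - (1/r) *\<^sub>R (y - x) = (1/r) *\<^sub>R ((x + r *\<^sub>R w) - y)"
      using r by (simp add: algebra_simps)
    moreover have "norm ((x + r *\<^sub>R w) - y) < r * q" using that by (simp add: B_def dist_norm)
    ultimately show "(1/r) *\<^sub>R (y - x) \<in> ball w q"
      using r by (simp add: dist_norm pos_divide_less_eq mult.commute)
  qed
  have BH: "B \<subseteq> H"
  proof
    fix y assume "y \<in> B"
    then obtain z where z: "z \<in> ball w q" "y = x + r *\<^sub>R z" using Bform by blast
    then have "norm z < 1" "0 < z \<bullet> \<nu>" using sub by auto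
    then show "y \<in> H" using z r by (simp add: H_def half_ball_def dist_norm)
  qed
  have int: "set_integrable lebesgue H (\<lambda>y. norm (u y - a))"
  proof (rule BV_field_set_integrable_norm[OF u Hm])
    show "H \<subseteq> \<Omega>" using Hb subset_ball[of r \<delta>' x] \<delta>'(2) r(4) by auto
    show "bounded H" using Hb bounded_ball bounded_subset by blast
  qed
  have iB: "integrable lebesgue (\<lambda>y. indicator B y * (d / 2))"
    using lmeasurable_ball[of "x + r *\<^sub>R w" "r * q"] unfolding B_def fmeasurable_def
    by (intro integrable_mult_left integrable_real_indicator) auto
  have "measure lebesgue B * (d / 2) = (LINT y|lebesgue. indicator B y * (d / 2))"
    by (simp add: B_def)
  also have "\<dots> \<le> (LINT y:H|lebesgue. norm (u y - a))"
    unfolding set_lebesgue_integral_def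
  proof (rule integral_mono[OF iB int[unfolded set_integrable_def]])
    fix y
    show "indicator B y * (d / 2) \<le> indicator H y *\<^sub>R norm (u y - a)"
    proof (cases "y \<in> B")
      case True
      then obtain z where z: "z \<in> ball w q" "y = x + r *\<^sub>R z" using Bform by blast
      then have "norm (u y - c) < d / 2" using \<delta>(2) r by auto
      then have "d / 2 \<le> norm (u y - a)"
        using norm_triangle_ineq4[of "u y - c" "u y - a"] by (simp add: d_def)
      then show ?thesis using True BH by auto
    qed simp
  qed
  finally have 1: "measure lebesgue B * (d / 2) \<le> (LINT y:H|lebesgue. norm (u y - a))" .
  have mB: "measure lebesgue B = unit_ball_vol 2 * (r * q)\<^sup>2"
    using content_ball[of "r * q" "x + r *\<^sub>R w"] r q by (simp add: B_def)
  have mH: "measure lebesgue H \<le> unit_ball_vol 2 * r\<^sup>2"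
    using measure_mono_fmeasurable[OF Hb Hm] content_ball[of r x] r by simp
  have V: "0 < unit_ball_vol (2::real)" by simp
  have "measure lebesgue B \<le> measure lebesgue H"
    by (rule measure_mono_fmeasurable[OF BH _ Hl]) (simp add: B_def)
  then have H0: "0 < measure lebesgue H" using mB V r q by (smt (verit) mult_pos_pos zero_less_power)
  have "d / 2 * q\<^sup>2 * measure lebesgue H \<le> d / 2 * q\<^sup>2 * (unit_ball_vol 2 * r\<^sup>2)"
    using d by (intro mult_left_mono mH) auto
  also have "\<dots> = measure lebesgue B * (d / 2)" by (simp add: mB power_mult_distrib)
  also note 1
  finally have "d / 2 * q\<^sup>2 \<le> average H (\<lambda>y. norm (u y - a))"
    using H0 by (simp add: average_def pos_le_divide_eq)
  with b(2)[OF r(1,2)] show False by (simp add: H_def)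
qed

text \<open>Unless the half planes of \<nu> and \<open>w\<close> are opposite, they share an open
  sector, and a ball around a multiple of \<open>\<nu> + w\<close> fits into it.\<close>

lemma half_ball_trace_eq_sector:
  assumes \<Omega>: "open \<Omega>" "x \<in> \<Omega>" and u: "u \<in> BV_field \<Omega>"
    and lim: "((\<lambda>r. average (half_ball x r \<nu>) (\<lambda>y. norm (u y - a))) \<longlongrightarrow> 0) (at_right 0)"
    and nrm: "norm \<nu> = 1" "norm w = 1" "\<nu> \<noteq> - w" and sec: "sector_limit u x w c"
  shows "a = c"
proof -
  \<comment> \<open>The common value of \<open>p \<bullet> \<nu>\<close> and
    \<open>p \<bullet> w\<close> for the centre \<open>p\<close> below; half of it serves both as
    the radius of the ball and as the aperture of the sector.\<close>
  define q where "q = (1 + \<nu> \<bullet> w) / 4"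
  have "\<nu> \<bullet> w \<noteq> - 1"
  proof
    assume "\<nu> \<bullet> w = - 1"
    then have "(\<nu> + w) \<bullet> (\<nu> + w) = 0"
      using nrm(1,2) by (simp add: inner_simps inner_commute norm_eq_1)
    then show False using nrm(3) by (simp add: add_eq_0_iff2)
  qed
  then have q: "0 < q" "q \<le> 1/2"
    using Cauchy_Schwarz_ineq2[of \<nu> w] nrm by (auto simp: q_def abs_le_iff)
  define p where "p = (1/4) *\<^sub>R (\<nu> + w)"
  have p: "p \<bullet> \<nu> = q" "p \<bullet> w = q" "norm p \<le> 1/2"
  proof -
    have "\<nu> \<bullet> \<nu> = 1" "w \<bullet> w = 1" using nrm by (simp_all add: norm_eq_1)
    then show "p \<bullet> \<nu> = q" "p \<bullet> w = q" by (simp_all add: p_def q_def inner_simps inner_commute)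
    show "norm p \<le> 1/2" using nrm norm_triangle_ineq[of \<nu> w] by (simp add: p_def)
  qed
  have *: "norm z < 1 \<and> q/2 < z \<bullet> \<nu> \<and> q/2 < z \<bullet> w" if "z \<in> ball p (q/2)" for z
  proof -
    have z: "norm (z - p) < q/2" using that by (simp add: dist_norm norm_minus_commute)
    have "\<bar>(z - p) \<bullet> \<nu>\<bar> < q/2" "\<bar>(z - p) \<bullet> w\<bar> < q/2"
      using Cauchy_Schwarz_ineq2[of "z - p" \<nu>] Cauchy_Schwarz_ineq2[of "z - p" w] nrm z by auto
    moreover have "norm z \<le> norm p + norm (z - p)" using norm_triangle_ineq[of p "z - p"] by simp
    ultimately show ?thesis using p q z unfolding inner_diff_left by linarith
  qed
  show ?thesis
  proof (rule half_ball_trace_eq[OF \<Omega> u lim])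
    show "0 < q/2" using q by simp
    show "ball p (q/2) \<subseteq> {z. norm z < 1 \<and> 0 < z \<bullet> \<nu>}" using * q by (auto dest!: *)
    fix e :: real assume "0 < e"
    moreover have "0 < q/2" using q by simp
    ultimately obtain \<delta> where \<delta>: "0 < \<delta>"
      "\<And>y. norm (y - x) < \<delta> \<Longrightarrow> (q/2) * norm (y - x) < (y - x) \<bullet> w \<Longrightarrow> norm (u y - c) < e"
      using sector_limitD[OF sec] by blast
    show "\<exists>\<delta>>0. \<forall>r. 0 < r \<longrightarrow> r < \<delta> \<longrightarrow> (\<forall>z\<in>ball p (q/2). norm (u (x + r *\<^sub>R z) - c) < e)"
    proof (intro exI conjI allI impI ballI)
      show "0 < \<delta>" by fact
      fix r z assume r: "0 < r" "r < \<delta>" and z: "z \<in> ball p (q/2)"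
      have nz: "norm z < 1" "q/2 < z \<bullet> w" using *[OF z] by auto
      show "norm (u (x + r *\<^sub>R z) - c) < e"
      proof (rule \<delta>(2))
        have "r * norm z \<le> r * 1" using nz r by (intro mult_left_mono) auto
        then have "r * norm z < \<delta>" using r by linarith
        then show "norm (x + r *\<^sub>R z - x) < \<delta>" using r by simp
        have "(q/2) * norm z \<le> (q/2) * 1" using nz q by (intro mult_left_mono) auto
        then have "(q/2) * norm z < z \<bullet> w" using nz by linarith
        then have "r * ((q/2) * norm z) < r * (z \<bullet> w)" using r by simp
        then show "(q/2) * norm (x + r *\<^sub>R z - x) < (x + r *\<^sub>R z - x) \<bullet> w" using r by (simp add: mult.left_commute)
      qed
    qed
  qed
qed

text \<open>If \<nu> were neither \<open>w\<close> nor \<open>- w\<close>, both half balls would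
  overlap the sectors around \<open>w\<close>, and both traces would equal \<open>a'\<close>,
  against \<open>a \<noteq> b\<close>. Otherwise the traces are the sector limits up to
  exchange.\<close>

lemma jump_triple_sector_limits:
  assumes \<Omega>: "open \<Omega>" "x \<in> \<Omega>" and u: "u \<in> BV_field \<Omega>" and w: "norm w = 1"
    and sec: "sector_limit u x w a'" "sector_limit u x (- w) b'" and J: "jump_triple u x a b \<nu>"
  shows "norm (a - b) = norm (a' - b')"
proof -
  have \<nu>: "norm \<nu> = 1" "norm (- \<nu>) = 1" "a \<noteq> b"
    and la: "((\<lambda>r. average (half_ball x r \<nu>) (\<lambda>y. norm (u y - a))) \<longlongrightarrow> 0) (at_right 0)"
    and lb: "((\<lambda>r. average (half_ball x r (- \<nu>)) (\<lambda>y. norm (u y - b))) \<longlongrightarrow> 0) (at_right 0)"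
    using J by (auto simp: jump_triple_def)
  have w': "norm (- w) = 1" using w by simp
  have ww: "w \<noteq> - w"
  proof
    assume "w = - w"
    then have "2 *\<^sub>R w = 0" by (metis scaleR_2 add.right_inverse)
    then show False using w by simp
  qed
  note tr = half_ball_trace_eq_sector[OF \<Omega> u]
  have "\<nu> = w \<or> \<nu> = - w"
  proof (rule ccontr)
    assume n: "\<not> ?thesis"
    then have "a = a'" "b = a'"
      using tr[OF la \<nu>(1) w _ sec(1)] tr[OF lb \<nu>(2) w _ sec(1)] by auto
    then show False using \<nu>(3) by simp
  qed
  then show ?thesis
  proof
    assume "\<nu> = w"
    with ww have "a = a'" "b = b'"
      using tr[OF la \<nu>(1) w _ sec(1)] tr[OF lb \<nu>(2) w' _ sec(2)] by auto
    then show ?thesis by simp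
  next
    assume "\<nu> = - w"
    with ww have "a = b'" "b = a'"
      using tr[OF la \<nu>(1) w' _ sec(2)] tr[OF lb \<nu>(2) w _ sec(1)] by auto
    then show ?thesis by (simp add: norm_minus_commute)
  qed
qed

text \<open>\<open>traces\<close> picks some jump triple; the size of the jump does not depend on
  which.\<close>

lemma norm_traces_diff:
  assumes "open \<Omega>" "x \<in> jump_set \<Omega> u" "u \<in> BV_field \<Omega>" "norm w = 1"
    and "sector_limit u x w a" "sector_limit u x (- w) b"
  shows "norm (trace_plus u x - trace_minus u x) = norm (a - b)"
proof -
  have x: "x \<in> \<Omega>" and "\<exists>p. \<exists>\<nu>. jump_triple u x (fst p) (snd p) \<nu>"
    using assms(2) by (auto simp: jump_set_def)
  then have "\<exists>\<nu>. jump_triple u x (fst (traces u x)) (snd (traces u x)) \<nu>"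
    unfolding traces_def case_prod_beta by (rule_tac someI_ex)
  then show ?thesis
    using jump_triple_sector_limits[OF assms(1) x assms(3-6)]
    by (auto simp: trace_plus_def trace_minus_def)
qed

lemma sector_limit_isCont: "isCont u x \<Longrightarrow> sector_limit u x w (u x)"
  unfolding sector_limit_def continuous_at_eps_delta by (metis dist_norm)

text \<open>At a point of continuity both sector limits are \<open>u x\<close>, so a jump would have
  size 0.\<close>

lemma isCont_not_in_jump_set:
  assumes "open \<Omega>" "u \<in> BV_field \<Omega>" "isCont u x" shows "x \<notin> jump_set \<Omega> u"
proof
  assume "x \<in> jump_set \<Omega> u"
  then obtain a b \<nu> where x: "x \<in> \<Omega>" and J: "jump_triple u x a b \<nu>" by (auto simp: jump_set_def)
  then have "norm (a - b) = norm (u x - u x)"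
    using sector_limit_isCont[OF assms(3)] 
    by (intro jump_triple_sector_limits[OF assms(1) x assms(2), of \<nu>]) (auto simp: jump_triple_def)
  then show False using J by (simp add: jump_triple_def)
qed


subsection \<open>Convex domains\<close>

lemma plane_orthonormal_expansion:
  fixes v e :: plane
  assumes "norm e = 1"
  shows "v = (v \<bullet> e) *\<^sub>R e + (v \<bullet> vector [- (e $ 2), e $ 1]) *\<^sub>R vector [- (e $ 2), e $ 1]"
proof -
  have e: "e $ 1 * e $ 1 + e $ 2 * e $ 2 = 1"
    using assms by (simp add: norm_eq_1 inner_vec_def sum_2)
  have "v $ 1 = (v \<bullet> e) * e $ 1 + (v $ 2 * e $ 1 - v $ 1 * e $ 2) * (- (e $ 2))"
    "v $ 2 = (v \<bullet> e) * e $ 2 + (v $ 2 * e $ 1 - v $ 1 * e $ 2) * e $ 1"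
    using e by (simp_all add: inner_vec_def sum_2) algebra+
  then show ?thesis
    by (simp add: vec_eq_iff forall_2 inner_vec_def[of v "vector _"] sum_2 algebra_simps)
qed

text \<open>Near a boundary point \<open>p\<close> the domain contains, with every point \<open>z\<close>, a cone with axis \<open>- p\<close>
  pointing into the unit ball, hence is the epigraph of the infimum of these cones.\<close>

lemma lipschitz_domain_convex:
  assumes "open \<Omega>" "convex \<Omega>" and ball: "ball 0 1 \<subseteq> \<Omega>"
  shows "lipschitz_domain \<Omega>"
  unfolding lipschitz_domain_def
proof (intro conjI ballI)
  show "open \<Omega>" "connected \<Omega>" using assms convex_connected by auto
  show "\<Omega> \<noteq> {}" using ball by force
  fix p assume p: "p \<in> frontier \<Omega>"
  define D where "D = norm p"
  have "p \<notin> \<Omega>" using p \<open>open \<Omega>\<close> by (simp add: frontier_def interior_open)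
  then have D: "1 \<le> D" using ball by (force simp: D_def)
  define e2 where "e2 = - (1 / D) *\<^sub>R p"
  define e1 where "e1 = (vector [- (e2 $ 2), e2 $ 1] :: plane)"
  have e2: "norm e2 = 1" using D by (auto simp: e2_def D_def)
  have e1: "norm e1 = 1" "e1 \<bullet> e2 = 0"
    using e2 by (simp_all add: norm_eq_1 e1_def inner_vec_def sum_2 algebra_simps)
  have De2: "D *\<^sub>R e2 = - p" using D by (simp add: e2_def)
  \<comment> \<open>With this slope, \<open>L * \<bar>\<beta>\<bar> < \<alpha>\<close> gives
    \<open>\<bar>\<beta> * D / \<alpha>\<bar> \<le> 1/2\<close>, which keeps the point
    \<open>w\<close> below in the unit disc.\<close>
  define L where "L = 2 * D"
  define A where "A = \<Omega> \<inter> ball p (1/2)"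
  define G where "G = (\<lambda>s z. z \<bullet> e2 + L * \<bar>s - z \<bullet> e1\<bar>)"
  define g where "g = (\<lambda>s. Inf (G s ` A))"
  have "p \<in> closure \<Omega>" using p by (simp add: frontier_def)
  then have A: "A \<noteq> {}"
    using open_Int_closure_eq_empty[of "ball p (1/2)" \<Omega>] by (force simp: A_def)
  have bdd: "bdd_below (G s ` A)" for s
  proof (rule bdd_belowI2)
    fix z assume z: "z \<in> A"
    have "\<bar>z \<bullet> e2\<bar> \<le> norm z" using Cauchy_Schwarz_ineq2[of z e2] e2 by simp
    moreover have "norm z \<le> D + 1/2"
      using z norm_triangle_ineq[of p "z - p"] by (simp add: A_def dist_norm norm_minus_commute D_def)
    moreover have "0 \<le> L * \<bar>s - z \<bullet> e1\<bar>" using D by (simp add: L_def)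
    ultimately show "- (D + 1/2) \<le> G s z" unfolding G_def by linarith
  qed
  have g_le: "g s \<le> G s z" if "z \<in> A" for s z
    unfolding g_def by (rule cINF_lower[OF bdd that])
  have g_lip: "g s \<le> g t + L * \<bar>s - t\<bar>" for s t
  proof -
    have "g s - L * \<bar>s - t\<bar> \<le> g t"
    proof (subst (2) g_def, rule cINF_greatest[OF A])
      fix z assume "z \<in> A"
      then have "g s \<le> G s z" by (rule g_le)
      also have "\<dots> \<le> G t z + L * \<bar>s - t\<bar>"
      proof -
        have "L * \<bar>s - z \<bullet> e1\<bar> \<le> L * (\<bar>t - z \<bullet> e1\<bar> + \<bar>s - t\<bar>)"
          using D by (intro mult_left_mono) (auto simp: L_def)
        then show ?thesis by (simp add: G_def algebra_simps)
      qed
      finally show "g s - L * \<bar>s - t\<bar> \<le> G t z" by simp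
    qed
    then show ?thesis by simp
  qed
  have lip: "L-lipschitz_on UNIV g"
  proof (rule lipschitz_onI)
    show "dist (g s) (g t) \<le> L * dist s t" for s t
      using g_lip[of s t] g_lip[of t s] by (auto simp: dist_real_def abs_le_iff abs_minus_commute)
  qed (use D in \<open>simp add: L_def\<close>)
  have "x \<in> \<Omega> \<longleftrightarrow> g (x \<bullet> e1) < x \<bullet> e2" if x: "x \<in> ball p (1/2)" for x
  proof
    assume "x \<in> \<Omega>"
    then have "x \<in> A" "open A" using x \<open>open \<Omega>\<close> by (auto simp: A_def)
    then obtain \<tau> where \<tau>: "0 < \<tau>" "cball x \<tau> \<subseteq> A" by (meson open_contains_cball)
    define z where "z = x - \<tau> *\<^sub>R e2"
    have "z \<in> A" using \<tau> e2 by (intro subsetD[OF \<tau>(2)]) (simp add: z_def dist_norm)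
    then have "g (x \<bullet> e1) \<le> G (x \<bullet> e1) z" by (rule g_le)
    also have "\<dots> = x \<bullet> e2 - \<tau>"
      using e1 e2 by (simp add: G_def z_def inner_diff_left inner_commute[of e2 e1] norm_eq_1)
    finally show "g (x \<bullet> e1) < x \<bullet> e2" using \<tau> by simp
  next
    assume "g (x \<bullet> e1) < x \<bullet> e2"
    then obtain z where z: "z \<in> A" "G (x \<bullet> e1) z < x \<bullet> e2"
      unfolding g_def using A bdd by (auto simp: cINF_less_iff)
    define \<alpha> \<beta> where "\<alpha> = (x - z) \<bullet> e2" and "\<beta> = (x - z) \<bullet> e1"
    have ab: "L * \<bar>\<beta>\<bar> < \<alpha>" using z(2) by (simp add: G_def \<alpha>_def \<beta>_def inner_diff_left)
    moreover have "0 \<le> L * \<bar>\<beta>\<bar>" using D by (simp add: L_def)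
    ultimately have a: "0 < \<alpha>" by linarith
    have xz: "x - z = \<alpha> *\<^sub>R e2 + \<beta> *\<^sub>R e1"
      unfolding \<alpha>_def \<beta>_def e1_def by (rule plane_orthonormal_expansion[OF e2])
    have "\<alpha> \<le> norm (x - z)" using norm_cauchy_schwarz[of "x - z" e2] e2 by (simp add: \<alpha>_def)
    also have "\<dots> < 1"
      using z(1) x dist_triangle_half_r[of p x 1 z] by (simp add: A_def dist_norm)
    finally have aD: "\<alpha> \<le> D" using D by simp
    \<comment> \<open>As \<open>- p = D *\<^sub>R e2\<close>, this is
      \<open>z + (D / \<alpha>) *\<^sub>R (x - z)\<close>: the end, inside the unit disc, of a
      segment that starts at \<open>z\<close> and contains \<open>x\<close>.\<close>
    define w where "w = (z - p) + (\<beta> * D / \<alpha>) *\<^sub>R e1"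
    have "\<bar>\<beta> * D / \<alpha>\<bar> \<le> 1/2"
      using ab a D by (simp add: L_def abs_mult field_simps)
    then have "norm ((\<beta> * D / \<alpha>) *\<^sub>R e1) \<le> 1/2" using e1 by simp
    moreover have "norm (z - p) < 1/2" using z(1) by (simp add: A_def dist_norm norm_minus_commute)
    ultimately have "norm w < 1"
      using norm_triangle_ineq[of "z - p" "(\<beta> * D / \<alpha>) *\<^sub>R e1"] unfolding w_def by linarith
    then have "w \<in> \<Omega>" using ball by auto
    moreover have "z \<in> \<Omega>" using z by (simp add: A_def)
    ultimately have "(1 - \<alpha> / D) *\<^sub>R z + (\<alpha> / D) *\<^sub>R w \<in> \<Omega>"
      using \<open>convex \<Omega>\<close> a aD D by (intro convexD) auto
    moreover have "(1 - \<alpha> / D) *\<^sub>R z + (\<alpha> / D) *\<^sub>R w = x"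
    proof -
      have "w = z + D *\<^sub>R e2 + (\<beta> * D / \<alpha>) *\<^sub>R e1" by (simp add: w_def De2)
      then have "(\<alpha> / D) *\<^sub>R w = (\<alpha> / D) *\<^sub>R z + \<alpha> *\<^sub>R e2 + \<beta> *\<^sub>R e1"
        using a D by (simp add: scaleR_add_right)
      then show ?thesis using xz by (simp add: algebra_simps)
    qed
    ultimately show "x \<in> \<Omega>" by simp
  qed
  then have "\<Omega> \<inter> ball p (1/2) = {x \<in> ball p (1/2). g (x \<bullet> e1) < x \<bullet> e2}" by blast
  then show "\<exists>r>0. \<exists>e1 e2. \<exists>g::real \<Rightarrow> real. \<exists>L.
      norm e1 = 1 \<and> norm e2 = 1 \<and> e1 \<bullet> e2 = 0 \<and> L-lipschitz_on UNIV g \<and>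
      \<Omega> \<inter> ball p r = {x \<in> ball p r. g (x \<bullet> e1) < x \<bullet> e2}"
    using e1 e2 lip by (intro exI[of _ "1/2::real"]) auto
qed

section \<open>Distances to the frontier and to a convex set\<close>

lemma infdist_frontier_le:
  fixes \<Omega> :: "'a::euclidean_space set"
  assumes "x \<in> \<Omega>" "z \<notin> \<Omega>" shows "infdist x (frontier \<Omega>) \<le> dist x z"
proof -
  have "closed_segment x z \<inter> frontier \<Omega> \<noteq> {}"
    by (rule connected_Int_frontier) (use assms in auto)
  then obtain w where w: "w \<in> closed_segment x z" "w \<in> frontier \<Omega>" by blast
  have "infdist x (frontier \<Omega>) \<le> dist x w" by (rule infdist_le[OF w(2)])
  also have "\<dots> \<le> dist x z" using segment_bound1[OF w(1)] by (simp add: dist_norm norm_minus_commute)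
  finally show ?thesis .
qed

lemma infdist_frontier_ge:
  fixes \<Omega> :: "'a::euclidean_space set"
  assumes "open \<Omega>" "frontier \<Omega> \<noteq> {}" "ball x r \<subseteq> \<Omega>"
  shows "r \<le> infdist x (frontier \<Omega>)"
  unfolding infdist_notempty[OF assms(2)]
proof (rule cINF_greatest[OF assms(2)])
  fix p assume "p \<in> frontier \<Omega>"
  then have "p \<notin> \<Omega>" using assms(1) by (simp add: frontier_def interior_open)
  then show "r \<le> dist x p" using assms(3) by force
qed

lemma convex_on_infdist:
  fixes P :: "'a::euclidean_space set"
  assumes "closed P" "convex P" "P \<noteq> {}" shows "convex_on UNIV (\<lambda>x. infdist x P)"
proof (rule convex_onI)
  fix t :: real and x y :: 'a assume t: "0 < t" "t < 1"
  obtain p q where p: "p \<in> P" "infdist x P = dist x p" and q: "q \<in> P" "infdist y P = dist y q"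
    using infdist_attains_inf[OF assms(1,3)] by metis
  have "(1 - t) *\<^sub>R p + t *\<^sub>R q \<in> P" using assms(2) p(1) q(1) t by (intro convexD) auto
  then have "infdist ((1 - t) *\<^sub>R x + t *\<^sub>R y) P
      \<le> dist ((1 - t) *\<^sub>R x + t *\<^sub>R y) ((1 - t) *\<^sub>R p + t *\<^sub>R q)" by (rule infdist_le)
  also have "\<dots> = norm ((1 - t) *\<^sub>R (x - p) + t *\<^sub>R (y - q))"
    by (simp add: dist_norm algebra_simps)
  also have "\<dots> \<le> (1 - t) * norm (x - p) + t * norm (y - q)"
    using t by (intro norm_triangle_le) simp
  finally show "infdist ((1 - t) *\<^sub>R x + t *\<^sub>R y) P \<le> (1 - t) * infdist x P + t * infdist y P"
    by (simp add: p q dist_norm)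
qed simp

lemma lipschitz_on_infdist: "1-lipschitz_on S (\<lambda>x. infdist x P)"
  by (rule lipschitz_onI) (use infdist_triangle_abs in \<open>auto simp: dist_real_def\<close>)

lemma infdist_closest_point:
  fixes P :: "'a::euclidean_space set"
  shows "closed P \<Longrightarrow> P \<noteq> {} \<Longrightarrow> infdist x P = norm (x - closest_point P x)"
  by (simp add: infdist_eq_setdist setdist_closest_point dist_norm)

text \<open>\<open>P\<close> lies in the half space behind the hyperplane through the closest point,
  and the left side is the signed distance of \<open>y\<close> to that hyperplane. For
  \<open>x\<close> in \<open>P\<close> the normal is \<open>sgn 0 = 0\<close> and the left side
  vanishes.\<close>

lemma infdist_ge_normal:
  fixes P :: "'a::euclidean_space set"
  assumes P: "closed P" "convex P" "P \<noteq> {}"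
  shows "sgn (x - closest_point P x) \<bullet> (y - closest_point P x) \<le> infdist y P"
proof -
  define p n where "p = closest_point P x" and "n = sgn (x - p)"
  have "n \<bullet> (closest_point P y - p) \<le> 0"
    using closest_point_dot[OF P(2,1) closest_point_in_set[OF P(1,3)], of x y]
    by (simp add: n_def p_def sgn_div_norm mult_nonneg_nonpos)
  moreover have "n \<bullet> (y - closest_point P y) \<le> norm n * norm (y - closest_point P y)"
    by (rule norm_cauchy_schwarz)
  moreover have "norm n * norm (y - closest_point P y) \<le> 1 * norm (y - closest_point P y)"
    by (intro mult_right_mono) (auto simp: n_def norm_sgn)
  moreover have "n \<bullet> (y - p) = n \<bullet> (closest_point P y - p) + n \<bullet> (y - closest_point P y)"
    by (simp add: inner_diff_right)
  ultimately show ?thesis using infdist_closest_point[OF P(1,3), of y] by (simp add: n_def p_def)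
qed

text \<open>The distance is squeezed between its supporting affine function and the distance to the
  projection of \<open>x\<close>, which have the same derivative at \<open>x\<close>.\<close>

lemma GDERIV_infdist:
  fixes P :: "'a::euclidean_space set"
  assumes P: "closed P" "convex P" "P \<noteq> {}" and x: "x \<notin> P"
  shows "GDERIV (\<lambda>y. infdist y P) x :> sgn (x - closest_point P x)"
proof -
  define p n where "p = closest_point P x" and "n = sgn (x - p)"
  have pP: "p \<in> P" using closest_point_in_set[OF P(1,3)] by (simp add: p_def)
  then have xp: "x - p \<noteq> 0" using x by auto
  have dx: "infdist x P = norm (x - p)" using infdist_closest_point[OF P(1,3)] by (simp add: p_def)
  have nx: "n \<bullet> (x - p) = norm (x - p)"
    using xp by (simp add: n_def sgn_div_norm power2_norm_eq_inner[symmetric] power2_eq_square)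
  have "((\<lambda>y. norm (y - p)) has_derivative (\<lambda>h. h \<bullet> n)) (at x)"
  proof -
    have "(norm has_derivative (\<lambda>h. h \<bullet> n)) (at (x - p))"
      using GDERIV_norm[OF xp] by (simp add: gderiv_def n_def)
    moreover have "((\<lambda>y. y - p) has_derivative (\<lambda>h. h)) (at x)" by (auto intro!: derivative_eq_intros)
    ultimately show ?thesis by (rule has_derivative_compose[rotated])
  qed
  then have lim: "((\<lambda>y. norm (norm (y - p) - norm (x - p) - (y - x) \<bullet> n) / norm (y - x)) \<longlongrightarrow> 0) (at x)"
    by (simp add: has_derivative_iff_norm)
  have "((\<lambda>y. norm (infdist y P - infdist x P - (y - x) \<bullet> n) / norm (y - x)) \<longlongrightarrow> 0) (at x)"
  proof (rule tendsto_sandwich[OF _ _ tendsto_const lim])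
    show "\<forall>\<^sub>F y in at x. norm (infdist y P - infdist x P - (y - x) \<bullet> n) / norm (y - x)
        \<le> norm (norm (y - p) - norm (x - p) - (y - x) \<bullet> n) / norm (y - x)"
    proof (intro always_eventually allI divide_right_mono)
      fix y
      have "infdist y P \<le> norm (y - p)" using infdist_le[OF pP, of y] by (simp add: dist_norm)
      moreover have "norm (x - p) + (y - x) \<bullet> n \<le> infdist y P"
        using infdist_ge_normal[OF P, of x y] nx
        by (simp add: p_def[symmetric] n_def[symmetric] inner_diff_right inner_commute[of n] inner_diff_left)
      ultimately show "norm (infdist y P - infdist x P - (y - x) \<bullet> n)
          \<le> norm (norm (y - p) - norm (x - p) - (y - x) \<bullet> n)" by (simp add: dx)
    qed simp
  qed auto
  then show ?thesis
    unfolding gderiv_def n_def p_def has_derivative_iff_norm by (simp add: bounded_linear_inner_left)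
qed

lemma isCont_infdist_normal:
  fixes P :: "'a::euclidean_space set"
  assumes "closed P" "convex P" "P \<noteq> {}" "x \<notin> P"
  shows "isCont (\<lambda>y. sgn (y - closest_point P y)) x"
proof -
  have "x - closest_point P x \<noteq> 0" using assms closest_point_in_set[OF assms(1,3), of x] by auto
  then show ?thesis
    using continuous_at_closest_point[OF assms(2,1,3)] by (intro continuous_intros isCont_sgn) auto
qed

text \<open>From a frontier point one moves along an outer normal until the circle of radius \<rho>
  is reached; the starting point is the point of \<open>C\<close> nearest to the end. Since
  nearest-point projection does not increase distances, the frontier is covered by a curve no longer
  than the circle.\<close>

lemma hausdorff1_outer_frontier_convex_le:
  fixes C :: "plane set"
  assumes C: "closed C" "convex C" and sub: "C \<subseteq> cball 0 \<rho>" and "0 \<le> \<rho>"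
  shows "hausdorff1_outer (frontier C) \<le> ennreal (2 * pi * \<rho>)"
proof -
  define c where "c = (\<lambda>t. \<rho> *\<^sub>R vector [cos t, sin t] :: plane)"
  have c_dist: "dist (c s) (c t) \<le> \<rho> * dist s t" for s t
  proof -
    have "(norm (vector [cos s, sin s] - vector [cos t, sin t] :: plane))\<^sup>2
        = (cos s - cos t)\<^sup>2 + (sin s - sin t)\<^sup>2"
      by (simp only: power2_norm_eq_inner) (simp add: inner_vec_def sum_2 power2_eq_square)
    also have "\<dots> = 4 * (sin ((s - t) / 2))\<^sup>2"
    proof -
      have "cos (s - t) = 1 - 2 * (sin ((s - t) / 2))\<^sup>2"
      proof -
        have "cos (2 * h) = 1 - 2 * (sin h)\<^sup>2" for h :: real by (rule cos_double_sin)
        from this[of "(s - t) / 2"] show ?thesis by (simp only: nonzero_mult_div_cancel_left times_divide_eq_right)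
      qed
      moreover have "(cos s - cos t)\<^sup>2 + (sin s - sin t)\<^sup>2
          = ((sin s)\<^sup>2 + (cos s)\<^sup>2) + ((sin t)\<^sup>2 + (cos t)\<^sup>2) - 2 * cos (s - t)"
        unfolding cos_diff by (simp add: power2_eq_square algebra_simps)
      ultimately show ?thesis by simp
    qed
    also have "\<dots> \<le> \<bar>s - t\<bar>\<^sup>2"
    proof -
      have "(sin ((s - t) / 2))\<^sup>2 \<le> ((s - t) / 2)\<^sup>2"
        using abs_sin_x_le_abs_x abs_le_square_iff by blast
      then show ?thesis by (simp add: power_divide)
    qed
    finally have "norm (vector [cos s, sin s] - vector [cos t, sin t] :: plane) \<le> \<bar>s - t\<bar>"
      by (rule power2_le_imp_le) simp
    then show ?thesis using \<open>0 \<le> \<rho>\<close>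
      by (simp add: c_def dist_norm dist_real_def mult_left_mono flip: scaleR_diff_right)
  qed
  show ?thesis
  proof (cases "C = {}")
    case False
    have "(1 * \<rho>)-lipschitz_on {0..2*pi} (closest_point C \<circ> c)"
    proof (rule lipschitz_on_compose)
      show "\<rho>-lipschitz_on {0..2*pi} c" using c_dist \<open>0 \<le> \<rho>\<close> by (intro lipschitz_onI)
      show "1-lipschitz_on (c ` {0..2*pi}) (closest_point C)"
        using closest_point_lipschitz[OF C(2,1) False] by (intro lipschitz_onI) auto
    qed
    then have "hausdorff1_outer ((closest_point C \<circ> c) ` {0..2*pi}) \<le> ennreal (1 * \<rho> * (2 * pi - 0))"
      by (rule hausdorff1_outer_lipschitz_curve_le) simp
    moreover have "frontier C \<subseteq> (closest_point C \<circ> c) ` {0..2*pi}"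
    proof
      fix x assume x: "x \<in> frontier C"
      then have xC: "x \<in> C" using C(1) frontier_subset_closed by blast
      obtain a where a: "a \<noteq> 0" "\<And>y. y \<in> C \<Longrightarrow> a \<bullet> y \<le> a \<bullet> x"
      proof (cases "interior C = {}")
        case True
        \<comment> \<open>With empty interior, \<open>C\<close> lies in a line, and a normal of this
          line supports \<open>C\<close> at every point.\<close>
        then have "aff_dim C \<noteq> int DIM(plane)"
          using rel_interior_interior[of C] False C(2) rel_interior_eq_empty aff_dim_eq_full by metis
        then obtain a b where ab: "a \<noteq> 0" "C \<subseteq> {y. a \<bullet> y = b}"
          using aff_lowdim_subset_hyperplane[of C] aff_dim_le_DIM[of C] by (metis order_le_neq_trans)
        then have "a \<bullet> y = b" if "y \<in> C" for y using that by blast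
        then show ?thesis using xC by (intro that[OF ab(1)]) simp
      next
        case ne: False
        have "x \<notin> rel_interior C" using x rel_interior_nonempty_interior[OF ne] by (simp add: frontier_def)
        moreover have "x \<in> closure C" using x by (simp add: frontier_def)
        ultimately obtain a where "a \<noteq> 0" "\<And>y. y \<in> closure C \<Longrightarrow> a \<bullet> x \<le> a \<bullet> y"
          using supporting_hyperplane_relative_frontier[OF C(2)] by metis
        then show ?thesis using that[of "- a"] closure_subset by auto
      qed
      have "\<exists>t\<ge>0. norm (x + t *\<^sub>R a) = \<rho>"
      proof -
        \<comment> \<open>So far out that the triangle inequality forces a norm of at least \<rho>;
          at parameter 0 the norm is at most \<rho>.\<close>
        define T where "T = (\<rho> + norm x) / norm a"
        have T: "0 \<le> T" using \<open>0 \<le> \<rho>\<close> by (simp add: T_def)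
        have "norm (x + 0 *\<^sub>R a) \<le> \<rho>" using xC sub by auto
        moreover have "\<rho> \<le> norm (x + T *\<^sub>R a)"
        proof -
          have "norm (T *\<^sub>R a) = \<rho> + norm x" using a(1) \<open>0 \<le> \<rho>\<close> by (simp add: T_def)
          then show ?thesis using norm_triangle_ineq4[of "x + T *\<^sub>R a" x] by simp
        qed
        moreover have "continuous_on {0..T} (\<lambda>t. norm (x + t *\<^sub>R a))" by (intro continuous_intros)
        ultimately show ?thesis using IVT'[of "\<lambda>t. norm (x + t *\<^sub>R a)" 0 \<rho> T] T by auto
      qed
      then obtain t where t: "0 \<le> t" "norm (x + t *\<^sub>R a) = \<rho>" by blast
      define y where "y = x + t *\<^sub>R a"
      have "dist y x \<le> dist y z" if "z \<in> C" for z
      proof -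
        have "0 \<le> a \<bullet> (x - z)" using a(2)[OF that] by (simp add: inner_diff_right)
        then have le: "0 \<le> 2 * t * (a \<bullet> (x - z)) + (x - z) \<bullet> (x - z)"
          using t(1) by (intro add_nonneg_nonneg mult_nonneg_nonneg) auto
        have yz: "y - z = (x - z) + t *\<^sub>R a" and yx: "y - x = t *\<^sub>R a"
          by (simp_all add: y_def)
        have "(norm (y - x))\<^sup>2 \<le> (norm (y - z))\<^sup>2"
          unfolding yz yx power2_norm_eq_inner inner_add_left inner_add_right
            inner_scaleR_left inner_scaleR_right inner_commute[of "x - z" a] distrib_left
          using le by linarith
        then show ?thesis unfolding dist_norm by (rule power2_le_imp_le) simp
      qed
      then have yx: "closest_point C y = x"
        using closest_point_unique[OF C(2,1) xC, of y] by simp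
      obtain s where s: "0 \<le> s" "s \<le> 2 * pi" "y = c s"
      proof (cases "\<rho> = 0")
        case True
        then have "y = c 0" using t(2) by (simp add: y_def c_def)
        then show ?thesis using that[of 0] by simp
      next
        case False
        have "(y $ 1)\<^sup>2 + (y $ 2)\<^sup>2 = \<rho>\<^sup>2"
          using t(2) by (simp add: y_def[symmetric] norm_vec_def L2_set_def sum_2)
            (metis real_sqrt_unique abs_ge_zero real_sqrt_pow2 sum_power2_ge_zero)
        then have "(y $ 1 / \<rho>)\<^sup>2 + (y $ 2 / \<rho>)\<^sup>2 = 1"
          using False by (simp add: power_divide flip: add_divide_distrib)
        then obtain s where "0 \<le> s" "s < 2 * pi" "y $ 1 / \<rho> = cos s" "y $ 2 / \<rho> = sin s"
          using sincos_total_2pi by metis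
        then show ?thesis using that[of s] False
          by (simp add: c_def vec_eq_iff forall_2 divide_eq_eq mult.commute)
      qed
      then have "x = (closest_point C \<circ> c) s" using yx by simp
      then show "x \<in> (closest_point C \<circ> c) ` {0..2*pi}" using s by auto
    qed
    ultimately have "hausdorff1_outer (frontier C) \<le> ennreal (1 * \<rho> * (2 * pi - 0))"
      using hausdorff1_outer_mono[of "frontier C"] order_trans by blast
    then show ?thesis by (simp add: mult.commute)
  qed simp
qed


subsection \<open>The competitor\<close>

lemma convex_on_max:
  fixes f g :: "'a::real_vector \<Rightarrow> real"
  assumes f: "convex_on S f" and g: "convex_on S g"
  shows "convex_on S (\<lambda>x. max (f x) (g x))"
proof (rule convex_onI)
  show "convex S" using f by (rule convex_on_imp_convex)
  fix t :: real and x y assume t: "0 < t" "t < 1" and xy: "x \<in> S" "y \<in> S"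
  have "h ((1 - t) *\<^sub>R x + t *\<^sub>R y) \<le> (1 - t) * max (f x) (g x) + t * max (f y) (g y)"
    if h: "convex_on S h" and le: "\<And>z. h z \<le> max (f z) (g z)" for h
  proof -
    have "h ((1 - t) *\<^sub>R x + t *\<^sub>R y) \<le> (1 - t) * h x + t * h y"
      using convex_onD[OF h] t xy by simp
    also have "\<dots> \<le> (1 - t) * max (f x) (g x) + t * max (f y) (g y)"
      using t by (intro add_mono mult_left_mono le) auto
    finally show ?thesis .
  qed
  from this[OF f] this[OF g]
  show "max (f ((1 - t) *\<^sub>R x + t *\<^sub>R y)) (g ((1 - t) *\<^sub>R x + t *\<^sub>R y))
      \<le> (1 - t) * max (f x) (g x) + t * max (f y) (g y)" by simp
qed

lemma lipschitz_on_max: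
  fixes f g :: "'a::metric_space \<Rightarrow> real"
  assumes "L-lipschitz_on S f" "L-lipschitz_on S g"
  shows "L-lipschitz_on S (\<lambda>x. max (f x) (g x))"
proof (rule lipschitz_onI)
  fix x y assume "x \<in> S" "y \<in> S"
  then have "\<bar>f x - f y\<bar> \<le> L * dist x y" "\<bar>g x - g y\<bar> \<le> L * dist x y"
    using assms by (auto simp: lipschitz_on_def dist_real_def)
  then show "dist (max (f x) (g x)) (max (f y) (g y)) \<le> L * dist x y"
    unfolding dist_real_def by linarith
qed (rule lipschitz_on_nonneg[OF assms(1)])

lemma convex_on_norm_UNIV: "convex_on UNIV (\<lambda>x. norm x)"
  using convex_on_dist[of UNIV 0] by (simp add: dist_norm)

lemma lipschitz_on_norm: "1-lipschitz_on S (\<lambda>x. norm x)"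
  by (rule lipschitz_onI) (auto simp: dist_real_def dist_norm norm_triangle_ineq3)

text \<open>By first-order expansion \<open>\<Phi>\<close> exceeds \<open>\<Phi> x\<close> on each
  sector around its gradient, close to \<open>x\<close>, and there \<open>u\<close> is the
  continuous field \<open>v\<close>. So a crease along a level set has the two adjacent fields as
  its sector limits.\<close>

lemma sector_limit_GDERIV:
  assumes \<Phi>: "GDERIV \<Phi> x :> k *\<^sub>R w" and k: "0 < k"
    and ev: "\<forall>\<^sub>F y in nhds x. \<Phi> x < \<Phi> y \<longrightarrow> u y = v y" and v: "isCont v x"
  shows "sector_limit u x w (v x)"
  unfolding sector_limit_def
proof (intro allI impI)
  fix c e :: real assume c: "0 < c" and e: "0 < e"
  have "(\<Phi> has_derivative (\<lambda>h. h \<bullet> (k *\<^sub>R w))) (at x)" using \<Phi> by (simp add: gderiv_def)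
  moreover have "0 < k * c" using k c by simp
  ultimately obtain \<delta>1 where \<delta>1: "0 < \<delta>1"
    "\<And>y. norm (y - x) < \<delta>1 \<Longrightarrow> norm (\<Phi> y - \<Phi> x - (y - x) \<bullet> (k *\<^sub>R w)) \<le> k * c * norm (y - x)"
    unfolding has_derivative_at_alt by blast
  obtain \<delta>2 where \<delta>2: "0 < \<delta>2" "\<And>y. norm (y - x) < \<delta>2 \<Longrightarrow> \<Phi> x < \<Phi> y \<Longrightarrow> u y = v y"
    using ev unfolding eventually_nhds_metric by (auto simp: dist_norm)
  obtain \<delta>3 where \<delta>3: "0 < \<delta>3" "\<And>y. norm (y - x) < \<delta>3 \<Longrightarrow> norm (v y - v x) < e"
    using v e unfolding continuous_at_eps_delta by (metis dist_norm)
  show "\<exists>\<delta>>0. \<forall>y. norm (y - x) < \<delta> \<longrightarrow> c * norm (y - x) < (y - x) \<bullet> w \<longrightarrow> norm (u y - v x) < e"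
  proof (intro exI[of _ "min \<delta>1 (min \<delta>2 \<delta>3)"] conjI allI impI)
    fix y assume y: "norm (y - x) < min \<delta>1 (min \<delta>2 \<delta>3)" "c * norm (y - x) < (y - x) \<bullet> w"
    have "k * (c * norm (y - x)) < k * ((y - x) \<bullet> w)" using y(2) k by simp
    moreover have "norm (\<Phi> y - \<Phi> x - (y - x) \<bullet> (k *\<^sub>R w)) \<le> k * c * norm (y - x)"
      using \<delta>1(2)[of y] y(1) by simp
    ultimately have "\<Phi> x < \<Phi> y" by (simp add: abs_le_iff mult.assoc)
    then show "norm (u y - v x) < e" using \<delta>2(2)[of y] \<delta>3(2)[of y] y(1) by simp
  qed (use \<delta>1 \<delta>2 \<delta>3 in simp)
qed

text \<open>The competitor \<open>\<psi>\<close> replaces the boundary distance by the cone \<open>norm x - R\<close> inside the convex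
  curve \<open>frontier C\<close>. This curve surrounds \<open>P\<close>, so \<open>\<psi>\<close> sees the boundary distance only where the
  latter is smooth.\<close>

locale inscribed_body =
  fixes P :: "plane set" and R :: real
  assumes closed_P: "closed P" and convex_P: "convex P"
    and ball_P: "cball 0 1 \<subseteq> P" and P_ball: "P \<subseteq> cball 0 R" and R_le: "R \<le> 3 / 2"
begin

definition d :: "plane \<Rightarrow> real" where "d x = infdist x P"
definition normal :: "plane \<Rightarrow> plane" where "normal x = sgn (x - closest_point P x)"
definition \<Omega> :: "plane set" where "\<Omega> = {x. d x < 1 / 2}"
text \<open>The two branches of \<open>\<psi>\<close> agree exactly where
  \<open>\<Phi> x = R + 1 / 2\<close>; the crease is thus a level set of a convex function.\<close>

definition \<Phi> :: "plane \<Rightarrow> real" where "\<Phi> x = d x + norm x"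
definition \<psi> :: "plane \<Rightarrow> real" where "\<psi> x = min (1 / 2 - d x) (norm x - R)"
definition C :: "plane set" where "C = {x. \<Phi> x \<le> R + 1 / 2}"

lemma zero_in_P: "0 \<in> P" by (rule subsetD[OF ball_P]) simp

lemma P_nonempty: "P \<noteq> {}" using zero_in_P by blast

lemmas P_facts = closed_P convex_P P_nonempty

lemma R_ge: "1 \<le> R"
proof -
  have "axis 1 1 \<in> cball (0::plane) 1" by simp
  then show ?thesis using ball_P P_ball by fastforce
qed

lemma d_nonneg: "0 \<le> d x" by (simp add: d_def infdist_nonneg)
lemma d_zero: "x \<in> P \<Longrightarrow> d x = 0" by (simp add: d_def)
lemma convex_on_d: "convex_on UNIV d"
  using convex_on_infdist[OF P_facts] by (simp add: d_def[abs_def])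
lemma lipschitz_on_d: "1-lipschitz_on S d"
  using lipschitz_on_infdist[of S P] by (simp add: d_def[abs_def])
lemma d_triangle: "d x \<le> d y + dist x y" by (simp add: d_def infdist_triangle)
lemma continuous_on_d: "continuous_on S d"
  using lipschitz_on_d by (rule lipschitz_on_continuous_on)
lemma GDERIV_d: "x \<notin> P \<Longrightarrow> GDERIV d x :> normal x"
  using GDERIV_infdist[OF P_facts] by (simp add: d_def[abs_def] normal_def)
lemma isCont_normal: "x \<notin> P \<Longrightarrow> isCont normal x"
  using isCont_infdist_normal[OF P_facts] by (simp add: normal_def[abs_def])
lemma norm_normal: "x \<notin> P \<Longrightarrow> norm (normal x) = 1"
  using closest_point_in_set[OF closed_P P_nonempty, of x] by (auto simp: normal_def norm_sgn)
lemma d_eq: "d x = norm (x - closest_point P x)"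
  unfolding d_def by (rule infdist_closest_point[OF closed_P P_nonempty])
lemma normal_d: "d x *\<^sub>R normal x = x - closest_point P x"
  by (cases "x - closest_point P x = 0") (simp_all add: d_eq normal_def sgn_div_norm)

lemma norm_le_d: "norm x \<le> R + d x"
proof -
  have "norm (closest_point P x) \<le> R"
    using closest_point_in_set[OF closed_P P_nonempty, of x] P_ball by auto
  then show ?thesis using norm_triangle_ineq[of "closest_point P x" "x - closest_point P x"] by (simp add: d_eq)
qed

text \<open>The radial projection \<open>sgn x\<close> belongs to the unit disc, hence to
  \<open>P\<close>, and its distance from \<open>x\<close> is \<open>norm x - 1\<close>.\<close>

lemma d_le_norm: "x \<notin> P \<Longrightarrow> d x \<le> norm x - 1"
proof -
  assume x: "x \<notin> P"
  then have n: "1 < norm x" using ball_P by force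
  have "sgn x \<in> P" using ball_P by (auto simp: norm_sgn)
  then have "d x \<le> norm (x - sgn x)" unfolding d_def by (metis infdist_le dist_norm)
  also have "x - sgn x = (1 - 1 / norm x) *\<^sub>R x" by (simp add: sgn_div_norm algebra_simps divide_inverse)
  also have "norm \<dots> = \<bar>1 - 1 / norm x\<bar> * norm x" by (rule norm_scaleR)
  also have "\<bar>1 - 1 / norm x\<bar> = 1 - 1 / norm x" using n by (intro abs_of_nonneg) (simp add: divide_le_eq)
  also have "(1 - 1 / norm x) * norm x = norm x - 1" using n by (auto simp: left_diff_distrib)
  finally show ?thesis .
qed

lemma open_\<Omega>: "open \<Omega>"
  unfolding \<Omega>_def by (intro open_Collect_less continuous_on_d continuous_on_const)

lemma convex_\<Omega>: "convex \<Omega>"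
proof (rule convexI)
  fix x y and u v :: real assume "x \<in> \<Omega>" "y \<in> \<Omega>" "0 \<le> u" "0 \<le> v" "u + v = 1"
  then show "u *\<^sub>R x + v *\<^sub>R y \<in> \<Omega>"
    using convex_lower[OF convex_on_d, of x y u v] by (simp add: \<Omega>_def)
qed

lemma P_sub_\<Omega>: "P \<subseteq> \<Omega>" by (auto simp: \<Omega>_def d_zero)

lemma \<Omega>_sub: "\<Omega> \<subseteq> cball 0 2"
proof
  fix x assume "x \<in> \<Omega>"
  then show "x \<in> cball 0 2" using norm_le_d[of x] R_le by (simp add: \<Omega>_def)
qed

lemma lipschitz_domain_\<Omega>: "lipschitz_domain \<Omega>"
  by (intro lipschitz_domain_convex open_\<Omega> convex_\<Omega>)
    (rule order_trans[OF ball_subset_cball order_trans[OF ball_P P_sub_\<Omega>]])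

lemma frontier_\<Omega>_nonempty: "frontier \<Omega> \<noteq> {}"
proof (rule frontier_not_empty)
  show "\<Omega> \<noteq> {}" using P_nonempty P_sub_\<Omega> by auto
  show "\<Omega> \<noteq> UNIV" using \<Omega>_sub not_bounded_UNIV bounded_cball bounded_subset by metis
qed

lemma d_frontier: "p \<in> frontier \<Omega> \<Longrightarrow> d p = 1 / 2"
proof -
  assume p: "p \<in> frontier \<Omega>"
  have "closed {x. d x \<le> 1/2}" by (intro closed_Collect_le continuous_on_d continuous_on_const)
  then have "closure \<Omega> \<subseteq> {x. d x \<le> 1/2}" by (rule closure_minimal[rotated]) (auto simp: \<Omega>_def)
  moreover have "p \<notin> \<Omega>" using p open_\<Omega> by (simp add: frontier_def interior_open)
  ultimately show ?thesis using p by (force simp: \<Omega>_def frontier_def)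
qed

text \<open>Following the outer normal for the length \<open>1 / 2 - d x\<close> leads to a point at
  distance at least \<open>1 / 2\<close> from \<open>P\<close>; no shorter way out exists, because
  \<open>d\<close> is 1-Lipschitz.\<close>

lemma boundary_distance_outside:
  assumes "x \<in> \<Omega>" "x \<notin> P" shows "boundary_distance \<Omega> x = 1 / 2 - d x"
proof (rule antisym)
  define p where "p = closest_point P x"
  have d: "d x < 1 / 2" using assms by (simp add: \<Omega>_def)
  define z where "z = x + (1 / 2 - d x) *\<^sub>R normal x"
  have "z = p + (1 / 2) *\<^sub>R normal x"
    using normal_d[of x] by (simp add: z_def p_def algebra_simps)
  then have "normal x \<bullet> (z - p) = 1 / 2" using norm_normal[OF assms(2)] by (simp add: norm_eq_1)
  then have "1 / 2 \<le> d z" using infdist_ge_normal[OF P_facts, of x z] by (simp add: normal_def p_def d_def)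
  then have "z \<notin> \<Omega>" by (simp add: \<Omega>_def)
  then have "boundary_distance \<Omega> x \<le> dist x z"
    unfolding boundary_distance_def by (rule infdist_frontier_le[OF assms(1)])
  also have "\<dots> = 1 / 2 - d x" using norm_normal[OF assms(2)] d by (simp add: z_def dist_norm)
  finally show "boundary_distance \<Omega> x \<le> 1 / 2 - d x" .
  have "ball x (1 / 2 - d x) \<subseteq> \<Omega>"
  proof
    fix y assume "y \<in> ball x (1 / 2 - d x)"
    then show "y \<in> \<Omega>" using d_triangle[of y x] by (simp add: \<Omega>_def dist_commute)
  qed
  then show "1 / 2 - d x \<le> boundary_distance \<Omega> x"
    unfolding boundary_distance_def by (rule infdist_frontier_ge[OF open_\<Omega> frontier_\<Omega>_nonempty])
qed

lemma convex_on_\<Phi>: "convex_on UNIV \<Phi>"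
  unfolding \<Phi>_def by (intro convex_on_add convex_on_d convex_on_norm_UNIV)

lemma lipschitz_on_\<Phi>: "(1 + 1)-lipschitz_on S \<Phi>"
  unfolding \<Phi>_def by (intro lipschitz_on_add lipschitz_on_d lipschitz_on_norm)

lemma continuous_on_\<Phi>: "continuous_on S \<Phi>"
  using lipschitz_on_\<Phi> by (rule lipschitz_on_continuous_on)

text \<open>Turns a minimum into a difference of convex functions, the form required for the
  \<open>BV\<close> bound.\<close>

lemma \<psi>_eq: "\<psi> x = norm x - (R + max (\<Phi> x - (R + 1 / 2)) 0)"
  by (simp add: \<psi>_def \<Phi>_def min_def max_def)

text \<open>On \<open>P\<close> one has \<open>\<Phi> x = norm x \<le> R\<close>. So the region
  where \<open>\<psi>\<close> follows the boundary distance avoids the ridges, and the crease avoids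
  the vertex of the cone.\<close>

lemma not_P_if_\<Phi>_ge: "R + 1 / 2 \<le> \<Phi> x \<Longrightarrow> x \<notin> P \<and> x \<noteq> 0"
  using d_zero[of x] P_ball ball_P R_ge by (force simp: \<Phi>_def)

lemma GDERIV_\<psi>_inner:
  assumes "\<Phi> x < R + 1 / 2" "x \<noteq> 0" shows "GDERIV \<psi> x :> sgn x"
proof (rule GDERIV_transform_open)
  show "open ({x. \<Phi> x < R + 1 / 2} \<inter> - {0})"
    by (intro open_Int open_Collect_less continuous_on_\<Phi> continuous_on_const) auto
  show "GDERIV (\<lambda>y. norm y - R) x :> sgn x"
    using GDERIV_diff[OF GDERIV_norm[OF assms(2)] GDERIV_const] by simp
qed (use assms in \<open>auto simp: \<psi>_eq\<close>)

lemma GDERIV_\<psi>_outer: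
  assumes "R + 1 / 2 < \<Phi> x" shows "GDERIV \<psi> x :> - normal x"
proof (rule GDERIV_transform_open)
  show "open {x. R + 1 / 2 < \<Phi> x}"
    by (intro open_Collect_less continuous_on_\<Phi> continuous_on_const)
  show "GDERIV (\<lambda>y. 1 / 2 - d y) x :> - normal x"
    using GDERIV_diff[OF GDERIV_const GDERIV_d] not_P_if_\<Phi>_ge[of x] assms by simp
qed (use assms in \<open>auto simp: \<psi>_def \<Phi>_def\<close>)

text \<open>Convexity and \<open>\<Phi> 0 = 0\<close> make \<open>\<Phi>\<close> increase strictly
  along the ray from the origin beyond \<open>x\<close>, so points just past \<open>x\<close> are
  outside \<open>C\<close>.\<close>

lemma frontier_C: "\<Phi> x = R + 1 / 2 \<Longrightarrow> x \<in> frontier C"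
proof -
  assume x: "\<Phi> x = R + 1 / 2"
  then have xC: "x \<in> C" by (simp add: C_def)
  have "x \<notin> interior C"
  proof
    assume "x \<in> interior C"
    then obtain e where e: "0 < e" "cball x e \<subseteq> C" by (auto simp: mem_interior_cball)
    have x0: "x \<noteq> 0" using not_P_if_\<Phi>_ge x by simp
    define s where "s = e / norm x"
    have s: "0 < s" using e x0 by (simp add: s_def)
    define y where "y = (1 + s) *\<^sub>R x"
    have "y \<in> C"
    proof (rule subsetD[OF e(2)])
      have "x - y = - (s *\<^sub>R x)" by (simp add: y_def algebra_simps)
      then show "y \<in> cball x e" using e x0 by (simp add: dist_norm s_def)
    qed
    then have "\<Phi> y \<le> \<Phi> x" using x by (simp add: C_def)
    moreover have "\<Phi> ((1 - 1 / (1 + s)) *\<^sub>R 0 + (1 / (1 + s)) *\<^sub>R y) \<le> (1 - 1 / (1 + s)) * \<Phi> 0 + (1 / (1 + s)) * \<Phi> y"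
      using s by (intro convex_onD[OF convex_on_\<Phi>]) auto
    moreover have "\<Phi> 0 = 0" using d_zero[OF zero_in_P] by (simp add: \<Phi>_def)
    moreover have "(1 / (1 + s)) *\<^sub>R y = x" using s by (simp add: y_def)
    ultimately have "\<Phi> x \<le> \<Phi> x / (1 + s)" using s by (simp add: divide_right_mono order_trans)
    moreover have "0 < s * \<Phi> x" using x R_ge s by simp
    ultimately show False using s by (simp add: field_simps)
  qed
  then show ?thesis using xC closure_subset by (auto simp: frontier_def)
qed

lemma closed_C: "closed C"
  unfolding C_def by (intro closed_Collect_le continuous_on_\<Phi> continuous_on_const)

lemma convex_C: "convex C"
proof (rule convexI)
  fix x y and u v :: real assume "x \<in> C" "y \<in> C" "0 \<le> u" "0 \<le> v" "u + v = 1"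
  then show "u *\<^sub>R x + v *\<^sub>R y \<in> C"
    using convex_lower[OF convex_on_\<Phi>, of x y u v] by (simp add: C_def)
qed

lemma C_sub: "C \<subseteq> cball 0 (R + 1 / 2)"
proof
  fix x assume "x \<in> C"
  then show "x \<in> cball 0 (R + 1 / 2)" using d_nonneg[of x] by (simp add: C_def \<Phi>_def)
qed

lemma \<psi>_in_S0: "\<psi> \<in> S0_class \<Omega>"
proof -
  have \<psi>_diff: "\<psi> = (\<lambda>x. norm x - (R + max (\<Phi> x - (R + 1 / 2)) 0))" by (rule ext) (rule \<psi>_eq)
  have lip: "(0 + (1 + 1 + 0))-lipschitz_on UNIV (\<lambda>x. R + max (\<Phi> x - (R + 1 / 2)) 0)"
    by (intro lipschitz_on_add lipschitz_on_constant lipschitz_on_max lipschitz_on_diff lipschitz_on_\<Phi>)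
      (rule lipschitz_on_mono[OF lipschitz_on_constant], auto)
  have \<psi>_lip: "(1 + (0 + (1 + 1 + 0)))-lipschitz_on S \<psi>" for S
    unfolding \<psi>_diff by (intro lipschitz_on_diff lipschitz_on_norm lipschitz_on_subset[OF lip]) auto
  have conv: "convex_on UNIV (\<lambda>x. R + max (\<Phi> x - (R + 1 / 2)) 0)"
  proof -
    have "convex_on UNIV (\<lambda>x. \<Phi> x + - (R + 1 / 2))"
      by (intro convex_on_add convex_on_\<Phi>) (simp add: convex_on_const)
    then have "convex_on UNIV (\<lambda>x. \<Phi> x - (R + 1 / 2))" by (simp only: add_uminus_conv_diff)
    then show ?thesis by (intro convex_on_add convex_on_max) (simp_all add: convex_on_const)
  qed
  have "negligible (frontier C \<union> {0})"
    using negligible_convex_frontier[OF convex_C] by (intro negligible_Un) auto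
  then have "AE x in lebesgue. x \<notin> frontier C \<union> {0}"
    unfolding negligible_iff_null_sets by (rule AE_not_in)
  then have "AE x in lebesgue. \<psi> differentiable (at x) \<and> norm (grad \<psi> x) = 1"
  proof eventually_elim
    case (elim x)
    then have "\<Phi> x \<noteq> R + 1 / 2" "x \<noteq> 0" using frontier_C by auto
    then consider "\<Phi> x < R + 1 / 2" "x \<noteq> 0" | "R + 1 / 2 < \<Phi> x" by linarith
    then show ?case
    proof cases
      case 1
      then show ?thesis using GDERIV_\<psi>_inner[OF 1]
        by (auto simp: grad_eq norm_sgn intro: GDERIV_imp_differentiable)
    next
      case 2
      then show ?thesis using GDERIV_\<psi>_outer[OF 2] not_P_if_\<Phi>_ge[of x]
        by (auto simp: grad_eq norm_normal intro: GDERIV_imp_differentiable)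
    qed
  qed
  then have AE: "AE x in lebesgue_on \<Omega>. \<psi> differentiable (at x) \<and> norm (grad \<psi> x) = 1"
    using open_\<Omega> by (subst AE_restrict_space_iff) auto
  have "grad \<psi> \<in> BV_field \<Omega>"
  proof (rule grad_in_BV_field[OF open_\<Omega> \<Omega>_sub convex_on_norm_UNIV conv lipschitz_on_norm lip])
    show "AE x in lebesgue_on \<Omega>. \<psi> differentiable (at x)" using AE by eventually_elim simp
  qed (rule \<psi>_eq)
  moreover have "(\<psi> \<longlongrightarrow> 0) (at p within \<Omega>)" if p: "p \<in> frontier \<Omega>" for p
  proof -
    have "continuous_on UNIV \<psi>" by (rule lipschitz_on_continuous_on[OF \<psi>_lip])
    then have "(\<psi> \<longlongrightarrow> \<psi> p) (at p within \<Omega>)"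
      by (meson UNIV_I continuous_on_def subset_UNIV tendsto_within_subset)
    \<comment> \<open>Since \<open>d p = 1 / 2\<close>, the first branch is 0 and the second is at
      least \<open>1 + 1 / 2 - R\<close>; here \<open>R \<le> 3 / 2\<close> enters.\<close>
    moreover have "\<psi> p = 0"
      using d_frontier[OF p] d_le_norm[of p] d_zero[of p] R_le by (force simp: \<psi>_def)
    ultimately show ?thesis by simp
  qed
  ultimately show ?thesis using AE \<psi>_lip by (auto simp: S0_class_def S_class_def)
qed

text \<open>The supporting line at the closest point has distance at least 1 from the origin, so
  \<open>normal x \<bullet> x \<ge> 1 + d x\<close>, while
  \<open>norm x \<le> R + d x \<le> R * (1 + d x)\<close>. For \<open>R\<close> close to 1 the
  normal is nearly radial.\<close>

lemma normal_inner_sgn_ge: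
  assumes "x \<notin> P" shows "1 / R \<le> normal x \<bullet> sgn x"
proof -
  have "x \<noteq> 0" using assms zero_in_P by auto
  have "normal x \<in> P" using ball_P norm_normal[OF assms] by auto
  then have "normal x \<bullet> (normal x - closest_point P x) \<le> 0"
    using infdist_ge_normal[OF P_facts, of x "normal x"] by (simp add: normal_def)
  then have "1 \<le> normal x \<bullet> closest_point P x"
    using norm_normal[OF assms] by (simp add: inner_diff_right norm_eq_1)
  moreover have "normal x \<bullet> (x - closest_point P x) = d x"
    unfolding normal_d[symmetric] using norm_normal[OF assms] by (simp add: norm_eq_1)
  ultimately have "1 + d x \<le> normal x \<bullet> x" by (simp add: inner_diff_right)
  moreover have "norm x \<le> R * (1 + d x)"
  proof -
    have "d x \<le> R * d x" using R_ge d_nonneg[of x] by (simp add: mult_le_cancel_right1)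
    then show ?thesis using norm_le_d[of x] by (simp add: algebra_simps)
  qed
  ultimately have "norm x \<le> R * (normal x \<bullet> x)"
    using R_ge mult_left_mono[of "1 + d x" "normal x \<bullet> x" R] by linarith
  then show ?thesis using \<open>x \<noteq> 0\<close> R_ge by (simp add: sgn_div_norm field_simps)
qed

text \<open>Across the crease the gradient changes from \<open>sgn x\<close> to
  \<open>- normal x\<close>, a jump of squared size
  \<open>2 + 2 * (normal x \<bullet> sgn x) \<ge> 2 + 2 / R\<close>. Off the crease and the origin
  the gradient is continuous.\<close>

lemma energy_\<psi>_le:
  assumes f: "\<And>t. 2 + 2 / R \<le> t\<^sup>2 \<Longrightarrow> 0 \<le> t \<Longrightarrow> t \<le> 2 \<Longrightarrow> f t \<le> M"
  shows "energy f \<Omega> \<psi> \<le> M * ennreal (2 * pi * (R + 1 / 2))"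
proof -
  define u where "u = grad \<psi>"
  have u: "u \<in> BV_field \<Omega>" using \<psi>_in_S0 by (simp add: S0_class_def S_class_def u_def)
  have u_inner: "u x = sgn x" if "\<Phi> x < R + 1 / 2" "x \<noteq> 0" for x
    using grad_eq[OF GDERIV_\<psi>_inner[OF that]] by (simp add: u_def)
  have u_outer: "u x = - normal x" if "R + 1 / 2 < \<Phi> x" for x
    using grad_eq[OF GDERIV_\<psi>_outer[OF that]] by (simp add: u_def)
  have ne0: "\<forall>\<^sub>F y in nhds x. y \<noteq> 0" if "x \<noteq> 0" for x :: plane
    using that by (intro t1_space_nhds)
  have sgn_cont: "isCont (sgn :: plane \<Rightarrow> plane) x" if "x \<noteq> 0" for x
    using that by (intro isCont_sgn) auto
  have on_\<Gamma>: "\<Phi> x = R + 1 / 2" if x: "x \<in> jump_set \<Omega> u" "x \<noteq> 0" for x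
  proof (rule ccontr)
    assume "\<Phi> x \<noteq> R + 1 / 2"
    then consider "\<Phi> x < R + 1 / 2" | "R + 1 / 2 < \<Phi> x" by linarith
    then have "isCont u x"
    proof cases
      case 1
      have "open {x. \<Phi> x < R + 1 / 2}"
        by (intro open_Collect_less continuous_on_\<Phi> continuous_on_const)
      then have "\<forall>\<^sub>F y in nhds x. \<Phi> y < R + 1 / 2" using 1 by (simp add: eventually_nhds) blast
      then have "\<forall>\<^sub>F y in nhds x. u y = sgn y" using ne0[OF x(2)]
        by eventually_elim (simp add: u_inner)
      then show ?thesis using sgn_cont[OF x(2)] by (simp add: isCont_cong)
    next
      case 2
      have "open {x. R + 1 / 2 < \<Phi> x}"
        by (intro open_Collect_less continuous_on_\<Phi> continuous_on_const)
      then have "\<forall>\<^sub>F y in nhds x. R + 1 / 2 < \<Phi> y" using 2 by (simp add: eventually_nhds) blast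
      then have "\<forall>\<^sub>F y in nhds x. u y = - normal y" by eventually_elim (simp add: u_outer)
      moreover have "isCont (\<lambda>y. - normal y) x"
        using 2 not_P_if_\<Phi>_ge[of x] by (intro continuous_minus isCont_normal) auto
      ultimately show ?thesis by (simp add: isCont_cong)
    qed
    then show False using isCont_not_in_jump_set[OF open_\<Omega> u] x by blast
  qed
  have amplitude: "f (norm (trace_plus u x - trace_minus u x)) \<le> M"
    if x: "x \<in> jump_set \<Omega> u" "x \<noteq> 0" for x
  proof -
    have \<Phi>x: "\<Phi> x = R + 1 / 2" by (rule on_\<Gamma>[OF x])
    then have xP: "x \<notin> P" using not_P_if_\<Phi>_ge by simp
    \<comment> \<open>At once the gradient of \<open>\<Phi>\<close>, hence normal to the crease, and
      up to sign the jump of \<open>grad \<psi>\<close>.\<close>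
    define W where "W = normal x + sgn x"
    have nn: "norm (normal x) = 1" "norm (sgn x) = 1" using norm_normal[OF xP] x(2) by (auto simp: norm_sgn)
    have "(norm W)\<^sup>2 = 2 + 2 * (normal x \<bullet> sgn x)"
      using nn by (simp add: W_def power2_norm_eq_inner inner_simps inner_commute norm_eq_1)
    then have W: "2 + 2 / R \<le> (norm W)\<^sup>2" using normal_inner_sgn_ge[OF xP] by simp
    moreover have "0 < 2 + 2 / R" using R_ge by (simp add: add_pos_pos)
    ultimately have W0: "0 < norm W" by (cases "W = 0") auto
    define w where "w = sgn W"
    have w: "norm w = 1" "W = norm W *\<^sub>R w" using W0 by (auto simp: w_def norm_sgn sgn_div_norm)
    have D: "GDERIV \<Phi> x :> norm W *\<^sub>R w"
      using GDERIV_add[OF GDERIV_d[OF xP] GDERIV_norm[OF x(2)]] w(2)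
      by (simp add: W_def \<Phi>_def[abs_def])
    have D': "GDERIV (\<lambda>y. - \<Phi> y) x :> norm W *\<^sub>R (- w)" using GDERIV_minus[OF D] by simp
    have "sector_limit u x w (- normal x)"
      by (rule sector_limit_GDERIV[OF D W0]) (use \<Phi>x u_outer isCont_normal[OF xP] in \<open>auto intro!: always_eventually continuous_minus\<close>)
    moreover have "sector_limit u x (- w) (sgn x)"
    proof (rule sector_limit_GDERIV[OF D' W0 _ sgn_cont[OF x(2)]])
      show "\<forall>\<^sub>F y in nhds x. - \<Phi> x < - \<Phi> y \<longrightarrow> u y = sgn y"
        using ne0[OF x(2)] by eventually_elim (use \<Phi>x u_inner in auto)
    qed
    ultimately have "norm (trace_plus u x - trace_minus u x) = norm (- normal x - sgn x)"
      by (rule norm_traces_diff[OF open_\<Omega> x(1) u w(1)])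
    also have "- normal x - sgn x = - W" by (simp add: W_def)
    also have "norm (- W) = norm W" by (rule norm_minus_cancel)
    finally have eq: "norm (trace_plus u x - trace_minus u x) = norm W" .
    have "norm W \<le> 2" using norm_triangle_ineq[of "normal x" "sgn x"] nn by (simp add: W_def)
    then show ?thesis unfolding eq using W by (intro f) auto
  qed
  have "frontier C \<in> sets hausdorff1" by (intro closed_in_sets_hausdorff1) simp
  note [measurable] = this
  have "{0} \<in> null_sets (hausdorff1 :: plane measure)"
    by (simp add: null_sets_def closed_in_sets_hausdorff1 emeasure_hausdorff1 hausdorff1_outer_singleton)
  then have "AE x in hausdorff1. x \<notin> {0::plane}" by (rule AE_not_in)
  then have "energy f \<Omega> \<psi> \<le> (\<integral>\<^sup>+x. M * indicator (frontier C) x \<partial>hausdorff1)"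
    unfolding energy_def u_def[symmetric]
  proof (intro nn_integral_mono_AE, eventually_elim)
    case (elim x)
    then show ?case using amplitude[of x] on_\<Gamma>[of x] frontier_C[of x]
      by (cases "x \<in> jump_set \<Omega> u") auto
  qed
  also have "\<dots> = M * emeasure hausdorff1 (frontier C)"
    by (rule nn_integral_cmult_indicator) measurable
  also have "\<dots> \<le> M * ennreal (2 * pi * (R + 1 / 2))"
    using hausdorff1_outer_frontier_convex_le[OF closed_C convex_C C_sub] R_ge
    by (intro mult_left_mono) (simp_all add: emeasure_hausdorff1 closed_in_sets_hausdorff1)
  finally show ?thesis .
qed

end


subsection \<open>Polygons circumscribed about the unit circle\<close>

definition dir :: "real \<Rightarrow> plane" where "dir a = vector [cos a, sin a]"

lemma inner_dir: "dir a \<bullet> dir b = cos (a - b)"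
  by (simp add: dir_def inner_vec_def sum_2 cos_diff)

lemma norm_dir [simp]: "norm (dir a) = 1"
  by (simp add: norm_eq_1 inner_dir)

lemma dir_polar: obtains a where "0 \<le> a" "a < 2 * pi" "x = norm x *\<^sub>R dir a"
proof (cases "x = 0")
  case True
  then show ?thesis using that[of 0] by simp
next
  case False
  have "norm (sgn x) = 1" using False by (simp add: norm_sgn)
  then have "(sgn x $ 1)\<^sup>2 + (sgn x $ 2)\<^sup>2 = 1"
    by (simp add: norm_eq_1 inner_vec_def sum_2 power2_eq_square)
  then obtain a where a: "0 \<le> a" "a < 2 * pi" "sgn x $ 1 = cos a" "sgn x $ 2 = sin a"
    using sincos_total_2pi by metis
  then have "sgn x = dir a" by (simp add: dir_def vec_eq_iff forall_2)
  moreover have "x = norm x *\<^sub>R sgn x" using False by (simp add: sgn_div_norm)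
  ultimately show ?thesis using a that by metis
qed

lemma cos_less_cos:
  assumes "0 \<le> a" "a < x" "x < 2 * pi - a" shows "cos x < cos a"
proof -
  have "cos a - cos x = 2 * sin ((a + x) / 2) * sin ((x - a) / 2)" by (rule cos_diff_cos)
  moreover have "0 < sin ((a + x) / 2)" "0 < sin ((x - a) / 2)"
    using assms by (auto intro!: sin_gt_zero)
  ultimately have "0 < cos a - cos x" by (metis mult_pos_pos zero_less_numeral)
  then show ?thesis by simp
qed

lemma cos_le_cos_abs: "\<bar>x\<bar> \<le> a \<Longrightarrow> a \<le> pi \<Longrightarrow> cos a \<le> cos x"
  using cos_monotone_0_pi_le[of "\<bar>x\<bar>" a] by simp

lemma sin_ge_mult_cos:
  assumes "0 < x" "x \<le> pi" shows "x * cos x \<le> sin x"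
proof -
  obtain z where z: "0 < z" "z < x" "sin x - sin 0 = (x - 0) * cos z"
    using MVT2[OF assms(1), of sin cos] by auto
  have "cos x \<le> cos z" using z assms by (intro cos_le_cos_abs) auto
  then show ?thesis using z(3) assms by simp
qed

text \<open>The side normals have the angles \<open>0\<close>, \<open>2 * \<theta>\<close>, ...,
  \<open>2 * N * \<theta>\<close>; the last two assumptions say that the remaining gap to a full
  turn is positive and at most \<open>2 * \<theta>\<close>. The bound on the cosine is
  \<open>R \<le> 3 / 2\<close> for \<open>R = 1 / cos \<theta>\<close>.\<close>

locale circumscribed_polygon =
  fixes \<theta> :: real and N :: nat
  assumes \<theta>_pos: "0 < \<theta>" and \<theta>_less: "\<theta> < pi / 2" and cos_\<theta>: "2 / 3 \<le> cos \<theta>"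
    and N_less: "real N * \<theta> < pi" and N_ge: "pi \<le> (real N + 1) * \<theta>"
begin

definition n :: "nat \<Rightarrow> plane" where "n k = dir (2 * real k * \<theta>)"
text \<open>Bisects \<open>n k\<close> and \<open>n (Suc k)\<close>, hence points to the vertex
  between these two sides.\<close>

definition e :: "nat \<Rightarrow> plane" where "e k = dir ((2 * real k + 1) * \<theta>)"
definition P :: "plane set" where "P = {x. \<forall>k\<le>N. n k \<bullet> x \<le> 1}"

lemma norm_n [simp]: "norm (n k) = 1" by (simp add: n_def)
lemma n_inner_self [simp]: "n k \<bullet> n k = 1" by (simp add: n_def inner_dir)
lemma e_inner_self [simp]: "e k \<bullet> e k = 1" by (simp add: e_def inner_dir)
lemma norm_e [simp]: "norm (e k) = 1" by (simp add: e_def)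

lemma n_inner_less: "k \<le> N \<Longrightarrow> l \<le> N \<Longrightarrow> k \<noteq> l \<Longrightarrow> n k \<bullet> n l < 1"
proof (induction k l rule: linorder_wlog)
  case (le k l)
  have "(real l - real k) * \<theta> \<le> real N * \<theta>" using le \<theta>_pos by (intro mult_right_mono) auto
  then have "cos (2 * real l * \<theta> - 2 * real k * \<theta>) < cos 0"
    using le \<theta>_pos N_less by (intro cos_less_cos) (auto simp: algebra_simps)
  then have "n l \<bullet> n k < 1" by (simp add: n_def inner_dir)
  then show ?case by (simp add: inner_commute)
qed (simp add: inner_commute)

lemma e_inner_less: "k < N \<Longrightarrow> l < N \<Longrightarrow> k \<noteq> l \<Longrightarrow> e k \<bullet> e l < 1"
proof -
  assume kl: "k < N" "l < N" "k \<noteq> l"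
  have "e k \<bullet> e l = n k \<bullet> n l" by (simp add: e_def n_def inner_dir algebra_simps)
  then show ?thesis using n_inner_less[of k l] kl by simp
qed

lemma n_inner_e: "n k \<bullet> e k = cos \<theta>" "n (Suc k) \<bullet> e k = cos \<theta>"
  using cos_minus[of \<theta>] by (simp_all add: n_def e_def inner_dir algebra_simps)

text \<open>On the ray spanned by \<open>e k\<close> only the sides \<open>k\<close> and
  \<open>Suc k\<close> compete: the angle to any other normal is at least
  \<open>3 * \<theta>\<close> one way round and, since \<open>N * \<theta> < pi\<close>, more than
  \<theta> the other way.\<close>

lemma n_inner_e_less:
  assumes "k < N" "j \<le> N" "j \<noteq> k" "j \<noteq> Suc k" shows "n j \<bullet> e k < cos \<theta>"
proof -
  define t where "t = \<bar>2 * real j - (2 * real k + 1)\<bar>"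
  have "j + 1 \<le> k \<or> k + 2 \<le> j" using assms by linarith
  then have "real j + 1 \<le> real k \<or> real k + 2 \<le> real j" by linarith
  moreover have "real k + 1 \<le> real N" "real j \<le> real N" using assms by linarith+
  ultimately have t: "3 \<le> t" "t \<le> 2 * real N - 1" unfolding t_def by linarith+
  have "n j \<bullet> e k = cos (t * \<theta>)"
  proof -
    have "2 * real j * \<theta> - (2 * real k + 1) * \<theta> = (2 * real j - (2 * real k + 1)) * \<theta>"
      by (simp add: algebra_simps)
    then have "n j \<bullet> e k = cos \<bar>(2 * real j - (2 * real k + 1)) * \<theta>\<bar>"
      by (simp add: n_def e_def inner_dir)
    then show ?thesis using \<theta>_pos by (simp add: t_def abs_mult)
  qed
  also have "\<dots> < cos \<theta>"
  proof (rule cos_less_cos)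
    show "\<theta> < t * \<theta>" using t \<theta>_pos by simp
    have "t * \<theta> \<le> (2 * real N - 1) * \<theta>" using t \<theta>_pos by (intro mult_right_mono) auto
    then show "t * \<theta> < 2 * pi - \<theta>" using N_less by (simp add: algebra_simps)
  qed (use \<theta>_pos in simp)
  finally show ?thesis .
qed

lemma P_norm_le: "x \<in> P \<Longrightarrow> norm x \<le> 1 / cos \<theta>"
proof -
  assume x: "x \<in> P"
  obtain a where a: "0 \<le> a" "a < 2 * pi" "x = norm x *\<^sub>R dir a" by (rule dir_polar)
  have "\<exists>k\<le>N. cos \<theta> \<le> cos (2 * real k * \<theta> - a)"
  proof -
    \<comment> \<open>The index of the multiple of \<open>2 * \<theta>\<close> nearest to
      \<open>a\<close>.\<close>
    define k where "k = nat \<lfloor>a / (2 * \<theta>) + 1 / 2\<rfloor>"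
    have "0 \<le> a / (2 * \<theta>)" using a \<theta>_pos by simp
    then have "real k \<le> a / (2 * \<theta>) + 1 / 2" "a / (2 * \<theta>) + 1 / 2 < real k + 1"
      unfolding k_def by linarith+
    then have k: "2 * real k * \<theta> - \<theta> \<le> a" "a \<le> 2 * real k * \<theta> + \<theta>"
      using \<theta>_pos by (auto simp: field_simps)
    show ?thesis
    proof (cases "k \<le> N")
      case True
      then show ?thesis using k \<theta>_less by (intro exI[of _ k] conjI cos_le_cos_abs) auto
    next
      case False
      \<comment> \<open>In the leftover gap beyond the last normal: here \<open>a\<close> is within
        \<theta> of a full turn, so the normal with index 0 serves.\<close>
      then have "(2 * (real N + 1) - 1) * \<theta> \<le> (2 * real k - 1) * \<theta>"
        using \<theta>_pos by (intro mult_right_mono) auto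
      then have "2 * pi - \<theta> \<le> a" using k N_ge by (simp add: algebra_simps)
      then have "cos \<theta> \<le> cos (2 * pi - a)" using a \<theta>_less by (intro cos_le_cos_abs) auto
      then show ?thesis by (intro exI[of _ 0]) (simp add: cos_diff)
    qed
  qed
  then obtain k where k: "k \<le> N" "cos \<theta> \<le> cos (2 * real k * \<theta> - a)" by blast
  have "norm x * cos \<theta> \<le> norm x * cos (2 * real k * \<theta> - a)" using k by (intro mult_left_mono) auto
  also have "\<dots> = n k \<bullet> x" by (subst (2) a(3)) (simp add: n_def inner_dir)
  also have "\<dots> \<le> 1" using x k by (simp add: P_def)
  finally show ?thesis using cos_\<theta> by (simp add: field_simps)
qed

sublocale inscribed_body P "1 / cos \<theta>"
proof
  have P_eq: "P = (\<Inter>k\<in>{..N}. {x. n k \<bullet> x \<le> 1})" by (auto simp: P_def)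
  show "closed P" unfolding P_eq by (intro closed_INT ballI closed_halfspace_le)
  show "convex P" unfolding P_eq by (intro convex_INT convex_halfspace_le)
  show "cball 0 1 \<subseteq> P"
  proof
    fix x :: plane assume "x \<in> cball 0 1"
    then have "n k \<bullet> x \<le> 1" for k using norm_cauchy_schwarz[of "n k" x] by simp
    then show "x \<in> P" by (simp add: P_def)
  qed
  show "P \<subseteq> cball 0 (1 / cos \<theta>)" using P_norm_le by auto
  show "1 / cos \<theta> \<le> 3 / 2" using cos_\<theta> by (simp add: field_simps)
qed

section \<open>The boundary distance of the rounded polygon\<close>

abbreviation bd :: "plane \<Rightarrow> real" where "bd \<equiv> boundary_distance \<Omega>"

text \<open>Maximum of the signed distances to the side lines, negative inside \<open>P\<close>,
  where \<open>d\<close> carries no information.\<close>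

definition m :: "plane \<Rightarrow> real" where "m x = Max ((\<lambda>k. n k \<bullet> x) ` {..N}) - 1"

lemma m_ge: "k \<le> N \<Longrightarrow> n k \<bullet> x - 1 \<le> m x" by (simp add: m_def)

lemma m_attained: obtains k where "k \<le> N" "m x = n k \<bullet> x - 1"
proof -
  have "Max ((\<lambda>k. n k \<bullet> x) ` {..N}) \<in> (\<lambda>k. n k \<bullet> x) ` {..N}" by (rule Max_in) auto
  then obtain k where "Max ((\<lambda>k. n k \<bullet> x) ` {..N}) = n k \<bullet> x" "k \<in> {..N}" by (rule imageE)
  then show ?thesis using that[of k] by (simp add: m_def)
qed

lemma m_le: "(\<And>k. k \<le> N \<Longrightarrow> n k \<bullet> x - 1 \<le> a) \<Longrightarrow> m x \<le> a" by (metis m_attained)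

lemma P_iff_m: "x \<in> P \<longleftrightarrow> m x \<le> 0"
proof
  show "x \<in> P \<Longrightarrow> m x \<le> 0" by (rule m_le) (simp add: P_def)
  assume "m x \<le> 0"
  then have "n k \<bullet> x \<le> 1" if "k \<le> N" for k using m_ge[OF that, of x] by simp
  then show "x \<in> P" by (simp add: P_def)
qed

lemma convex_on_m: "convex_on UNIV m"
proof (rule convex_onI)
  fix t :: real and x y assume t: "0 < t" "t < 1"
  show "m ((1 - t) *\<^sub>R x + t *\<^sub>R y) \<le> (1 - t) * m x + t * m y"
  proof (rule m_le)
    fix k assume "k \<le> N"
    then have "(1 - t) * (n k \<bullet> x - 1) + t * (n k \<bullet> y - 1) \<le> (1 - t) * m x + t * m y"
      using t by (intro add_mono mult_left_mono m_ge) auto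
    then show "n k \<bullet> ((1 - t) *\<^sub>R x + t *\<^sub>R y) - 1 \<le> (1 - t) * m x + t * m y"
      by (simp add: inner_add_right algebra_simps)
  qed
qed simp

lemma m_triangle: "m x \<le> m y + norm (x - y)"
proof (rule m_le)
  fix k assume "k \<le> N"
  then show "n k \<bullet> x - 1 \<le> m y + norm (x - y)"
    using m_ge[of k y] norm_cauchy_schwarz[of "n k" "x - y"] by (simp add: inner_diff_right)
qed

lemma lipschitz_on_m: "1-lipschitz_on S m"
proof (rule lipschitz_onI)
  show "dist (m x) (m y) \<le> 1 * dist x y" for x y
    using m_triangle[of x y] m_triangle[of y x] norm_minus_commute[of x y]
    unfolding dist_real_def dist_norm by linarith
qed simp

text \<open>Upper bound: walking along the normal of a side that attains \<open>m x\<close> leads to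
  the line \<open>n k \<bullet> z = 3 / 2\<close>, which is \<open>1 / 2\<close> away from
  \<open>P\<close>. Lower bound: the first \<open>- m x\<close> of a segment from \<open>x\<close>
  stays in \<open>P\<close>, as \<open>m\<close> is 1-Lipschitz, and less than \<open>1 / 2\<close>
  remains.\<close>

lemma bd_inside:
  assumes x: "x \<in> P" shows "bd x = 1 / 2 - m x"
proof (rule antisym)
  have m0: "m x \<le> 0" using x P_iff_m by blast
  obtain k where k: "k \<le> N" "m x = n k \<bullet> x - 1" by (rule m_attained)
  define z where "z = x + (1 / 2 - m x) *\<^sub>R n k"
  have nz: "n k \<bullet> z = 3 / 2" using k(2) by (simp add: z_def inner_add_right)
  have "n k \<bullet> closest_point P z \<le> 1"
    using closest_point_in_set[OF closed_P P_nonempty, of z] k(1) by (simp add: P_def)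
  then have "1 / 2 \<le> n k \<bullet> (z - closest_point P z)" using nz by (simp add: inner_diff_right)
  then have "1 / 2 \<le> d z" using norm_cauchy_schwarz[of "n k" "z - closest_point P z"] by (simp add: d_eq)
  then have "z \<notin> \<Omega>" by (simp add: \<Omega>_def)
  moreover have "x \<in> \<Omega>" using x P_sub_\<Omega> by blast
  ultimately have "bd x \<le> dist x z" unfolding boundary_distance_def by (intro infdist_frontier_le)
  also have "\<dots> = 1 / 2 - m x" using m0 by (simp add: z_def dist_norm)
  finally show "bd x \<le> 1 / 2 - m x" .
  have "ball x (1 / 2 - m x) \<subseteq> \<Omega>"
  proof
    fix y assume y: "y \<in> ball x (1 / 2 - m x)"
    show "y \<in> \<Omega>"
    proof (cases "norm (y - x) \<le> - m x")
      case True
      then have "y \<in> P" using m_triangle[of y x] P_iff_m by simp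
      then show ?thesis using P_sub_\<Omega> by blast
    next
      case False
      define s where "s = - m x / norm (y - x)"
      have ne: "0 < norm (y - x)" using False m0 by linarith
      have s: "0 \<le> s" "s \<le> 1" "s * norm (y - x) = - m x"
        using False m0 ne by (auto simp: s_def field_simps)
      define q where "q = x + s *\<^sub>R (y - x)"
      have "norm (q - x) = - m x" using s by (simp add: q_def)
      then have "q \<in> P" using m_triangle[of q x] P_iff_m by simp
      then have "d y \<le> norm (y - q)" unfolding d_def by (metis infdist_le dist_norm)
      also have "y - q = (1 - s) *\<^sub>R (y - x)" by (simp add: q_def algebra_simps)
      also have "norm \<dots> = norm (y - x) + m x" using s unfolding norm_scaleR by (simp add: algebra_simps)
      also have "\<dots> < 1 / 2" using y by (simp add: dist_norm norm_minus_commute)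
      finally show ?thesis by (simp add: \<Omega>_def)
    qed
  qed
  then show "1 / 2 - m x \<le> bd x"
    unfolding boundary_distance_def by (rule infdist_frontier_ge[OF open_\<Omega> frontier_\<Omega>_nonempty])
qed

text \<open>Merges both formulas into a difference of convex functions: on \<open>P\<close> the
  terms \<open>d x\<close> and \<open>max (m x) 0\<close> vanish, outside \<open>P\<close> the
  latter cancels \<open>m x\<close>.\<close>

lemma bd_eq: "x \<in> \<Omega> \<Longrightarrow> bd x = (1 / 2 + max (m x) 0) - (d x + m x)"
  using bd_inside[of x] boundary_distance_outside[of x] P_iff_m[of x] d_zero[of x] by (cases "x \<in> P") auto

lemma GDERIV_bd_inside:
  assumes x: "x \<in> interior P" and k: "k \<le> N" and max: "\<And>j. j \<le> N \<Longrightarrow> j \<noteq> k \<Longrightarrow> n j \<bullet> x < n k \<bullet> x"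
  shows "GDERIV bd x :> - n k"
proof (rule GDERIV_transform_open)
  define U where "U = interior P \<inter> (\<Inter>j\<in>{..N} - {k}. {y. n j \<bullet> y < n k \<bullet> y})"
  show "open U" unfolding U_def
    by (intro open_Int open_interior open_INT ballI open_Collect_less continuous_intros) auto
  show "x \<in> U" using x max by (auto simp: U_def)
  fix y assume y: "y \<in> U"
  have "m y = n k \<bullet> y - 1"
  proof (rule antisym[OF m_le m_ge[OF k]])
    fix j assume "j \<le> N"
    then show "n j \<bullet> y - 1 \<le> n k \<bullet> y - 1" using y by (cases "j = k") (auto simp: U_def less_imp_le)
  qed
  then show "3 / 2 - y \<bullet> n k = bd y"
    using bd_inside[of y] y interior_subset[of P] by (auto simp: U_def inner_commute)
next
  have "((\<lambda>y. y \<bullet> n k) has_derivative (\<lambda>h. h \<bullet> n k)) (at x)" by (auto intro!: derivative_eq_intros)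
  then have "GDERIV (\<lambda>y. y \<bullet> n k) x :> n k" by (simp add: gderiv_def)
  then show "GDERIV (\<lambda>y. 3 / 2 - y \<bullet> n k) x :> - n k" using GDERIV_diff[OF GDERIV_const] by fastforce
qed

lemma GDERIV_bd_outside:
  assumes "x \<in> \<Omega>" "x \<notin> P" shows "GDERIV bd x :> - normal x"
proof (rule GDERIV_transform_open)
  show "open (\<Omega> \<inter> - P)" using open_\<Omega> closed_P by auto
  show "GDERIV (\<lambda>y. 1 / 2 - d y) x :> - normal x"
    using GDERIV_diff[OF GDERIV_const GDERIV_d[OF assms(2)]] by simp
qed (use assms boundary_distance_outside in auto)

lemma bd_in_S0: "bd \<in> S0_class \<Omega>"
proof -
  have bd_lip: "1-lipschitz_on S bd" for S
    using lipschitz_on_infdist[of S "frontier \<Omega>"] by (simp add: boundary_distance_def[abs_def])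
  \<comment> \<open>Off these curves either a single side determines the distance near
    \<open>x\<close>, or \<open>x\<close> is outside \<open>P\<close>, where \<open>d\<close> is
    differentiable.\<close>
  define Z where "Z = frontier P \<union> (\<Union>i\<in>{..N}. \<Union>j\<in>{..N} - {i}. {x. (n i - n j) \<bullet> x = 0})"
  have "negligible {x. (n i - n j) \<bullet> x = 0}" if "i \<le> N" "j \<le> N" "j \<noteq> i" for i j
  proof -
    have "n i \<bullet> n j < 1" using that by (intro n_inner_less) auto
    then have "n i - n j \<noteq> 0" using n_inner_self[of i] by auto
    then show ?thesis by (intro negligible_hyperplane) simp
  qed
  then have "negligible Z" unfolding Z_def
    by (intro negligible_Un negligible_convex_frontier convex_P) (auto intro!: negligible_Union)
  then have "AE x in lebesgue. x \<notin> Z" unfolding negligible_iff_null_sets by (rule AE_not_in)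
  then have "AE x in lebesgue. x \<in> \<Omega> \<longrightarrow> bd differentiable (at x) \<and> norm (grad bd x) = 1"
  proof eventually_elim
    case (elim x)
    show ?case
    proof
      assume x: "x \<in> \<Omega>"
      show "bd differentiable (at x) \<and> norm (grad bd x) = 1"
      proof (cases "x \<in> P")
        case False
        then show ?thesis using GDERIV_bd_outside[OF x False]
          by (auto simp: grad_eq norm_normal intro: GDERIV_imp_differentiable)
      next
        case True
        then have xi: "x \<in> interior P" using elim closed_P by (auto simp: Z_def frontier_def)
        obtain k where k: "k \<le> N" "m x = n k \<bullet> x - 1" by (rule m_attained)
        have "n j \<bullet> x < n k \<bullet> x" if "j \<le> N" "j \<noteq> k" for j
        proof -
          have "(n k - n j) \<bullet> x \<noteq> 0" using elim that k by (auto simp: Z_def)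
          then show ?thesis using m_ge[OF that(1), of x] k(2) by (simp add: inner_diff_left)
        qed
        then have "GDERIV bd x :> - n k" by (rule GDERIV_bd_inside[OF xi k(1)])
        then show ?thesis by (auto simp: grad_eq intro: GDERIV_imp_differentiable)
      qed
    qed
  qed
  then have AE: "AE x in lebesgue_on \<Omega>. bd differentiable (at x) \<and> norm (grad bd x) = 1"
    using open_\<Omega> by (subst AE_restrict_space_iff) auto
  have c1: "convex_on UNIV (\<lambda>x. 1 / 2 + max (m x) 0)"
    by (intro convex_on_add convex_on_max convex_on_m) (simp_all add: convex_on_const)
  have l1: "(0 + 1)-lipschitz_on UNIV (\<lambda>x. 1 / 2 + max (m x) 0)"
    by (intro lipschitz_on_add lipschitz_on_constant lipschitz_on_max lipschitz_on_m)
      (rule lipschitz_on_mono[OF lipschitz_on_constant], auto)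
  have "grad bd \<in> BV_field \<Omega>"
  proof (rule grad_in_BV_field[OF open_\<Omega> \<Omega>_sub c1 _ l1 _ bd_eq])
    show "convex_on UNIV (\<lambda>x. d x + m x)" by (intro convex_on_add convex_on_d convex_on_m)
    show "(1 + 1)-lipschitz_on UNIV (\<lambda>x. d x + m x)"
      by (intro lipschitz_on_add lipschitz_on_d lipschitz_on_m)
    show "AE x in lebesgue_on \<Omega>. bd differentiable (at x)" using AE by eventually_elim simp
  qed
  moreover have "(bd \<longlongrightarrow> 0) (at p within \<Omega>)" if p: "p \<in> frontier \<Omega>" for p
  proof -
    have "continuous_on UNIV bd" by (rule lipschitz_on_continuous_on[OF bd_lip])
    then have "(bd \<longlongrightarrow> bd p) (at p within \<Omega>)"
      by (meson UNIV_I continuous_on_def subset_UNIV tendsto_within_subset)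
    then show ?thesis using p by (simp add: boundary_distance_def)
  qed
  ultimately show ?thesis using AE bd_lip by (auto simp: S0_class_def S_class_def)
qed

text \<open>Only the part in the unit disc. The actual ridge continues to the vertex at distance
  \<open>1 / cos \<theta>\<close>, but unit length suffices for the estimate.\<close>

definition ridge :: "nat \<Rightarrow> plane set" where "ridge k = open_segment 0 (e k)"

lemma ridge_iff: "x \<in> ridge k \<longleftrightarrow> (\<exists>s. 0 < s \<and> s < 1 \<and> x = s *\<^sub>R e k)"
proof -
  have "e k \<noteq> 0" using norm_dir[of "(2 * real k + 1) * \<theta>"] unfolding e_def by force
  then show ?thesis by (auto simp: ridge_def in_segment)
qed

text \<open>Near the ridge only two sides compete and the sign of \<open>y \<bullet> W\<close>
  decides between them, so the gradient is constant on either side. A jump triple is exhibited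
  because a lower bound for the energy needs points known to lie in the jump set.\<close>

lemma ridge_jump:
  assumes k: "k < N" and x: "x \<in> ridge k"
  shows "x \<in> jump_set \<Omega> (grad bd)"
    and "norm (trace_plus (grad bd) x - trace_minus (grad bd) x) = 2 * sin \<theta>"
proof -
  define u where "u = grad bd"
  have u: "u \<in> BV_field \<Omega>" using bd_in_S0 by (simp add: S0_class_def S_class_def u_def)
  obtain s where s: "0 < s" "s < 1" "x = s *\<^sub>R e k" using x by (auto simp: ridge_iff)
  define W where "W = n k - n (Suc k)"
  have xW: "x \<bullet> W = 0"
    using n_inner_e[of k] by (simp add: s(3) W_def inner_diff_right inner_commute)
  have "(norm W)\<^sup>2 = (2 * sin \<theta>)\<^sup>2"
  proof -
    have "(norm W)\<^sup>2 = n k \<bullet> n k + n (Suc k) \<bullet> n (Suc k) - 2 * (n k \<bullet> n (Suc k))"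
      by (simp add: W_def power2_norm_eq_inner inner_simps inner_commute)
    also have "n k \<bullet> n (Suc k) = cos (2 * \<theta>)"
      using cos_minus[of "2 * \<theta>"] by (simp add: n_def inner_dir algebra_simps)
    finally show ?thesis by (simp add: cos_double_sin power_mult_distrib)
  qed
  moreover have sin_pos: "0 < sin \<theta>" using \<theta>_pos \<theta>_less by (intro sin_gt_zero) auto
  ultimately have nW: "norm W = 2 * sin \<theta>" by (intro power2_eq_imp_eq[of "norm W"]) auto
  then have W0: "0 < norm W" using sin_pos by simp
  define w where "w = sgn W"
  have w: "norm w = 1" "W = norm W *\<^sub>R w" using W0 by (auto simp: w_def norm_sgn sgn_div_norm)
  define U where "U = ball 0 1 \<inter> (\<Inter>j\<in>{..N} - {k, Suc k}.
      {y. n j \<bullet> y < n k \<bullet> y} \<inter> {y. n j \<bullet> y < n (Suc k) \<bullet> y})"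
  have "open U" unfolding U_def
    by (intro open_Int open_ball open_INT ballI open_Collect_less continuous_intros) auto
  have "x \<in> U"
    using s n_inner_e[of k] n_inner_e_less[OF k] by (auto simp: U_def)
  have Ui: "y \<in> interior P" if "y \<in> U" for y
    using that ball_P interior_maximal[of "ball 0 1" P] ball_subset_cball by (force simp: U_def)
  have u_plus: "u y = - n k" if y: "y \<in> U" "0 < y \<bullet> W" for y
    unfolding u_def
  proof (rule grad_eq, rule GDERIV_bd_inside[OF Ui[OF y(1)]])
    fix j assume "j \<le> N" "j \<noteq> k"
    then show "n j \<bullet> y < n k \<bullet> y"
      using y by (cases "j = Suc k") (auto simp: U_def W_def inner_diff_right inner_commute)
  qed (use k in simp)
  have u_minus: "u y = - n (Suc k)" if y: "y \<in> U" "y \<bullet> W < 0" for y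
    unfolding u_def
  proof (rule grad_eq, rule GDERIV_bd_inside[OF Ui[OF y(1)]])
    fix j assume "j \<le> N" "j \<noteq> Suc k"
    then show "n j \<bullet> y < n (Suc k) \<bullet> y"
      using y by (cases "j = k") (auto simp: U_def W_def inner_diff_right inner_commute)
  qed (use k in simp)
  have evU: "\<forall>\<^sub>F y in nhds x. y \<in> U" using \<open>open U\<close> \<open>x \<in> U\<close> by (simp add: eventually_nhds) blast
  have "((\<lambda>y. y \<bullet> W) has_derivative (\<lambda>h. h \<bullet> W)) (at x)" by (auto intro!: derivative_eq_intros)
  then have D: "GDERIV (\<lambda>y. y \<bullet> W) x :> norm W *\<^sub>R w" using w(2) by (simp add: gderiv_def)
  have D': "GDERIV (\<lambda>y. - (y \<bullet> W)) x :> norm W *\<^sub>R (- w)" using GDERIV_minus[OF D] by simp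
  have sec: "sector_limit u x w (- n k)"
  proof (rule sector_limit_GDERIV[OF D W0])
    show "\<forall>\<^sub>F y in nhds x. x \<bullet> W < y \<bullet> W \<longrightarrow> u y = - n k"
      using evU by eventually_elim (simp add: xW u_plus)
  qed simp
  have sec': "sector_limit u x (- w) (- n (Suc k))"
  proof (rule sector_limit_GDERIV[OF D' W0])
    show "\<forall>\<^sub>F y in nhds x. - (x \<bullet> W) < - (y \<bullet> W) \<longrightarrow> u y = - n (Suc k)"
      using evU by eventually_elim (simp add: xW u_minus)
  qed simp
  obtain r0 where r0: "0 < r0" "ball x r0 \<subseteq> U"
    using \<open>open U\<close> \<open>x \<in> U\<close> by (auto simp: open_contains_ball)
  have yw: "(y - x) \<bullet> w * norm W = y \<bullet> W" for y
    using xW W0 by (simp add: w_def sgn_div_norm inner_diff_left)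
  \<comment> \<open>On small half balls the gradient equals \<open>a\<close>, so these averages are
    exactly 0.\<close>
  have avg: "((\<lambda>r. average (half_ball x r \<nu>) (\<lambda>y. norm (u y - a))) \<longlongrightarrow> 0) (at_right 0)"
    if "\<And>y. y \<in> U \<Longrightarrow> 0 < (y - x) \<bullet> \<nu> \<Longrightarrow> u y = a" for \<nu> a
  proof (rule tendsto_eventually)
    have "average (half_ball x r \<nu>) (\<lambda>y. norm (u y - a)) = 0" if r: "0 < r" "r < r0" for r
    proof -
      have "indicator (half_ball x r \<nu>) y *\<^sub>R norm (u y - a) = 0" for y
      proof (cases "y \<in> half_ball x r \<nu>")
        case True
        then have "y \<in> U" "0 < (y - x) \<bullet> \<nu>" using r r0 by (auto simp: half_ball_def)
        then show ?thesis using \<open>\<And>y. y \<in> U \<Longrightarrow> 0 < (y - x) \<bullet> \<nu> \<Longrightarrow> u y = a\<close> by simp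
      qed simp
      then have "(LINT y:half_ball x r \<nu>|lebesgue. norm (u y - a)) = 0"
        unfolding set_lebesgue_integral_def by (simp only: Bochner_Integration.integral_zero)
      then show ?thesis by (simp add: average_def)
    qed
    then show "\<forall>\<^sub>F r in at_right 0. average (half_ball x r \<nu>) (\<lambda>y. norm (u y - a)) = 0"
      using r0(1) by (auto simp: eventually_at_right_field)
  qed
  have "u y = - n k" if "y \<in> U" "0 < (y - x) \<bullet> w" for y
    using u_plus[OF that(1)] yw[of y] W0 that(2) by (metis mult_pos_pos)
  moreover have "u y = - n (Suc k)" if "y \<in> U" "0 < (y - x) \<bullet> (- w)" for y
    using u_minus[OF that(1)] yw[of y] W0 that(2) by (metis inner_minus_right mult_neg_pos neg_0_less_iff_less)
  moreover have "- n k \<noteq> - n (Suc k)" using W0 by (auto simp: W_def)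
  ultimately have "jump_triple u x (- n k) (- n (Suc k)) w"
    unfolding jump_triple_def using w(1) avg by blast
  moreover have "x \<in> \<Omega>" using Ui[OF \<open>x \<in> U\<close>] interior_subset P_sub_\<Omega> by blast
  ultimately have J: "x \<in> jump_set \<Omega> u" by (auto simp: jump_set_def)
  then show "x \<in> jump_set \<Omega> (grad bd)" by (simp add: u_def)
  have "norm (trace_plus u x - trace_minus u x) = norm (- n k - - n (Suc k))"
    by (rule norm_traces_diff[OF open_\<Omega> J u w(1) sec sec'])
  also have "\<dots> = norm W" by (simp add: W_def norm_minus_commute)
  finally show "norm (trace_plus (grad bd) x - trace_minus (grad bd) x) = 2 * sin \<theta>"
    using nW by (simp add: u_def)
qed

lemma ridge_in_sets: "ridge k \<in> sets hausdorff1"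
proof (rule borel_in_sets_hausdorff1)
  have "closed (closed_segment 0 (e k))" by simp
  then show "ridge k \<in> sets borel" unfolding ridge_def open_segment_def
    by (intro sets.Diff) auto
qed

lemma emeasure_ridge_ge: "1 \<le> emeasure hausdorff1 (ridge k)"
proof -
  have "ennreal (1 - 0) \<le> hausdorff1_outer (ridge k)"
  proof (rule hausdorff1_outer_ge_projection)
    show "\<bar>x \<bullet> e k - y \<bullet> e k\<bar> \<le> dist x y" for x y
      using Cauchy_Schwarz_ineq2[of "x - y" "e k"] by (simp add: inner_diff_left dist_norm)
    have "(s *\<^sub>R e k) \<bullet> e k = s" for s by simp
    then show "{0<..<1} \<subseteq> (\<lambda>x. x \<bullet> e k) ` ridge k" by (force simp: ridge_iff image_iff)
  qed simp
  then show ?thesis by (simp add: emeasure_hausdorff1 ridge_in_sets)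
qed

lemma disjoint_ridges: "disjoint_family_on ridge {..<N}"
  unfolding disjoint_family_on_def
proof (intro ballI impI)
  fix k l assume kl: "k \<in> {..<N}" "l \<in> {..<N}" "k \<noteq> l"
  have False if x: "x \<in> ridge k" "x \<in> ridge l" for x
  proof -
    obtain s t where st: "0 < s" "0 < t" "x = s *\<^sub>R e k" "x = t *\<^sub>R e l"
      using x unfolding ridge_iff by blast
    then have "norm (s *\<^sub>R e k) = norm (t *\<^sub>R e l)" by simp
    then have "s = t" using st by simp
    then have "e k = e l" using st by simp
    moreover have "e k \<bullet> e l < 1" using kl by (intro e_inner_less) auto
    ultimately show False using norm_e norm_eq_1 by (metis less_irrefl)
  qed
  then show "ridge k \<inter> ridge l = {}" by blast
qed

lemma energy_bd_ge: "of_nat N * f (2 * sin \<theta>) \<le> energy f \<Omega> bd"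
proof -
  define T where "T = (\<Union>k\<in>{..<N}. ridge k)"
  have T: "T \<in> sets hausdorff1" unfolding T_def by (intro sets.finite_UN) (auto simp: ridge_in_sets)
  have "of_nat N = (\<Sum>k\<in>{..<N}. 1 :: ennreal)" by simp
  also have "\<dots> \<le> (\<Sum>k\<in>{..<N}. emeasure hausdorff1 (ridge k))" by (intro sum_mono emeasure_ridge_ge)
  also have "\<dots> = emeasure hausdorff1 T"
    unfolding T_def by (intro sum_emeasure disjoint_ridges) (auto simp: ridge_in_sets)
  finally have "of_nat N * f (2 * sin \<theta>) \<le> emeasure hausdorff1 T * f (2 * sin \<theta>)"
    by (rule mult_right_mono) simp
  also have "\<dots> = (\<integral>\<^sup>+x. f (2 * sin \<theta>) * indicator T x \<partial>hausdorff1)"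
    by (subst nn_integral_cmult_indicator[OF T]) (rule mult.commute)
  also have "\<dots> \<le> energy f \<Omega> bd"
    unfolding energy_def
  proof (rule nn_integral_mono)
    fix x
    show "f (2 * sin \<theta>) * indicator T x \<le> f (norm (trace_plus (grad bd) x - trace_minus (grad bd) x))
        * indicator (jump_set \<Omega> (grad bd)) x"
      using ridge_jump[of _ x] by (cases "x \<in> T") (auto simp: T_def)
  qed
  finally show ?thesis .
qed

end

section \<open>Comparison of the two energies and choice of the angle\<close>

lemma circumscribed_polygon_exists:
  assumes "0 < \<theta>" "\<theta> < pi / 2" "2 / 3 \<le> cos \<theta>"
  obtains N where "circumscribed_polygon \<theta> N"
proof -
  obtain n :: nat where "pi / \<theta> < n" using reals_Archimedean2 by blast
  then have ex: "pi \<le> (real n + 1) * \<theta>" using assms by (simp add: field_simps)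
  define N where "N = (LEAST n. pi \<le> (real n + 1) * \<theta>)"
  have "pi \<le> (real N + 1) * \<theta>" unfolding N_def by (rule LeastI[of _ n]) (rule ex)
  moreover have "real N * \<theta> < pi"
  proof (cases N)
    case (Suc k)
    then have "\<not> pi \<le> (real k + 1) * \<theta>"
      using not_less_Least[of k "\<lambda>n. pi \<le> (real n + 1) * \<theta>"] by (simp add: N_def)
    then show ?thesis using Suc by (simp add: add.commute)
  qed simp
  ultimately show ?thesis using assms by (intro that[of N]) unfold_locales
qed

text \<open>With \<open>cos \<theta> \<ge> 9 / 10\<close> the competitor costs at most
  \<open>29 / 9 * pi * M\<close>; with \<open>\<theta> \<le> 1 / 4\<close> as well, the distance
  costs at least \<open>18 / 5 * (pi - 1 / 4) * M\<close>, which is larger since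
  \<open>pi > 3\<close>.\<close>

lemma distance_not_minimal:
  fixes f :: "real \<Rightarrow> ennreal"
  assumes "circumscribed_polygon \<theta> N" and \<theta>: "\<theta> \<le> 1 / 4" "9 / 10 \<le> cos \<theta>" and M: "0 < M"
    and f0: "ennreal (2 * M) * ennreal (2 * sin \<theta>) \<le> f (2 * sin \<theta>)"
    and f2: "\<And>t. 2 + 2 * cos \<theta> \<le> t\<^sup>2 \<Longrightarrow> 0 \<le> t \<Longrightarrow> t \<le> 2 \<Longrightarrow> f t \<le> ennreal M"
  shows "\<not> minimizer f (inscribed_body.\<Omega> (circumscribed_polygon.P \<theta> N))
      (boundary_distance (inscribed_body.\<Omega> (circumscribed_polygon.P \<theta> N)))"
proof
  interpret circumscribed_polygon \<theta> N by fact
  assume "minimizer f \<Omega> bd"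
  then have le: "energy f \<Omega> bd \<le> energy f \<Omega> \<psi>" using \<psi>_in_S0 by (simp add: minimizer_def)
  have sin0: "0 < sin \<theta>" using \<theta>_pos \<theta>_less by (intro sin_gt_zero) auto
  have "ennreal (real N * (2 * M * (2 * sin \<theta>))) = of_nat N * (ennreal (2 * M) * ennreal (2 * sin \<theta>))"
  proof -
    have "ennreal (2 * M) * ennreal (2 * sin \<theta>) = ennreal (2 * M * (2 * sin \<theta>))"
      using M sin0 by (intro ennreal_mult[symmetric]) auto
    moreover have "ennreal (real N * a) = of_nat N * ennreal a" if "0 \<le> a" for a
      using that by (simp add: ennreal_mult ennreal_of_nat_eq_real_of_nat)
    ultimately show ?thesis using M sin0 by simp
  qed
  also have "\<dots> \<le> of_nat N * f (2 * sin \<theta>)" by (intro mult_left_mono f0) simp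
  also have "\<dots> \<le> energy f \<Omega> bd" by (rule energy_bd_ge)
  also note le
  also have "energy f \<Omega> \<psi> \<le> ennreal M * ennreal (2 * pi * (1 / cos \<theta> + 1 / 2))"
    by (rule energy_\<psi>_le) (use f2 in simp)
  also have "\<dots> = ennreal (M * (2 * pi * (1 / cos \<theta> + 1 / 2)))"
    using M \<theta> by (simp add: ennreal_mult)
  finally have "real N * (2 * M * (2 * sin \<theta>)) \<le> M * (2 * pi * (1 / cos \<theta> + 1 / 2))"
    using M \<theta> by (subst (asm) ennreal_le_iff) auto
  then have "M * (4 * (real N * sin \<theta>)) \<le> M * (2 * pi * (1 / cos \<theta> + 1 / 2))" by (simp add: algebra_simps)
  then have "4 * (real N * sin \<theta>) \<le> 2 * pi * (1 / cos \<theta> + 1 / 2)" using M by simp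
  also have "\<dots> \<le> 2 * pi * (10 / 9 + 1 / 2)"
    using \<theta> by (intro mult_left_mono add_right_mono) (auto simp: field_simps)
  finally have up: "4 * (real N * sin \<theta>) \<le> 29 / 9 * pi" by simp
  \<comment> \<open>The choice of \<open>N\<close> gives
    \<open>real N * \<theta> \<ge> pi - \<theta>\<close>; the inequality
    \<open>\<theta> * cos \<theta> \<le> sin \<theta>\<close> then turns the angle into a
    sine.\<close>
  have "(pi - \<theta>) * (9 / 10) \<le> (real N * \<theta>) * cos \<theta>"
    using N_ge \<theta> \<theta>_pos by (intro mult_mono) (auto simp: algebra_simps)
  also have "\<dots> = real N * (\<theta> * cos \<theta>)" by simp
  also have "\<dots> \<le> real N * sin \<theta>"
    using sin_ge_mult_cos[of \<theta>] \<theta>_pos \<theta>_less by (intro mult_left_mono) auto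
  finally have lo: "(pi - \<theta>) * (9 / 10) \<le> real N * sin \<theta>" .
  have "(pi - 1 / 4) * (9 / 10) \<le> (pi - \<theta>) * (9 / 10)" using \<theta> by simp
  then show False using up lo pi_gt3 by simp
qed

lemma eventually_arcsin_small:
  assumes "\<kappa> < 1" shows "\<forall>\<^sub>F t in at_right 0. arcsin (t / 2) \<le> 1 / 4 \<and> \<kappa> < cos (arcsin (t / 2))"
proof -
  have "isCont (\<lambda>t::real. arcsin (t / 2)) 0" by (intro isCont_o2[OF _ isCont_arcsin] continuous_intros) auto
  then have lim: "((\<lambda>t. arcsin (t / 2)) \<longlongrightarrow> 0) (at_right 0)"
    using isContD tendsto_within_subset[of _ _ 0 UNIV "{0<..}"] by fastforce
  then have "((\<lambda>t. cos (arcsin (t / 2))) \<longlongrightarrow> cos 0) (at_right 0)" by (intro tendsto_intros)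
  then have "\<forall>\<^sub>F t in at_right 0. \<kappa> < cos (arcsin (t / 2))" using assms by (intro order_tendstoD) auto
  moreover have "\<forall>\<^sub>F t in at_right 0. arcsin (t / 2) < 1 / 4" using lim by (intro order_tendstoD) auto
  ultimately show ?thesis by eventually_elim simp
qed

lemma circumscribed_polygon_arcsin:
  assumes "0 < t" "t < 2" "9 / 10 \<le> cos (arcsin (t / 2))"
  obtains N where "circumscribed_polygon (arcsin (t / 2)) N" "2 * sin (arcsin (t / 2)) = t"
proof -
  have "0 < arcsin (t / 2)" "arcsin (t / 2) < pi / 2"
    using assms arcsin_less_arcsin[of 0 "t/2"] arcsin_less_arcsin[of "t/2" 1] by auto
  then show ?thesis using circumscribed_polygon_exists[of "arcsin (t / 2)"] assms that by auto
qed

theorem proposition1: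
  fixes f :: "real \<Rightarrow> ennreal"
  assumes "f \<in> borel_measurable (lebesgue_on {0..2})"
  shows "\<exists>\<Omega> :: (real^2) set. lipschitz_domain \<Omega> \<and> convex \<Omega> \<and>
           boundary_distance \<Omega> \<in> S0_class \<Omega> \<and>
           (minimizer f \<Omega> (boundary_distance \<Omega>) \<longrightarrow> limsup_slope_0 f \<le> 2 * limsup_2 f)"
proof -
  have ex: "\<exists>\<Omega> :: (real^2) set. lipschitz_domain \<Omega> \<and> convex \<Omega> \<and> boundary_distance \<Omega> \<in> S0_class \<Omega> \<and> Q \<Omega>"
    if N: "circumscribed_polygon \<theta> N" and Q: "Q (inscribed_body.\<Omega> (circumscribed_polygon.P \<theta> N))" for \<theta> N Q
  proof -
    interpret circumscribed_polygon \<theta> N by (rule N)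
    show ?thesis using lipschitz_domain_\<Omega> convex_\<Omega> bd_in_S0 Q by blast
  qed
  show ?thesis
  proof (cases "limsup_slope_0 f \<le> 2 * limsup_2 f")
    \<comment> \<open>The conclusion holds already, so any polygon with a small angle will
      do.\<close>
    case True
    have "\<forall>\<^sub>F t in at_right 0. 9 / 10 < cos (arcsin (t / 2))"
      using eventually_arcsin_small[of "9 / 10"] by (auto elim: eventually_mono)
    moreover have "\<forall>\<^sub>F t in at_right (0::real). 0 < t \<and> t < 2"
      by (auto simp: eventually_at_right_field intro: exI[of _ 2])
    ultimately have "\<forall>\<^sub>F t in at_right 0. 9 / 10 < cos (arcsin (t / 2)) \<and> 0 < t \<and> t < 2"
      by (rule eventually_conj)
    then obtain t :: real where "9 / 10 < cos (arcsin (t / 2))" "0 < t" "t < 2"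
      using eventually_happens trivial_limit_at_right_real by blast
    then obtain N where "circumscribed_polygon (arcsin (t / 2)) N"
      using circumscribed_polygon_arcsin[of t] by auto
    then show ?thesis using True by (intro ex[of _ N]) auto
  next
    case False
    \<comment> \<open>With \<open>M\<close> half of this intermediate value, \<open>f\<close> stays
      below \<open>M\<close> near 2, while \<open>f t / t\<close> exceeds \<open>2 * M\<close> for
      arbitrarily small \<open>t\<close>.\<close>
    then obtain c where c: "2 * limsup_2 f < c" "c < limsup_slope_0 f" using dense not_le by metis
    then obtain r where r: "0 \<le> r" "c = ennreal r" by (cases c) auto
    define M where "M = r / 2"
    have cM: "c = 2 * ennreal M" using r by (simp add: M_def ennreal_mult'[symmetric] flip: ennreal_numeral)
    have M: "0 < M" using c(1) r by (auto simp: M_def intro: ccontr)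
    have "limsup_2 f < ennreal M"
    proof (rule ccontr)
      assume "\<not> limsup_2 f < ennreal M"
      then have "2 * ennreal M \<le> 2 * limsup_2 f" by (intro mult_left_mono) auto
      then show False using c(1) cM by simp
    qed
    then have "\<forall>\<^sub>F t in inf (nhds 2) (principal {..2}). f t < ennreal M"
      unfolding limsup_2_def by (rule Limsup_lessD)
    then obtain \<delta> where \<delta>: "0 < \<delta>" "\<And>t. \<bar>t - 2\<bar> < \<delta> \<Longrightarrow> t \<le> 2 \<Longrightarrow> f t < ennreal M"
      by (auto simp: eventually_inf_principal eventually_nhds_metric dist_real_def)
    \<comment> \<open>The second entry solves
      \<open>2 + 2 * \<kappa> = (2 - min \<delta> 1)\<^sup>2\<close>, so jumps whose square is at
      least \<open>2 + 2 * cos \<theta>\<close> exceed \<open>2 - \<delta>\<close>. The minimum with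
      1 keeps the base positive, so that squares can be compared.\<close>
    define \<kappa> where "\<kappa> = max (9 / 10) ((2 - min \<delta> 1)\<^sup>2 / 2 - 1)"
    have "(2 - min \<delta> 1)\<^sup>2 < 2\<^sup>2" using \<delta>(1) by (intro power_strict_mono) auto
    then have "\<kappa> < 1" by (simp add: \<kappa>_def)
    then have "\<forall>\<^sub>F t in at_right 0. arcsin (t / 2) \<le> 1 / 4 \<and> \<kappa> < cos (arcsin (t / 2))"
      by (rule eventually_arcsin_small)
    moreover have "\<forall>\<^sub>F t in at_right (0::real). 0 < t \<and> t < 2"
      by (auto simp: eventually_at_right_field intro: exI[of _ 2])
    \<comment> \<open>A large upper limit gives large quotients only frequently; the bounds on the
      angle hold eventually, so both hold at some \<open>t\<close>.\<close>
    moreover have "\<exists>\<^sub>F t in at_right 0. c < f t / ennreal t"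
    proof (rule ccontr)
      assume "\<not> ?thesis"
      then have "\<forall>\<^sub>F t in at_right 0. f t / ennreal t \<le> c" by (simp add: not_frequently not_less)
      then have "limsup_slope_0 f \<le> c" unfolding limsup_slope_0_def by (rule Limsup_bounded)
      then show False using c(2) by simp
    qed
    ultimately have "\<exists>\<^sub>F t in at_right 0. (arcsin (t / 2) \<le> 1 / 4 \<and> \<kappa> < cos (arcsin (t / 2)))
        \<and> (0 < t \<and> t < 2) \<and> c < f t / ennreal t"
      by (intro frequently_eventually_conj) auto
    then obtain t where t: "arcsin (t / 2) \<le> 1 / 4" "\<kappa> < cos (arcsin (t / 2))" "0 < t" "t < 2"
      "c < f t / ennreal t" by (auto dest!: frequently_ex)
    define \<theta> where "\<theta> = arcsin (t / 2)"
    have cos: "9 / 10 \<le> cos \<theta>" "(2 - min \<delta> 1)\<^sup>2 / 2 - 1 < cos \<theta>"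
      using t(2) by (simp_all add: \<kappa>_def \<theta>_def)
    obtain N where N: "circumscribed_polygon \<theta> N" "2 * sin \<theta> = t"
      using circumscribed_polygon_arcsin[OF t(3,4)] cos(1) unfolding \<theta>_def by blast
    have "c * ennreal t \<le> f t"
    proof (rule ccontr)
      assume "\<not> c * ennreal t \<le> f t"
      then have "f t / ennreal t \<le> c * ennreal t / ennreal t" by (intro divide_right_mono_ennreal) auto
      also have "\<dots> = c" using t(3) by (simp add: ennreal_mult_divide_eq)
      finally show False using t(5) by simp
    qed
    then have f0: "ennreal (2 * M) * ennreal (2 * sin \<theta>) \<le> f (2 * sin \<theta>)"
      using N(2) r(2) by (simp add: M_def)
    have "\<not> minimizer f (inscribed_body.\<Omega> (circumscribed_polygon.P \<theta> N))
        (boundary_distance (inscribed_body.\<Omega> (circumscribed_polygon.P \<theta> N)))"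
    proof (rule distance_not_minimal[where f = f, OF N(1) _ cos(1) M f0])
      show "\<theta> \<le> 1 / 4" using t(1) by (simp add: \<theta>_def)
      fix s :: real assume s: "2 + 2 * cos \<theta> \<le> s\<^sup>2" "0 \<le> s" "s \<le> 2"
      then have "(2 - min \<delta> 1)\<^sup>2 < s\<^sup>2" using cos(2) by simp
      then have "2 - min \<delta> 1 < s" by (rule power2_less_imp_less) (rule s(2))
      then have "\<bar>s - 2\<bar> < \<delta>" using s(3) \<delta>(1) by (auto simp: min_def split: if_splits)
      then show "f s \<le> ennreal M" using \<delta>(2)[of s] s(3) by simp
    qed
    \<comment> \<open>The distance is not a minimizer, so the implication holds vacuously.\<close>
    then show ?thesis by (intro ex[OF N(1)]) simp
  qed
qed

end
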